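(* Given $(\ell,u_0)\in Y'\times H$ and $\delta\in\Delta$, let $(\lambda^\delta,u^\delta)\in Y^\delta\times X^\delta$ be the solution of the saddle-point system, and let $\lambda_\delta:=A_s^{-1}(\ell-Bu^\delta)\in Y$. Suppose that for some $\varrho\ge0$, $$\|\lambda_\delta-\lambda^\delta\|_Y\le\varrho\,\sqrt{\|\lambda^\delta\|_Y^2+\Big(1+\tfrac{1}{(\varrho+\frac12)^2}\Big)\|u_0-\gamma_0u^\delta\|_H^2}\,.$$ Then $$\|u-u^\delta\|_X\le c(\alpha)\sqrt{\varrho^2+\tfrac{9\varrho+4}{4\varrho+4}}\ \inf_{\bar u^\delta\in X^\delta}\|u-\bar u^\delta\|_X,$$ where $u:=B_e^{-1}(\ell,u_0)$.
   Context: All spaces are real. Let $V\hookrightarrow H\simeq H'\hookrightarrow V'$ be a Gelfand triple of Hilbert spaces, $\mathrm{T}>0$, $\Xi:=(0,\mathrm{T})$. Let $A(t)\in\mathcal L(V,V')$ be bounded uniformly in a.e. $t\in\Xi$ and uniformly coercive: $(A(t)v)(v)\ge c\|v\|_V^2$ for all $v\in V$ and a.e. $t\in\Xi$, with $c>0$ independent of $t$ and $v$. Set $Y:=L_2(\Xi;V)$, $X:=Y\cap H^1(\Xi;V')$, and define $A\in\mathcal L(Y,Y')$, $\mathrm{d}_t\in\mathcal L(X,Y')$ by $(Aw)(v):=\int_\Xi (A(t)w(t))(v(t))\,dt$, $(\mathrm{d}_tw)(v):=\int_\Xi (\tfrac{dw}{dt}(t))(v(t))\,dt$. For $t\in\overline\Xi$,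 $\gamma_t\in\mathcal L(X,H)$ is the trace $w\mapsto w(t)$ (recall $X\hookrightarrow C(\overline\Xi;H)$). Set $B:=\mathrm{d}_t+A$ and $B_e:=(B,\gamma_0)\colon X\to Y'\times H$, which is boundedly invertible. Set $A_s:=\frac12(A+A')$, $A_a:=\frac12(A-A')$ (with $A'\colon Y\to Y'$ the adjoint). Norms: $\|v\|_Y:=\sqrt{(A_sv)(v)}$, $\|\cdot\|_{Y'}$ the corresponding dual norm, $\|w\|_X:=\sqrt{\|w\|_Y^2+\|\mathrm{d}_tw\|_{Y'}^2+\|\gamma_{\mathrm T}w\|_H^2}$. Set $\alpha:=\|A_a\|_{\mathcal L(Y,Y')}$ and $c(\alpha):=1+\frac{\alpha}{2}\big(\alpha+\sqrt{\alpha^2+4}\big)$. $(X^\delta)_{\delta\in\Delta}$, $(Y^\delta)_{\delta\in\Delta}$ are families of closed non-trivial subspaces of $X$ and $Y$. The index set $\Delta$ contains $\infty$, with $X^\infty=X$, $Y^\infty=Y$; for $\delta\ne\infty$ the spaces are finite-dimensional. It is always assumed that $X^\delta\subset Y^\delta$ for all $\delta\in\Delta$. For $g\in Y'$ put $\|g\|_{(Y^\delta)'}:=\sup_{0\ne v\in Y^\delta}g(v)/\|v\|_Y$. The saddle-point system, which is uniquely solvable, is: find $(\lambda^\delta,u^\delta)\in Y^\delta\times X^\delta$ with $(A_s\lambda^\delta)(v)+(Bu^\delta)(v)=\ell(v)$ for all $v\in Y^\delta$, and $(Bw)(\lambda^\delta)+\langle u_0-\gamma_0u^\delta,\gamma_0w\rangle_H=0$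 for all $w\in X^\delta$. Equivalently $u^\delta=\operatorname{argmin}_{w\in X^\delta}\|\ell-Bw\|_{(Y^\delta)'}^2+\|u_0-\gamma_0w\|_H^2$, with $\lambda^\delta\in Y^\delta$ the Riesz lift of $\ell-Bu^\delta$ in $Y^\delta$. *)

theory Defs
  imports "HOL-Analysis.Analysis"
begin

text \<open>
  Elements of the Bochner spaces over the time interval \<open>(0,T)\<close> are represented by functions
  on the reals; two functions that agree almost everywhere on \<open>(0,T)\<close> represent the same element.
  All norms, operators and traces below only depend on this equivalence class, and every closed
  subspace is a union of equivalence classes. The dual \<open>V'\<close> is the type \<open>'v \<Rightarrow>\<^sub>L real\<close>. Functionals
  on \<open>L\<^sub>2((0,T);V)\<close> are HOL functions of which only the values on that space matter. The spaces
  \<open>V\<close> and \<open>H\<close> are not required to be separable, so that the Bochner integral of the library is not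
  available; only integrals of real-valued functions are used.
\<close>

section \<open>Bochner spaces\<close>

abbreviation time_measure :: "real \<Rightarrow> real measure" where
  "time_measure T \<equiv> lebesgue_on {0<..<T}"

definition strongly_measurable :: "'a measure \<Rightarrow> ('a \<Rightarrow> 'b::topological_space) \<Rightarrow> bool" where
  "strongly_measurable M f \<longleftrightarrow>
     (\<exists>s. (\<forall>n. simple_function M (s n)) \<and> (AE x in M. (\<lambda>n::nat. s n x) \<longlonglongrightarrow> f x))"

definition L2_space :: "real \<Rightarrow> (real \<Rightarrow> 'b::real_normed_vector) set" where
  "L2_space T = {f. strongly_measurable (time_measure T) f \<and>
                    integrable (time_measure T) (\<lambda>t. (norm (f t))\<^sup>2)}"

definition L2_norm :: "real \<Rightarrow> (real \<Rightarrow> 'b::real_normed_vector) \<Rightarrow> real" where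
  "L2_norm T f = sqrt (LINT t|time_measure T. (norm (f t))\<^sup>2)"

definition test_function :: "real \<Rightarrow> (real \<Rightarrow> real) \<Rightarrow> bool" where
  "test_function T \<phi> \<longleftrightarrow>
     (\<forall>n t. (deriv ^^ n) \<phi> differentiable (at t)) \<and>
     (\<exists>a b. 0 < a \<and> b < T \<and> (\<forall>t. t \<notin> {a..b} \<longrightarrow> \<phi> t = 0))"

text \<open>
  The defining identity \<open>\<integral> \<phi>' f = - \<integral> \<phi> g\<close> of the distributional derivative is an identity in
  \<open>V'\<close>; it is written out on the elements of \<open>V\<close>, with which the integral commutes.
\<close>
definition has_weak_derivative ::
    "real \<Rightarrow> (real \<Rightarrow> 'v::real_normed_vector \<Rightarrow>\<^sub>L real) \<Rightarrow> (real \<Rightarrow> 'v \<Rightarrow>\<^sub>L real) \<Rightarrow> bool" where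
  "has_weak_derivative T f g \<longleftrightarrow>
     (\<forall>\<phi>. test_function T \<phi> \<longrightarrow>
        (\<forall>v. (LINT t|time_measure T. deriv \<phi> t * f t v) =
             - (LINT t|time_measure T. \<phi> t * g t v)))"

definition H1_space :: "real \<Rightarrow> (real \<Rightarrow> 'v::real_normed_vector \<Rightarrow>\<^sub>L real) set" where
  "H1_space T = {f \<in> L2_space T. \<exists>g \<in> L2_space T. has_weak_derivative T f g}"

definition weak_derivative ::
    "real \<Rightarrow> (real \<Rightarrow> 'v::real_normed_vector \<Rightarrow>\<^sub>L real) \<Rightarrow> (real \<Rightarrow> 'v \<Rightarrow>\<^sub>L real)" where
  "weak_derivative T f = (SOME g. g \<in> L2_space T \<and> has_weak_derivative T f g)"

section \<open>Gelfand triple and spatial operators\<close>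

definition gelfand_triple :: "('v::{real_inner,banach} \<Rightarrow>\<^sub>L 'h::{real_inner,banach}) \<Rightarrow> bool" where
  "gelfand_triple \<iota> \<longleftrightarrow> inj (blinfun_apply \<iota>) \<and> closure (range (blinfun_apply \<iota>)) = UNIV"

text \<open>The embedding \<open>H \<simeq> H' \<hookrightarrow> V'\<close>, mapping \<open>h\<close> to the functional \<open>v \<mapsto> \<langle>h, \<iota> v\<rangle>\<close>.\<close>
definition dual_emb :: "('v::{real_inner,banach} \<Rightarrow>\<^sub>L 'h::{real_inner,banach}) \<Rightarrow> 'h \<Rightarrow> 'v \<Rightarrow>\<^sub>L real" where
  "dual_emb \<iota> h = blinfun_inner_right h o\<^sub>L \<iota>"

definition admissible_operator ::
    "real \<Rightarrow> (real \<Rightarrow> 'v::{real_inner,banach} \<Rightarrow>\<^sub>L 'v \<Rightarrow>\<^sub>L real) \<Rightarrow> bool" where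
  "admissible_operator T A \<longleftrightarrow>
     (\<forall>v w. (\<lambda>t. A t v w) \<in> borel_measurable (time_measure T)) \<and>
     (\<exists>C. AE t in time_measure T. norm (A t) \<le> C) \<and>
     (\<exists>c>0. AE t in time_measure T. \<forall>v. A t v v \<ge> c * (norm v)\<^sup>2)"

section \<open>The spaces X and Y and the operators on them\<close>

definition Y_space :: "real \<Rightarrow> (real \<Rightarrow> 'v::{real_inner,banach}) set" where
  "Y_space T = L2_space T"

definition X_space ::
    "('v::{real_inner,banach} \<Rightarrow>\<^sub>L 'h::{real_inner,banach}) \<Rightarrow> real \<Rightarrow> (real \<Rightarrow> 'v) set" where
  "X_space \<iota> T = {w \<in> Y_space T. (\<lambda>t. dual_emb \<iota> (\<iota> (w t))) \<in> H1_space T}"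

definition Y_dual :: "real \<Rightarrow> ((real \<Rightarrow> 'v::{real_inner,banach}) \<Rightarrow> real) set" where
  "Y_dual T = {g.
     (\<forall>v\<in>Y_space T. \<forall>w\<in>Y_space T. g (\<lambda>t. v t + w t) = g v + g w) \<and>
     (\<forall>a. \<forall>v\<in>Y_space T. g (\<lambda>t. a *\<^sub>R v t) = a * g v) \<and>
     (\<exists>C. \<forall>v\<in>Y_space T. \<bar>g v\<bar> \<le> C * L2_norm T v)}"

definition op_A ::
    "real \<Rightarrow> (real \<Rightarrow> 'v::{real_inner,banach} \<Rightarrow>\<^sub>L 'v \<Rightarrow>\<^sub>L real) \<Rightarrow>
     (real \<Rightarrow> 'v) \<Rightarrow> (real \<Rightarrow> 'v) \<Rightarrow> real" where
  "op_A T A w v = (LINT t|time_measure T. A t (w t) (v t))"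

text \<open>The adjoint of \<open>F : Y \<rightarrow> Y'\<close>, with \<open>Y\<close> identified with its bidual.\<close>
definition adjoint_op :: "('y \<Rightarrow> 'y \<Rightarrow> real) \<Rightarrow> 'y \<Rightarrow> 'y \<Rightarrow> real" where
  "adjoint_op F w v = F v w"

definition op_As ::
    "real \<Rightarrow> (real \<Rightarrow> 'v::{real_inner,banach} \<Rightarrow>\<^sub>L 'v \<Rightarrow>\<^sub>L real) \<Rightarrow>
     (real \<Rightarrow> 'v) \<Rightarrow> (real \<Rightarrow> 'v) \<Rightarrow> real" where
  "op_As T A w v = 1/2 * (op_A T A w v + adjoint_op (op_A T A) w v)"

definition op_Aa ::
    "real \<Rightarrow> (real \<Rightarrow> 'v::{real_inner,banach} \<Rightarrow>\<^sub>L 'v \<Rightarrow>\<^sub>L real) \<Rightarrow>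
     (real \<Rightarrow> 'v) \<Rightarrow> (real \<Rightarrow> 'v) \<Rightarrow> real" where
  "op_Aa T A w v = 1/2 * (op_A T A w v - adjoint_op (op_A T A) w v)"

definition op_dt ::
    "('v::{real_inner,banach} \<Rightarrow>\<^sub>L 'h::{real_inner,banach}) \<Rightarrow> real \<Rightarrow>
     (real \<Rightarrow> 'v) \<Rightarrow> (real \<Rightarrow> 'v) \<Rightarrow> real" where
  "op_dt \<iota> T w v =
     (LINT t|time_measure T. weak_derivative T (\<lambda>t. dual_emb \<iota> (\<iota> (w t))) t (v t))"

definition op_B ::
    "('v::{real_inner,banach} \<Rightarrow>\<^sub>L 'h::{real_inner,banach}) \<Rightarrow> real \<Rightarrow>
     (real \<Rightarrow> 'v \<Rightarrow>\<^sub>L 'v \<Rightarrow>\<^sub>L real) \<Rightarrow> (real \<Rightarrow> 'v) \<Rightarrow> (real \<Rightarrow> 'v) \<Rightarrow> real" where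
  "op_B \<iota> T A w v = op_dt \<iota> T w v + op_A T A w v"

text \<open>The value at \<open>t\<close> of the representative in \<open>C([0,T];H)\<close>.\<close>
definition trace_at ::
    "('v::{real_inner,banach} \<Rightarrow>\<^sub>L 'h::{real_inner,banach}) \<Rightarrow> real \<Rightarrow> real \<Rightarrow> (real \<Rightarrow> 'v) \<Rightarrow> 'h" where
  "trace_at \<iota> T t w =
     (THE h. \<exists>z. continuous_on {0..T} z \<and> (AE s in time_measure T. z s = \<iota> (w s)) \<and> h = z t)"

section \<open>Norms\<close>

definition Y_norm ::
    "real \<Rightarrow> (real \<Rightarrow> 'v::{real_inner,banach} \<Rightarrow>\<^sub>L 'v \<Rightarrow>\<^sub>L real) \<Rightarrow> (real \<Rightarrow> 'v) \<Rightarrow> real" where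
  "Y_norm T A v = sqrt (op_As T A v v)"

definition nonzero :: "real \<Rightarrow> (real \<Rightarrow> 'v::{real_inner,banach}) \<Rightarrow> bool" where
  "nonzero T v \<longleftrightarrow> \<not> (AE t in time_measure T. v t = 0)"

definition Y_dual_norm ::
    "real \<Rightarrow> (real \<Rightarrow> 'v::{real_inner,banach} \<Rightarrow>\<^sub>L 'v \<Rightarrow>\<^sub>L real) \<Rightarrow>
     ((real \<Rightarrow> 'v) \<Rightarrow> real) \<Rightarrow> real" where
  "Y_dual_norm T A g = (SUP v\<in>{v \<in> Y_space T. nonzero T v}. g v / Y_norm T A v)"

definition X_norm ::
    "('v::{real_inner,banach} \<Rightarrow>\<^sub>L 'h::{real_inner,banach}) \<Rightarrow> real \<Rightarrow>
     (real \<Rightarrow> 'v \<Rightarrow>\<^sub>L 'v \<Rightarrow>\<^sub>L real) \<Rightarrow> (real \<Rightarrow> 'v) \<Rightarrow> real" where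
  "X_norm \<iota> T A w =
     sqrt ((Y_norm T A w)\<^sup>2 + (Y_dual_norm T A (op_dt \<iota> T w))\<^sup>2 + (norm (trace_at \<iota> T T w))\<^sup>2)"

definition asymmetry ::
    "real \<Rightarrow> (real \<Rightarrow> 'v::{real_inner,banach} \<Rightarrow>\<^sub>L 'v \<Rightarrow>\<^sub>L real) \<Rightarrow> real" where
  "asymmetry T A =
     (SUP w\<in>{w \<in> Y_space T. nonzero T w}. Y_dual_norm T A (op_Aa T A w) / Y_norm T A w)"

definition c_const :: "real \<Rightarrow> real" where
  "c_const \<alpha> = 1 + \<alpha> / 2 * (\<alpha> + sqrt (\<alpha>\<^sup>2 + 4))"

section \<open>Discretization\<close>

definition closed_nontrivial_subspace ::
    "real \<Rightarrow> ((real \<Rightarrow> 'v::{real_inner,banach}) \<Rightarrow> real) \<Rightarrow>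
     (real \<Rightarrow> 'v) set \<Rightarrow> (real \<Rightarrow> 'v) set \<Rightarrow> bool" where
  "closed_nontrivial_subspace T N W S \<longleftrightarrow>
     S \<subseteq> W \<and>
     (\<lambda>t. 0) \<in> S \<and>
     (\<forall>v\<in>S. \<forall>w\<in>S. (\<lambda>t. v t + w t) \<in> S) \<and>
     (\<forall>a. \<forall>v\<in>S. (\<lambda>t. a *\<^sub>R v t) \<in> S) \<and>
     (\<forall>f. \<forall>w\<in>W. (\<forall>n::nat. f n \<in> S) \<and> (\<lambda>n. N (\<lambda>t. f n t - w t)) \<longlonglongrightarrow> 0 \<longrightarrow> w \<in> S) \<and>
     (\<exists>v\<in>S. nonzero T v)"

definition finite_dimensional :: "real \<Rightarrow> (real \<Rightarrow> 'v::{real_inner,banach}) set \<Rightarrow> bool" where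
  "finite_dimensional T S \<longleftrightarrow>
     (\<exists>B. finite B \<and> B \<subseteq> S \<and>
        (\<forall>v\<in>S. \<exists>a. AE t in time_measure T. v t = (\<Sum>b\<in>B. a b *\<^sub>R b t)))"

definition discretization_family ::
    "('v::{real_inner,banach} \<Rightarrow>\<^sub>L 'h::{real_inner,banach}) \<Rightarrow> real \<Rightarrow>
     (real \<Rightarrow> 'v \<Rightarrow>\<^sub>L 'v \<Rightarrow>\<^sub>L real) \<Rightarrow> 'i set \<Rightarrow> 'i \<Rightarrow>
     ('i \<Rightarrow> (real \<Rightarrow> 'v) set) \<Rightarrow> ('i \<Rightarrow> (real \<Rightarrow> 'v) set) \<Rightarrow> bool" where
  "discretization_family \<iota> T A \<Delta> infty Xd Yd \<longleftrightarrow>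
     infty \<in> \<Delta> \<and> Xd infty = X_space \<iota> T \<and> Yd infty = Y_space T \<and>
     (\<forall>\<delta>\<in>\<Delta>. closed_nontrivial_subspace T (X_norm \<iota> T A) (X_space \<iota> T) (Xd \<delta>) \<and>
             closed_nontrivial_subspace T (Y_norm T A) (Y_space T) (Yd \<delta>) \<and>
             Xd \<delta> \<subseteq> Yd \<delta>) \<and>
     (\<forall>\<delta>\<in>\<Delta> - {infty}. finite_dimensional T (Xd \<delta>) \<and> finite_dimensional T (Yd \<delta>))"

definition saddle_point_solution ::
    "('v::{real_inner,banach} \<Rightarrow>\<^sub>L 'h::{real_inner,banach}) \<Rightarrow> real \<Rightarrow>
     (real \<Rightarrow> 'v \<Rightarrow>\<^sub>L 'v \<Rightarrow>\<^sub>L real) \<Rightarrow> (real \<Rightarrow> 'v) set \<Rightarrow> (real \<Rightarrow> 'v) set \<Rightarrow>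
     ((real \<Rightarrow> 'v) \<Rightarrow> real) \<Rightarrow> 'h \<Rightarrow> (real \<Rightarrow> 'v) \<Rightarrow> (real \<Rightarrow> 'v) \<Rightarrow> bool" where
  "saddle_point_solution \<iota> T A XS YS l u0 lam w0 \<longleftrightarrow>
     lam \<in> YS \<and> w0 \<in> XS \<and>
     (\<forall>v\<in>YS. op_As T A lam v + op_B \<iota> T A w0 v = l v) \<and>
     (\<forall>w\<in>XS. op_B \<iota> T A w lam + (u0 - trace_at \<iota> T 0 w0) \<bullet> trace_at \<iota> T 0 w = 0)"

end

theory Submission
  imports Defs
begin

text \<open>
  Put \<open>e = u - u\<^sub>\<delta>\<close>, let \<open>\<mu> = u\<^sub>0 - \<gamma>\<^sub>0 u\<^sub>\<delta>\<close> and write \<open>P\<close> for the orthogonal projection of \<open>Y\<close> onto the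
  discrete space. The Riesz lift \<open>\<lambda>\<close> of \<open>B e\<close> satisfies
  \<open>\<parallel>\<lambda>\<parallel>\<^sup>2 = \<parallel>P \<lambda>\<parallel>\<^sup>2 + \<parallel>\<lambda> - P \<lambda>\<parallel>\<^sup>2\<close>, so the hypothesis bounds \<open>\<parallel>\<lambda>\<parallel>\<^sup>2 + \<parallel>\<mu>\<parallel>\<^sup>2\<close> by a multiple of
  \<open>\<parallel>P \<lambda>\<parallel>\<^sup>2 + \<parallel>\<mu>\<parallel>\<^sup>2\<close>, and by the second saddle point equation the latter equals
  \<open>B (u - w) (P \<lambda>) + \<langle>\<mu>, \<gamma>\<^sub>0 (u - w)\<rangle>\<close> for every discrete \<open>w\<close>. Passing between
  \<open>\<parallel>B e\<parallel>\<^sup>2 + \<parallel>\<gamma>\<^sub>0 e\<parallel>\<^sup>2\<close> and the square of the \<open>X\<close>-norm costs a factor \<open>c(\<alpha>)\<close> each way,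
  the larger eigenvalue of the matrix with rows \<open>(1, \<alpha>)\<close> and \<open>(\<alpha>, 1 + \<alpha>\<^sup>2)\<close>.

  The analytic input is the formula \<open>2 (d\<^sub>t w)(w) = \<parallel>w(T)\<parallel>\<^sup>2 - \<parallel>w(0)\<parallel>\<^sup>2\<close>. Tested with \<open>w(r)\<close>, an increment
  \<open>w(t) - w(s)\<close> is the integral of \<open>w'(\<tau>)(w(r))\<close> over \<open>(s,t)\<close>. Hence \<open>\<parallel>w(t)\<parallel>\<^sup>2\<close> minus the primitive of
  \<open>2 w'(w)\<close> changes over a step \<open>h\<close> by an amount whose mean over the starting point is \<open>o(h)\<close>, because
  translations are continuous in the mean square; summing over many small steps, it is constant. The
  same increments yield a continuous representative.
\<close>

section \<open>Smooth functions of compact support\<close>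

text \<open>\<open>V\<close> and \<open>H\<close> may be nonseparable and only real integrals occur,
  so the weak derivative is tested with one fixed \<open>v\<close> at a time, and the exceptional
  null set depends on \<open>v\<close>. Strong measurability removes this obstacle: for almost every
  \<open>t\<close> the value \<open>w t\<close> lies in the closure of a countable set, so one null
  set serves for all \<open>v = w r\<close>. The \<open>V\<close>-norm of \<open>w r\<close> is not
  controlled at a single time, which is why the error \<open>o(h)\<close> is available only in the
  mean.

  The matrix arises as follows. Let \<open>r\<close> be the Riesz lift of
  \<open>d_t e + A_a e\<close>, so that the lift of \<open>B e\<close> is \<open>r + e\<close>. The
  energy formula gives exactly \<open>|r|^2 + |e|^2 + |e(T)|^2 = |r + e|^2 + |e(0)|^2\<close>. The
  norms of \<open>r\<close> and of \<open>d_t e\<close> differ by at most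
  \<open>\<alpha> |e|\<close>, in either direction, hence the form
  \<open>(m + \<alpha> y)^2 + y^2\<close> and the same constant both ways.

  With \<open>\<kappa> = 1 + 1/(\<rho> + 1/2)^2\<close>, the hypothesis yields the factor
  \<open>1 + \<rho>^2\<close> on the discrete multiplier and \<open>1 + \<rho>^2 \<kappa>\<close> on
  the initial residual. The rational function of \<open>\<rho>\<close> in the claim is an upper
  bound for the larger one, after splitting off \<open>\<rho>^2\<close>.\<close>

text \<open>The derivatives of \<open>exp (- 1 / x)\<close>, extended by zero to \<open>x \<le> 0\<close>, are all of this form.\<close>
definition flat_exp :: "real poly \<Rightarrow> real \<Rightarrow> real" where
  "flat_exp p x = (if x \<le> 0 then 0 else poly p (1 / x) * exp (- 1 / x))"

lemma poly_times_exp_minus_tendsto_0: "((\<lambda>y::real. poly q y * exp (- y)) \<longlongrightarrow> 0) at_top"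
proof -
  have "((\<lambda>y::real. \<Sum>i\<le>degree q. coeff q i * (y ^ i / exp y)) \<longlongrightarrow> (\<Sum>i\<le>degree q. coeff q i * 0)) at_top"
    by (intro tendsto_sum tendsto_mult tendsto_const tendsto_power_div_exp_0)
  moreover have "(\<lambda>y::real. \<Sum>i\<le>degree q. coeff q i * (y ^ i / exp y)) = (\<lambda>y. poly q y * exp (- y))"
    by (simp add: poly_altdef sum_distrib_right exp_minus divide_inverse mult.assoc)
  ultimately show ?thesis by simp
qed

text \<open>For \<open>x > 0\<close> the chain rule turns \<open>p(1/x) exp(-1/x)\<close> into
  \<open>(p - p')(1/x) exp(-1/x) / x^2\<close>, and the factor \<open>1/x^2\<close> is absorbed as
  the polynomial \<open>[:0, 0, 1:]\<close>. At \<open>0\<close> the difference quotient becomes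
  \<open>y p(y) exp(-y)\<close> under \<open>y = 1/x\<close>, which tends to
  \<open>0\<close>.\<close>

lemma flat_exp_has_derivative:
  "(flat_exp p has_real_derivative flat_exp ([:0, 0, 1:] * (p - pderiv p)) x) (at x)"
proof -
  let ?q = "[:0, 0, 1:] * (p - pderiv p)"
  consider "x < 0" | "x = 0" | "x > 0" by linarith
  then show ?thesis
  proof cases
    case 1
    have "((\<lambda>x. 0) has_real_derivative 0) (at x)" by simp
    moreover have "eventually (\<lambda>y. y < 0) (nhds x)" using 1 by (intro eventually_nhds_in_open[of "{..<0}", simplified]) auto
    ultimately have "(flat_exp p has_real_derivative 0) (at x)"
      by (subst DERIV_cong_ev[OF refl _ refl]) (auto elim!: eventually_mono simp: flat_exp_def)
    then show ?thesis using 1 by (simp add: flat_exp_def)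
  next
    case 3
    have d: "((\<lambda>x. poly p (1 / x) * exp (- 1 / x)) has_real_derivative
        (poly (pderiv p) (1 / x) * (- 1 / x^2)) * exp (- 1 / x) + poly p (1 / x) * (exp (- 1 / x) * (1 / x^2))) (at x)"
      using 3 by (auto intro!: derivative_eq_intros simp: power2_eq_square)
    have "eventually (\<lambda>y. y > 0) (nhds x)" using 3 by (intro eventually_nhds_in_open[of "{0<..}", simplified]) auto
    then have "(flat_exp p has_real_derivative
        (poly (pderiv p) (1 / x) * (- 1 / x^2)) * exp (- 1 / x) + poly p (1 / x) * (exp (- 1 / x) * (1 / x^2))) (at x)"
      using d by (subst DERIV_cong_ev[OF refl _ refl]) (auto elim!: eventually_mono simp: flat_exp_def)
    then show ?thesis using 3 by (simp add: flat_exp_def power2_eq_square field_simps)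
  next
    case 2
    have "((\<lambda>y. flat_exp p y / y) \<longlongrightarrow> 0) (at_left 0)"
      by (rule Lim_transform_eventually[OF tendsto_const])
        (auto simp: flat_exp_def eventually_at_filter intro!: always_eventually)
    moreover have "((\<lambda>y. flat_exp p y / y) \<longlongrightarrow> 0) (at_right 0)"
    proof (subst filterlim_at_right_to_top, rule Lim_transform_eventually)
      show "((\<lambda>y::real. poly ([:0, 1:] * p) y * exp (- y)) \<longlongrightarrow> 0) at_top"
        by (rule poly_times_exp_minus_tendsto_0)
      show "eventually (\<lambda>y. poly ([:0, 1:] * p) y * exp (- y) = flat_exp p (inverse y) / inverse y) at_top"
        using eventually_gt_at_top[of 0]
        by eventually_elim (simp add: flat_exp_def field_simps)
    qed
    ultimately have "((\<lambda>y. flat_exp p y / y) \<longlongrightarrow> 0) (at 0)"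
      by (simp add: filterlim_at_split)
    then show ?thesis using 2 by (simp add: has_field_derivative_iff flat_exp_def)
  qed
qed

text \<open>Closure under differentiation gives smoothness of every member at once, as
  \<open>test_function\<close> demands for all iterated derivatives, without a formula for any of
  them.\<close>

inductive_set flat_algebra :: "(real \<Rightarrow> real) set" where
  flat: "(\<lambda>x. flat_exp p (c * x + d)) \<in> flat_algebra"
| add: "f \<in> flat_algebra \<Longrightarrow> g \<in> flat_algebra \<Longrightarrow> (\<lambda>x. f x + g x) \<in> flat_algebra"
| mult: "f \<in> flat_algebra \<Longrightarrow> g \<in> flat_algebra \<Longrightarrow> (\<lambda>x. f x * g x) \<in> flat_algebra"

lemma flat_algebra_derivative:
  "f \<in> flat_algebra \<Longrightarrow> \<exists>f'\<in>flat_algebra. \<forall>x. (f has_real_derivative f' x) (at x)"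
proof (induction rule: flat_algebra.induct)
  case (flat p c d)
  let ?q = "smult c ([:0, 0, 1:] * (p - pderiv p))"
  have der: "((\<lambda>x. flat_exp p (c * x + d)) has_real_derivative flat_exp ?q (c * x + d)) (at x)" for x
  proof -
    have "((\<lambda>x. flat_exp p (c * x + d)) has_real_derivative
        flat_exp ([:0, 0, 1:] * (p - pderiv p)) (c * x + d) * c) (at x)"
      by (rule DERIV_chain2[OF flat_exp_has_derivative]) (auto intro!: derivative_eq_intros)
    moreover have "flat_exp (smult c q) y = flat_exp q y * c" for q y by (simp add: flat_exp_def)
    ultimately show ?thesis by (simp only:)
  qed
  show ?case by (rule bexI[OF _ flat_algebra.flat], rule allI, rule der)
next
  case (add f g)
  then obtain f' g' where "f' \<in> flat_algebra" "g' \<in> flat_algebra"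
    "\<forall>x. (f has_real_derivative f' x) (at x)" "\<forall>x. (g has_real_derivative g' x) (at x)" by blast
  then show ?case
    by (intro bexI[of _ "\<lambda>x. f' x + g' x"]) (auto intro: flat_algebra.add DERIV_add)
next
  case (mult f g)
  then obtain f' g' where "f' \<in> flat_algebra" "g' \<in> flat_algebra"
    "\<forall>x. (f has_real_derivative f' x) (at x)" "\<forall>x. (g has_real_derivative g' x) (at x)" by blast
  then show ?case using mult.hyps
    by (intro bexI[of _ "\<lambda>x. f' x * g x + g' x * f x"])
      (auto intro: flat_algebra.add flat_algebra.mult DERIV_mult)
qed

lemma flat_algebra_deriv:
  assumes "f \<in> flat_algebra"
  shows "deriv f \<in> flat_algebra" "f differentiable (at x)"
proof -
  obtain f' where f': "f' \<in> flat_algebra" "\<And>x. (f has_real_derivative f' x) (at x)"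
    using flat_algebra_derivative[OF assms] by blast
  then have "deriv f = f'" by (auto intro: DERIV_imp_deriv)
  with f' show "deriv f \<in> flat_algebra" "f differentiable (at x)"
    by (auto simp: real_differentiable_def)
qed

lemma flat_algebra_funpow_deriv: "f \<in> flat_algebra \<Longrightarrow> (deriv ^^ n) f \<in> flat_algebra"
  by (induction n) (auto intro: flat_algebra_deriv)

lemma flat_algebra_continuous: "f \<in> flat_algebra \<Longrightarrow> continuous_on S f"
  by (meson continuous_at_imp_continuous_on differentiable_imp_continuous_within flat_algebra_deriv(2))

text \<open>Constants do not belong to the algebra by its rules, so the sign is absorbed by the
  polynomial of a generator, and in a product by the first factor.\<close>

lemma flat_algebra_uminus: 
  assumes "f \<in> flat_algebra" shows "(\<lambda>x. - f x) \<in> flat_algebra"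
  using assms
proof (induction rule: flat_algebra.induct)
  case (flat p c d)
  have "(\<lambda>x. - flat_exp p (c * x + d)) = (\<lambda>x. flat_exp (- p) (c * x + d))"
    by (auto simp: flat_exp_def)
  then show ?case by (metis flat_algebra.flat)
next
  case (add f g)
  from flat_algebra.add[OF add.IH] show ?case by simp
next
  case (mult f g)
  from flat_algebra.mult[OF mult.IH(1) mult.hyps(2)] show ?case by simp
qed

section \<open>Bump functions and test functions obtained as primitives\<close>

text \<open>One factor vanishes to the left of \<open>a\<close>, the other to the right of
  \<open>b\<close>. Since \<open>exp (- 1 / (k y))\<close> tends to \<open>1\<close> for every fixed
  \<open>y > 0\<close> as \<open>k\<close> grows, the steeper and steeper bumps converge to the
  indicator of the open interval; \<open>Suc n\<close> keeps the scaling positive at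
  \<open>n = 0\<close>.\<close>

definition bump :: "real \<Rightarrow> real \<Rightarrow> nat \<Rightarrow> real \<Rightarrow> real" where
  "bump a b n x = flat_exp 1 (real (Suc n) * (x - a)) * flat_exp 1 (real (Suc n) * (b - x))"

lemma bump_flat_algebra: "bump a b n \<in> flat_algebra"
proof -
  have "bump a b n = (\<lambda>x. flat_exp 1 (real (Suc n) * x + (- real (Suc n) * a))
      * flat_exp 1 ((- real (Suc n)) * x + real (Suc n) * b))"
    by (rule ext) (simp add: bump_def right_diff_distrib del: of_nat_Suc)
  then show ?thesis by (metis flat_algebra.flat flat_algebra.mult)
qed

lemma flat_exp_1_bounds: "0 \<le> flat_exp 1 x" "flat_exp 1 x \<le> 1"
  by (auto simp: flat_exp_def)

lemma bump_bounds: "0 \<le> bump a b n x" "bump a b n x \<le> 1"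
  by (auto simp: bump_def flat_exp_1_bounds mult_le_one)

lemma bump_eq_0: "x \<notin> {a<..<b} \<Longrightarrow> bump a b n x = 0"
  by (auto simp: bump_def flat_exp_def mult_le_0_iff not_less simp del: of_nat_Suc)

lemma bump_translate: "bump (a + H) (b + H) n (x + H) = bump a b n x"
  by (simp add: bump_def)

lemma bump_tendsto: "(\<lambda>n. bump a b n x) \<longlonglongrightarrow> indicator {a<..<b} x"
proof (cases "x \<in> {a<..<b}")
  case True
  have lim: "(\<lambda>n. flat_exp 1 (real (Suc n) * y)) \<longlonglongrightarrow> 1" if "y > 0" for y
  proof -
    have "(\<lambda>n. exp (- (inverse (real (Suc n)) * (1 / y)))) \<longlonglongrightarrow> exp (- (0 * (1 / y)))"
      by (intro tendsto_intros LIMSEQ_inverse_real_of_nat)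
    then have *: "(\<lambda>n. exp (- (inverse (real (Suc n)) * (1 / y)))) \<longlonglongrightarrow> 1" by simp
    show ?thesis
      by (rule Lim_transform_eventually[OF *])
        (use that in \<open>auto intro!: always_eventually simp: flat_exp_def field_simps mult_le_0_iff simp del: of_nat_Suc\<close>)
  qed
  show ?thesis using True tendsto_mult[OF lim[of "x - a"] lim[of "b - x"]]
    by (simp add: bump_def)
qed (simp add: bump_eq_0)

lemma bump_test_function:
  assumes "0 < a" "b < T"
  shows "test_function T (bump a b n)"
  unfolding test_function_def
  using assms bump_eq_0 flat_algebra_deriv flat_algebra_funpow_deriv bump_flat_algebra
  by (metis greaterThanLessThan_iff atLeastAtMost_iff less_imp_le)

text \<open>Mean value zero is what makes the primitive vanish again to the right of the support.
  Every such \<open>f\<close> is thereby the derivative of a test function and may be inserted into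
  the left-hand side of the identity defining a weak derivative.\<close>

lemma primitive_test_function:
  assumes f: "f \<in> flat_algebra" and ab: "0 < a" "b < T" and sup: "\<And>x. x \<notin> {a..b} \<Longrightarrow> f x = 0"
    and zero: "integral {a..b} f = 0"
  shows "test_function T (\<lambda>t. integral {0..t} f)" "deriv (\<lambda>t. integral {0..t} f) = f"
proof -
  let ?F = "\<lambda>t. integral {0..t} f"
  have int: "f integrable_on {x..y}" for x y
    by (rule integrable_continuous_real[OF flat_algebra_continuous[OF f]])
  have vanish: "integral {x..y} f = 0" if "\<And>s. x < s \<Longrightarrow> s < y \<Longrightarrow> f s = 0" for x y
  proof -
    have "integral {x..y} f = integral {x..y} (\<lambda>x. 0)"
      by (rule integral_spike[of "{x, y}"]) (use that in force)+
    then show ?thesis by simp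
  qed
  have before: "?F t = 0" if "t < a" for t
    using that sup by (intro vanish) auto
  have der: "(?F has_real_derivative f t) (at t)" for t
  proof (cases "t > 0")
    case True
    have "(?F has_real_derivative f t) (at t within {0..t + 1})"
      by (rule integral_has_real_derivative) (use True flat_algebra_continuous[OF f] in auto)
    moreover have "at t within {0..t + 1} = at t"
      by (rule at_within_interior) (use True in auto)
    ultimately show ?thesis by simp
  next
    case False
    have "eventually (\<lambda>y. y < a) (nhds t)" using False ab by (intro eventually_nhds_in_open[of "{..<a}", simplified]) auto
    then have "(?F has_real_derivative 0) (at t)"
      by (subst DERIV_cong_ev[OF refl _ refl, where g="\<lambda>_. 0"]) (auto elim!: eventually_mono simp: before)
    then show ?thesis using False ab sup[of t] by simp
  qed
  then show deriv_F: "deriv ?F = f" by (auto intro: DERIV_imp_deriv)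
  have after: "?F t = 0" if "t > b" "t \<ge> a" for t
  proof -
    have "?F t = integral {0..a} f + integral {a..t} f"
      using ab that by (intro Henstock_Kurzweil_Integration.integral_combine[symmetric] int) auto
    also have "integral {0..a} f = 0"
      using sup by (intro vanish) auto
    also have "integral {a..t} f = integral {a..b} f"
    proof (cases "a \<le> b")
      case True
      then have "integral {a..t} f = integral {a..b} f + integral {b..t} f"
        using that by (intro Henstock_Kurzweil_Integration.integral_combine[symmetric] int) auto
      also have "integral {b..t} f = 0" using sup by (intro vanish) auto
      finally show ?thesis by simp
    next
      case False
      then have "f = (\<lambda>_. 0)" using sup by auto
      then show ?thesis by simp
    qed
    finally show ?thesis using zero by simp
  qed
  have "(deriv ^^ n) ?F differentiable (at t)" for n t
  proof (cases n)
    case 0 then show ?thesis using der by (auto simp: real_differentiable_def)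
  next
    case (Suc m)
    then have "(deriv ^^ n) ?F = (deriv ^^ m) f" by (simp only: funpow_Suc_right o_def deriv_F)
    then show ?thesis by (simp add: f flat_algebra_funpow_deriv flat_algebra_deriv)
  qed
  \<comment> \<open>For \<open>b < a\<close> the support condition forces \<open>f = 0\<close>; the
    bound \<open>max a b\<close> treats this degenerate case along with the proper one.\<close>
  moreover have "?F t = 0" if "t \<notin> {a..max a b}" for t
    using that before after by force
  moreover have "max a b < T \<or> (\<forall>t. ?F t = 0)"
  proof (cases "a \<le> b")
    case False
    then have "f = (\<lambda>_. 0)" using sup by auto
    then show ?thesis by simp
  qed (use ab in auto)
  ultimately show "test_function T ?F" unfolding test_function_def using ab by metis
qed

section \<open>Strong measurability\<close>

lemma strongly_measurable_compose2:
  fixes H :: "'b::topological_space \<Rightarrow> 'c::topological_space \<Rightarrow> 'd::topological_space"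
  assumes f: "strongly_measurable M f" and g: "strongly_measurable M g"
    and H: "continuous_on UNIV (\<lambda>p. H (fst p) (snd p))"
  shows "strongly_measurable M (\<lambda>x. H (f x) (g x))"
proof -
  obtain s where s: "\<And>n. simple_function M (s n)" "AE x in M. (\<lambda>n::nat. s n x) \<longlonglongrightarrow> f x"
    using f unfolding strongly_measurable_def by auto
  obtain t where t: "\<And>n. simple_function M (t n)" "AE x in M. (\<lambda>n::nat. t n x) \<longlonglongrightarrow> g x"
    using g unfolding strongly_measurable_def by auto
  have "AE x in M. (\<lambda>n. H (s n x) (t n x)) \<longlonglongrightarrow> H (f x) (g x)"
    using s(2) t(2)
  proof eventually_elim
    case (elim x)
    show ?case
      using continuous_on_tendsto_compose[OF H tendsto_Pair[OF elim]] by simp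
  qed
  moreover have "\<And>n. simple_function M (\<lambda>x. H (s n x) (t n x))"
    by (rule simple_function_compose2[OF s(1) t(1)])
  ultimately show ?thesis
    unfolding strongly_measurable_def by (intro exI[of _ "\<lambda>n x. H (s n x) (t n x)"]) simp
qed

lemma strongly_measurable_compose:
  assumes "strongly_measurable M f" "continuous_on UNIV H"
  shows "strongly_measurable M (\<lambda>x. H (f x))"
  by (rule strongly_measurable_compose2[OF assms(1,1), of "\<lambda>x y. H x"])
    (rule continuous_on_compose2[OF assms(2)], auto intro: continuous_intros)

text \<open>Bounding the approximants by the limit makes dominated convergence applicable.\<close>
definition simple_limit :: "(real \<Rightarrow> 'b::real_normed_vector) \<Rightarrow> bool" where
  "simple_limit f \<longleftrightarrow> (\<exists>s. (\<forall>n. simple_function lborel (s n)) \<and> (\<forall>x. (\<lambda>n::nat. s n x) \<longlonglongrightarrow> f x)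
     \<and> (\<forall>n x. norm (s n x) \<le> 2 * norm (f x)))"

text \<open>Applying \<open>H\<close> to the simple approximants gives real functions with finitely
  many values, and measurability passes to their pointwise limit, so no measurable structure on the
  vector spaces is involved. The inner maps \<open>p\<close> and \<open>q\<close> may live on a
  product space; this yields joint measurability of expressions such as
  \<open>norm (w (r + h) - w \<tau>)\<close> in both variables.\<close>

lemma simple_limit_compose2_measurable:
  fixes H :: "'b::real_normed_vector \<Rightarrow> 'c::real_normed_vector \<Rightarrow> real"
  assumes f: "simple_limit f" and g: "simple_limit g"
    and H: "continuous_on UNIV (\<lambda>p. H (fst p) (snd p))"
    and p: "p \<in> borel_measurable M" and q: "q \<in> borel_measurable M"
  shows "(\<lambda>x. H (f (p x)) (g (q x))) \<in> borel_measurable M"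
proof -
  obtain s where s: "\<And>n. simple_function lborel (s n)" "\<And>x. (\<lambda>n::nat. s n x) \<longlonglongrightarrow> f x"
    using f unfolding simple_limit_def by auto
  obtain t where t: "\<And>n. simple_function lborel (t n)" "\<And>x. (\<lambda>n::nat. t n x) \<longlonglongrightarrow> g x"
    using g unfolding simple_limit_def by auto
  show ?thesis
  proof (rule borel_measurable_LIMSEQ_real)
    show "(\<lambda>n. H (s n (p x)) (t n (q x))) \<longlonglongrightarrow> H (f (p x)) (g (q x))" for x
      using continuous_on_tendsto_compose[OF H tendsto_Pair[OF s(2)[of "p x"] t(2)[of "q x"]]] by simp
    show "(\<lambda>x. H (s n (p x)) (t n (q x))) \<in> borel_measurable M" for n
      using p q
      by (intro borel_measurable_simple_function
          simple_function_compose2[OF simple_function_comp[OF _ s(1)] simple_function_comp[OF _ t(1)]]) simp_all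
  qed
qed

lemma continuous_on_norm_pair:
  "continuous_on UNIV (\<lambda>p::'b::real_normed_vector \<times> 'b. norm (fst p - snd p))"
  "continuous_on UNIV (\<lambda>p::'b \<times> 'c::real_normed_vector. norm (fst p))"
  by (auto intro!: continuous_on_norm continuous_on_diff continuous_on_fst continuous_on_snd continuous_on_id)

lemma simple_limit_norm_diff_measurable:
  assumes "simple_limit f" "p \<in> borel_measurable M" "q \<in> borel_measurable M"
  shows "(\<lambda>x. norm (f (p x) - f (q x))) \<in> borel_measurable M"
  by (rule simple_limit_compose2_measurable[OF assms(1,1) continuous_on_norm_pair(1) assms(2,3)])

lemma simple_limit_norm_measurable:
  assumes "simple_limit f" "p \<in> borel_measurable M"
  shows "(\<lambda>x. norm (f (p x))) \<in> borel_measurable M"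
  by (rule simple_limit_compose2_measurable[OF assms(1,1) continuous_on_norm_pair(2) assms(2,2)])

section \<open>Passage from the completed measure on the interval to Borel functions on the
  line\<close>

lemma time_measure_AE_iff:
  "(AE x in time_measure T. P x) \<longleftrightarrow> (AE x in lborel. x \<in> {0<..<T} \<longrightarrow> P x)"
  by (subst AE_restrict_space_iff) (auto simp: AE_completion_iff)

lemma simple_function_zero_extension:
  assumes f: "simple_function (restrict_space M S) f" and S: "S \<in> sets M"
  shows "simple_function M (\<lambda>x. if x \<in> S then f x else (0::'b::zero))" (is "simple_function M ?g")
  unfolding simple_function_def
proof safe
  have sp: "space (restrict_space M S) = S" using sets.sets_into_space[OF S] by (auto simp: space_restrict_space)
  have "?g ` space M \<subseteq> insert 0 (f ` S)" by auto
  then show "finite (?g ` space M)"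
    using simple_functionD(1)[OF f] finite_subset by (auto simp: sp)
  fix x
  have "f -` {?g x} \<inter> S \<in> sets (restrict_space M S)"
    using simple_functionD(2)[OF f] by (simp add: sp)
  then have "f -` {?g x} \<inter> S \<in> sets M"
    using S by (subst (asm) sets_restrict_space_iff) auto
  moreover have "?g -` {?g x} \<inter> space M = (f -` {?g x} \<inter> S) \<union> (if ?g x = 0 then space M - S else {})"
    using sets.sets_into_space[OF S] by (auto split: if_splits)
  ultimately show "?g -` {?g x} \<inter> space M \<in> sets M" using S by auto
qed

text \<open>Each approximant is simple for the completed measure and agrees almost everywhere with a
  Borel simple function. One Borel null set \<open>N\<close> absorbs the countably many exceptions
  together with the points without convergence, and \<open>f'\<close> is set to zero on it.\<close>

lemma strongly_measurable_simple_limit: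
  fixes f :: "real \<Rightarrow> 'b::real_normed_vector"
  assumes "strongly_measurable (time_measure T) f"
  obtains f' where "simple_limit f'" "\<And>x. x \<notin> {0<..<T} \<Longrightarrow> f' x = 0"
    "AE x in lborel. x \<in> {0<..<T} \<longrightarrow> f x = f' x"
proof -
  let ?I = "{0<..<T}"
  obtain s where s: "\<And>n. simple_function (time_measure T) (s n)"
    "AE x in time_measure T. (\<lambda>n::nat. s n x) \<longlonglongrightarrow> f x"
    using assms unfolding strongly_measurable_def by auto
  have "simple_function lebesgue (\<lambda>x. if x \<in> ?I then s n x else 0)" for n
    using s(1) by (intro simple_function_zero_extension) auto
  then have "\<exists>s'. simple_function lborel s' \<and> (AE x in lborel. (if x \<in> ?I then s n x else 0) = s' x)" for n
    by (rule completion_ex_simple_function)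
  then have "\<exists>s'. \<forall>n. simple_function lborel (s' n) \<and> (AE x in lborel. (if x \<in> ?I then s n x else 0) = s' n x)"
    by (intro choice allI)
  then obtain s' where s': "\<And>n. simple_function lborel (s' n)"
    "\<And>n. AE x in lborel. (if x \<in> ?I then s n x else 0) = s' n x" by blast
  have "AE x in lborel. x \<in> ?I \<longrightarrow> (\<lambda>n. s' n x) \<longlonglongrightarrow> f x"
  proof -
    have "AE x in lborel. \<forall>n. (if x \<in> ?I then s n x else 0) = s' n x"
      using s'(2) by (simp add: AE_all_countable)
    with s(2)[unfolded time_measure_AE_iff] show ?thesis
      by eventually_elim auto
  qed
  then obtain N where sub: "{x \<in> space lborel. \<not> (x \<in> ?I \<longrightarrow> (\<lambda>n. s' n x) \<longlonglongrightarrow> f x)} \<subseteq> N"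
    and N: "emeasure lborel N = 0" "N \<in> sets lborel"
    by (rule AE_E)
  have lim: "(\<lambda>n. s' n x) \<longlonglongrightarrow> f x" if "x \<notin> N" "x \<in> ?I" for x
    using sub that by auto
  define f' where "f' x = (if x \<in> ?I - N then f x else 0)" for x
  define t where "t n x = (if x \<in> ?I - N then s' n x else 0)" for n x
  \<comment> \<open>Discarding values larger than twice the limit does not spoil convergence: where
    \<open>f' x\<close> is nonzero this happens only finitely often, and where
    \<open>f' x = 0\<close> it leaves the constant sequence zero.\<close>
  define r where "r n x = (if norm (t n x) \<le> 2 * norm (f' x) then t n x else 0)" for n x
  have t: "simple_function lborel (t n)" for n
    unfolding t_def using N(2) by (intro simple_function_If s') auto
  have t_lim: "(\<lambda>n. t n x) \<longlonglongrightarrow> f' x" for x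
    using lim by (auto simp: t_def f'_def)
  have [measurable]: "(\<lambda>x. norm (t n x)) \<in> borel_measurable lborel" for n
    by (rule borel_measurable_simple_function, rule simple_function_compose1[OF t])
  have [measurable]: "(\<lambda>x. norm (f' x)) \<in> borel_measurable lborel"
    by (rule borel_measurable_LIMSEQ_real[where u="\<lambda>n x. norm (t n x)"]) (auto intro: tendsto_norm t_lim)
  have "simple_function lborel (r n)" for n
    unfolding r_def by (intro simple_function_If t) auto
  moreover have "(\<lambda>n. r n x) \<longlonglongrightarrow> f' x" for x
  proof (cases "f' x = 0")
    case False
    then have "eventually (\<lambda>n. norm (t n x) < 2 * norm (f' x)) sequentially"
      by (intro order_tendstoD(2)[OF tendsto_norm[OF t_lim]]) auto
    then have "eventually (\<lambda>n. t n x = r n x) sequentially"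
      by eventually_elim (auto simp: r_def)
    then show ?thesis by (rule Lim_transform_eventually[OF t_lim])
  next
    case True
    then have "r n x = 0" for n by (simp add: r_def)
    then show ?thesis using True by simp
  qed
  moreover have "norm (r n x) \<le> 2 * norm (f' x)" for n x by (auto simp: r_def)
  ultimately have "simple_limit f'" unfolding simple_limit_def by blast
  moreover have "AE x in lborel. x \<in> ?I \<longrightarrow> f x = f' x"
    by (rule AE_I[of _ _ N]) (use N in \<open>auto simp: f'_def\<close>)
  moreover have "f' x = 0" if "x \<notin> ?I" for x
    unfolding f'_def by (rule if_not_P) (use that in blast)
  ultimately show ?thesis using that by blast
qed

text \<open>These three facts move scalar integrals to \<open>lborel\<close>, where translations and
  product measures are at hand. Vanishing of \<open>f'\<close> outside the interval makes
  restricting the domain harmless.\<close>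

lemma
  fixes f f' :: "real \<Rightarrow> real"
  assumes f': "f' \<in> borel_measurable borel" and eq: "AE x in lborel. x \<in> {0<..<T} \<longrightarrow> f x = f' x"
  shows time_measure_measurable: "f \<in> borel_measurable (time_measure T)"
    and time_measure_integrable: "(\<And>x. x \<notin> {0<..<T} \<Longrightarrow> f' x = 0) \<Longrightarrow> integrable (time_measure T) f \<longleftrightarrow> integrable lborel f'"
    and time_measure_integral: "(\<And>x. x \<notin> {0<..<T} \<Longrightarrow> f' x = 0) \<Longrightarrow> (LINT x|time_measure T. f x) = (LINT x|lborel. f' x)"
proof -
  let ?I = "{0<..<T}"
  let ?g = "\<lambda>x. indicator ?I x *\<^sub>R f x" and ?g' = "\<lambda>x. indicator ?I x *\<^sub>R f' x"
  have m': "?g' \<in> borel_measurable borel" using f' by measurable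
  then have ml': "?g' \<in> borel_measurable lebesgue" by (simp add: measurable_completion)
  have e: "AE x in lebesgue. ?g' x = ?g x"
    using eq by (auto simp: AE_completion_iff indicator_def elim: eventually_mono)
  have ml: "?g \<in> borel_measurable lebesgue" by (rule borel_measurable_AE[OF ml' e])
  then show "f \<in> borel_measurable (time_measure T)"
    by (subst borel_measurable_restrict_space_iff) (simp_all add: mult.commute)
  assume 0: "\<And>x. x \<notin> ?I \<Longrightarrow> f' x = 0"
  then have g': "?g' = f'" by (auto simp: indicator_def fun_eq_iff)
  have "integrable lebesgue ?g \<longleftrightarrow> integrable lebesgue ?g'"
    by (rule integrable_cong_AE) (use ml ml' e in auto)
  also have "\<dots> \<longleftrightarrow> integrable lborel f'"
    unfolding g' by (rule integrable_completion) (use f' in simp)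
  finally show "integrable (time_measure T) f \<longleftrightarrow> integrable lborel f'"
    by (subst integrable_restrict_space) auto
  have "integral\<^sup>L lebesgue ?g = integral\<^sup>L lebesgue ?g'"
    by (rule integral_cong_AE) (use ml ml' e in auto)
  also have "\<dots> = integral\<^sup>L lborel f'"
    unfolding g' by (rule integral_completion) (use f' in simp)
  finally show "(LINT x|time_measure T. f x) = (LINT x|lborel. f' x)"
    by (subst integral_restrict_space) auto
qed

lemma strongly_measurable_imp_borel_measurable:
  fixes f :: "real \<Rightarrow> real"
  assumes "strongly_measurable (time_measure T) f"
  shows "f \<in> borel_measurable (time_measure T)"
proof -
  obtain f' where f': "simple_limit f'" "\<And>x. x \<notin> {0<..<T} \<Longrightarrow> f' x = 0"
    "AE x in lborel. x \<in> {0<..<T} \<longrightarrow> f x = f' x"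
    by (rule strongly_measurable_simple_limit[OF assms]) (rule that)
  have "(\<lambda>x. f' x) \<in> borel_measurable borel"
    by (rule simple_limit_compose2_measurable[OF f'(1) f'(1), of "\<lambda>x y. x" "\<lambda>x. x" borel "\<lambda>x. x"])
      (rule continuous_on_fst[OF continuous_on_id] | simp)+
  from this f'(3) show ?thesis by (rule time_measure_measurable)
qed

text \<open>Strong measurability replaces separability of the target space.\<close>
lemma strongly_measurable_separable_range:
  fixes f :: "real \<Rightarrow> 'b::real_normed_vector"
  assumes "strongly_measurable M f"
  obtains D where "countable D" "AE x in M. f x \<in> closure D"
proof -
  obtain s where s: "\<And>n. simple_function M (s n)" "AE x in M. (\<lambda>n::nat. s n x) \<longlonglongrightarrow> f x"
    using assms unfolding strongly_measurable_def by auto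
  let ?D = "\<Union>n. s n ` space M"
  have "countable ?D"
    using simple_functionD(1)[OF s(1)] by (auto intro: countable_finite)
  moreover have "AE x in M. f x \<in> closure ?D"
    using s(2) AE_space
  proof eventually_elim
    case (elim x)
    then show ?case unfolding closure_sequential by (intro exI[of _ "\<lambda>n. s n x"]) auto
  qed
  ultimately show ?thesis by (rule that)
qed

section \<open>Scalar weak derivatives\<close>

text \<open>By Lebesgue differentiation the averages over \<open>[x, x + h]\<close> converge to
  \<open>f x\<close> at almost every \<open>x\<close>, whereas for \<open>x\<close> inside the
  interval and small \<open>h\<close> they are all zero.\<close>

lemma AE_eq_0_if_interval_integrals_0:
  fixes f :: "real \<Rightarrow> real"
  assumes f: "integrable lborel f"
    and zero: "\<And>a b. p < a \<Longrightarrow> a < b \<Longrightarrow> b < q \<Longrightarrow> (LINT x|lborel. indicator {a<..<b} x * f x) = 0"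
  shows "AE x in lborel. x \<in> {p<..<q} \<longrightarrow> f x = 0"
proof -
  have si: "set_integrable lborel {a..b} f" for a b
    unfolding set_integrable_def by (rule integrable_mult_indicator[OF _ f]) simp
  then have "f integrable_on cbox a b" for a b
    using set_borel_integral_eq_integral(1) by (metis interval_cbox)
  then obtain N where N: "negligible N" and lim:
    "\<And>x e. \<lbrakk>x \<notin> N; 0 < e\<rbrakk> \<Longrightarrow> \<exists>d>0. \<forall>h. 0 < h \<and> h < d \<longrightarrow>
       norm (integral (cbox x (x + h *\<^sub>R One)) f /\<^sub>R h ^ DIM(real) - f x) < e"
    by (rule integrable_ccontinuous_explicit) blast
  have "AE x in lebesgue. x \<notin> N"
    using N by (auto simp: negligible_iff_null_sets intro: AE_not_in)
  then have "AE x in lborel. x \<notin> N" by (simp add: AE_completion_iff)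
  then show ?thesis
  proof eventually_elim
    case (elim x)
    show ?case
    proof (intro impI, rule ccontr)
      assume x: "x \<in> {p<..<q}" and "f x \<noteq> 0"
      obtain x' where x': "p < x'" "x' < x" using x dense[of p x] by auto
      from \<open>f x \<noteq> 0\<close> obtain d where "d > 0" and d: "\<And>h. 0 < h \<Longrightarrow> h < d \<Longrightarrow>
          \<bar>integral {x..x + h} f / h - f x\<bar> < \<bar>f x\<bar>"
        using lim[OF elim, of "\<bar>f x\<bar>"] by (auto simp: divide_inverse mult.commute)
      define h where "h = min d (q - x) / 2"
      have h: "0 < h" "h < d" "x + h < q" using \<open>d > 0\<close> x by (auto simp: h_def min_def field_simps)
      have "integral {x..x + h} f = (LINT y|lborel. indicator {x..x + h} y * f y)"
        using set_borel_integral_eq_integral(2)[OF si] by (simp add: set_lebesgue_integral_def)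
      also have "\<dots> = (LINT y|lborel. indicator {x<..<x + h} y * f y)"
        by (rule integral_cong_AE)
          (use f AE_lborel_singleton[of x] AE_lborel_singleton[of "x + h"]
            in \<open>auto simp: indicator_def elim!: eventually_elim2\<close>)
      also have "\<dots> = 0" using x h by (intro zero) auto
      finally show False using d[OF h(1,2)] by simp
    qed
  qed
qed

lemma bump_integral_0_imp_interval:
  fixes D :: "real \<Rightarrow> real"
  assumes D: "integrable lborel D" and 0: "\<And>n. (LINT x|lborel. bump a b n x * D x) = 0"
  shows "(LINT x|lborel. indicator {a<..<b} x * D x) = 0"
proof -
  have [measurable]: "bump a b n \<in> borel_measurable borel" for n
    by (intro borel_measurable_continuous_onI flat_algebra_continuous bump_flat_algebra)
  have [measurable]: "D \<in> borel_measurable borel" using D by auto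
  have "(\<lambda>n. LINT x|lborel. bump a b n x * D x) \<longlonglongrightarrow> (LINT x|lborel. indicator {a<..<b} x * D x)"
  proof (rule integral_dominated_convergence[where w="\<lambda>x. norm (D x)"])
    show "AE x in lborel. (\<lambda>n. bump a b n x * D x) \<longlonglongrightarrow> indicator {a<..<b} x * D x"
      by (intro AE_I2 tendsto_mult bump_tendsto tendsto_const)
    show "AE x in lborel. norm (bump a b n x * D x) \<le> norm (D x)" for n
      using bump_bounds[of a b n] by (intro AE_I2) (simp add: abs_mult mult_left_le_one_le)
  qed (use D in auto)
  then show ?thesis using 0 by (simp add: LIMSEQ_const_iff)
qed

text \<open>The null set in \<open>inv\<close> depends on the shift. Fubini exchanges the two
  quantifiers: for some \<open>r\<close> the identity holds at almost every shift \<open>H\<close>,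
  and the substitution \<open>\<tau> = r + H\<close> turns this into \<open>M \<tau> = M r\<close>
  for almost every \<open>\<tau>\<close>.\<close>

lemma AE_const_if_translation_invariant:
  fixes M :: "real \<Rightarrow> real"
  assumes [measurable]: "M \<in> borel_measurable borel" and pq: "p < q"
    and inv: "\<And>H. AE r in lborel. r \<in> {p<..<q} \<longrightarrow> r + H \<in> {p<..<q} \<longrightarrow> M (r + H) = M r"
  shows "\<exists>C. AE r in lborel. r \<in> {p<..<q} \<longrightarrow> M r = C"
proof -
  let ?P = "\<lambda>H r. r \<in> {p<..<q} \<longrightarrow> r + H \<in> {p<..<q} \<longrightarrow> M (r + H) = M r"
  have meas: "{x \<in> space (lborel \<Otimes>\<^sub>M lborel). ?P (fst x) (snd x)} \<in> sets (lborel \<Otimes>\<^sub>M lborel)"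
    by measurable
  have "AE H in lborel. AE r in lborel. ?P H r" by (rule AE_I2, rule inv)
  then have sw: "AE r in lborel. AE H in lborel. ?P H r"
    by (rule lborel_pair.AE_commute[where P="?P", OF meas, THEN iffD1])
  have "\<exists>r. r \<in> {p<..<q} \<and> (AE H in lborel. ?P H r)"
  proof (rule ccontr)
    assume no: "\<not> ?thesis"
    from sw have "AE r in lborel. r \<notin> {p<..<q}"
      by eventually_elim (use no in blast)
    then have "emeasure lborel {p<..<q} = 0" by (subst (asm) AE_iff_measurable[of "{p<..<q}"]) auto
    then show False using pq by simp
  qed
  then obtain r where r: "r \<in> {p<..<q}" "AE H in lborel. ?P H r" by blast
  have "AE \<tau> in lborel. ?P (- r + 1 * \<tau>) r"
    by (rule AE_borel_affine[OF _ _ r(2)]) (simp, measurable)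
  then have "AE \<tau> in lborel. \<tau> \<in> {p<..<q} \<longrightarrow> M \<tau> = M r"
    by eventually_elim (use r(1) in simp)
  then show ?thesis by (rule exI)
qed

lemma weak_derivative_unique_scalar:
  fixes g1 g2 :: "real \<Rightarrow> real"
  assumes g: "integrable lborel g1" "integrable lborel g2"
    and eq: "\<And>\<phi>. test_function T \<phi> \<Longrightarrow> (LINT t|lborel. \<phi> t * g1 t) = (LINT t|lborel. \<phi> t * g2 t)"
  shows "AE t in lborel. t \<in> {0<..<T} \<longrightarrow> g1 t = g2 t"
proof -
  have "AE t in lborel. t \<in> {0<..<T} \<longrightarrow> g1 t - g2 t = 0"
  proof (rule AE_eq_0_if_interval_integrals_0)
    show "integrable lborel (\<lambda>t. g1 t - g2 t)" using g by auto
    fix a b assume ab: "0 < a" "a < b" "b < T"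
    show "(LINT x|lborel. indicator {a<..<b} x * (g1 x - g2 x)) = 0"
    proof (rule bump_integral_0_imp_interval)
      fix n
      have [measurable]: "bump a b n \<in> borel_measurable borel"
        by (intro borel_measurable_continuous_onI flat_algebra_continuous bump_flat_algebra)
      have [measurable]: "g1 \<in> borel_measurable borel" "g2 \<in> borel_measurable borel" using g by auto
      have i: "integrable lborel (\<lambda>x. bump a b n x * g x)" if "integrable lborel g" for g
        by (rule Bochner_Integration.integrable_bound[OF that])
          (use that bump_bounds[of a b n] in \<open>auto simp: abs_mult mult_left_le_one_le\<close>)
      show "(LINT x|lborel. bump a b n x * (g1 x - g2 x)) = 0"
        using eq[OF bump_test_function, of a b n] ab i[OF g(1)] i[OF g(2)]
        by (simp add: right_diff_distrib Bochner_Integration.integral_diff)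
    qed (use g in auto)
  qed
  then show ?thesis by simp
qed

lemma primitive_bound:
  fixes g :: "real \<Rightarrow> real"
  assumes g: "integrable lborel g"
  shows "\<bar>LINT s|lborel. indicator {..<t} s * g s\<bar> \<le> (LINT s|lborel. \<bar>g s\<bar>)"
proof -
  have "\<bar>LINT s|lborel. indicator {..<t} s * g s\<bar> \<le> (LINT s|lborel. \<bar>indicator {..<t} s * g s\<bar>)"
    by (rule integral_abs_bound)
  also have "\<dots> \<le> (LINT s|lborel. \<bar>g s\<bar>)"
    using g by (intro integral_mono' ) (auto simp: indicator_def abs_mult)
  finally show ?thesis .
qed

lemma primitive_measurable:
  fixes g :: "real \<Rightarrow> real"
  assumes [measurable]: "g \<in> borel_measurable borel"
  shows "(\<lambda>t. LINT s|lborel. indicator {..<t} s * g s) \<in> borel_measurable borel"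
proof -
  have "(\<lambda>p::real \<times> real. (if snd p < fst p then 1 else 0) * g (snd p)) \<in> borel_measurable (lborel \<Otimes>\<^sub>M lborel)"
    by measurable
  then have "(\<lambda>t. LINT s|lborel. (if s < t then 1 else 0) * g s) \<in> borel_measurable lborel"
    by (intro lborel.borel_measurable_lebesgue_integral) (simp add: case_prod_beta')
  moreover have "(\<lambda>t. LINT s|lborel. (if s < t then 1 else 0) * g s) = (\<lambda>t. LINT s|lborel. indicator {..<t} s * g s)"
    by (intro ext Bochner_Integration.integral_cong) (auto simp: indicator_def)
  ultimately show ?thesis by simp
qed

text \<open>Fubini on the triangle \<open>t < s\<close>. When \<open>\<psi>\<close> has mean zero,
  its integral over \<open>(t, \<infinity>)\<close> is minus its primitive, so this moves the
  primitive from the test function onto \<open>g\<close>.\<close>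

lemma integral_primitive_swap:
  fixes \<psi> g :: "real \<Rightarrow> real"
  assumes \<psi>: "integrable lborel \<psi>" and g: "integrable lborel g"
  shows "(LINT t|lborel. (LINT s|lborel. indicator {t<..} s * \<psi> s) * g t)
       = (LINT s|lborel. \<psi> s * (LINT t|lborel. indicator {..<s} t * g t))"
proof -
  have [measurable]: "\<psi> \<in> borel_measurable borel" "g \<in> borel_measurable borel" using \<psi> g by auto
  let ?h = "\<lambda>p::real \<times> real. (if fst p < snd p then 1 else 0) * (g (fst p) * \<psi> (snd p))"
  have "integrable (lborel \<Otimes>\<^sub>M lborel) (\<lambda>p. g (fst p) * \<psi> (snd p))"
  proof (rule lborel_pair.Fubini_integrable)
    show "integrable lborel (\<lambda>x. LINT y|lborel. norm (g (fst (x, y)) * \<psi> (snd (x, y))))"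
      using g by (simp add: abs_mult integrable_abs)
    show "AE x in lborel. integrable lborel (\<lambda>y. g (fst (x, y)) * \<psi> (snd (x, y)))"
      using \<psi> by simp
  qed measurable
  then have "integrable (lborel \<Otimes>\<^sub>M lborel) ?h"
    by (rule Bochner_Integration.integrable_bound) (auto simp: abs_mult)
  then have "(LINT y|lborel. LINT x|lborel. ?h (x, y)) = (LINT x|lborel. LINT y|lborel. ?h (x, y))"
    by (intro lborel_pair.Fubini_integral) (simp add: case_prod_beta')
  moreover have "(LINT x|lborel. ?h (x, y)) = \<psi> y * (LINT t|lborel. indicator {..<y} t * g t)" for y
    by (subst integral_mult_right_zero[symmetric], rule Bochner_Integration.integral_cong)
      (auto simp: indicator_def)
  moreover have "(LINT y|lborel. ?h (x, y)) = (LINT s|lborel. indicator {x<..} s * \<psi> s) * g x" for x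
    by (subst integral_mult_left_zero[symmetric], rule Bochner_Integration.integral_cong)
      (auto simp: indicator_def)
  ultimately show ?thesis by simp
qed

lemma bump_integrable: "integrable lborel (bump a b n)"
proof -
  have "integrable lborel (\<lambda>x. bump a b n x * indicator {a..b} x)"
    using flat_algebra_continuous[OF bump_flat_algebra, of UNIV a b n]
    by (intro borel_integrable_atLeastAtMost) (auto simp: continuous_on_eq_continuous_at)
  moreover have "(\<lambda>x. bump a b n x * indicator {a..b} x) = bump a b n"
  proof
    fix x show "bump a b n x * indicator {a..b} x = bump a b n x"
      using bump_eq_0[of x a b n] by (cases "x \<in> {a<..<b}") auto
  qed
  ultimately show ?thesis by simp
qed

lemma integral_translate:
  fixes f :: "real \<Rightarrow> real"
  shows "(LINT x|lborel. f (x + H)) = (LINT x|lborel. f x)"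
  using lborel_integral_real_affine[of 1 f H] by (simp add: add.commute)

lemma integrable_translate:
  fixes f :: "real \<Rightarrow> real"
  shows "integrable lborel f \<Longrightarrow> integrable lborel (\<lambda>x. f (x + H))"
  using lborel_integrable_real_affine[of f 1 H] by (simp add: add.commute)

text \<open>The derivative \<open>\<psi>\<close> of the test function is a bump minus its translate
  by \<open>H\<close>, which has mean zero automatically. The weak identity then says that
  \<open>M = f - G\<close> has the same integral against both bumps. This makes \<open>M\<close>
  invariant under translations, hence constant.\<close>

theorem weak_derivative_imp_primitive:
  fixes f g :: "real \<Rightarrow> real"
  assumes T: "T > 0" and f: "integrable lborel f" and g: "integrable lborel g"
    and weak: "\<And>\<phi>. test_function T \<phi> \<Longrightarrow>
      (LINT t|lborel. deriv \<phi> t * f t) = - (LINT t|lborel. \<phi> t * g t)"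
  shows "\<exists>C. AE t in lborel. t \<in> {0<..<T} \<longrightarrow> f t = C + (LINT s|lborel. indicator {..<t} s * g s)"
proof -
  define G where "G t = (LINT s|lborel. indicator {..<t} s * g s)" for t
  define M where "M t = f t - G t" for t
  let ?I = "{0<..<T}"
  have [measurable]: "f \<in> borel_measurable borel" "g \<in> borel_measurable borel" using f g by auto
  have [measurable]: "G \<in> borel_measurable borel"
    unfolding G_def by (rule primitive_measurable) simp
  have [measurable]: "M \<in> borel_measurable borel" unfolding M_def by measurable
  have "AE r in lborel. r \<in> ?I \<longrightarrow> r + H \<in> ?I \<longrightarrow> M (r + H) = M r" for H
  proof -
    \<comment> \<open>The interval \<open>(?p, ?q)\<close> consists of those \<open>r\<close> for
      which both \<open>r\<close> and \<open>r + H\<close> lie in \<open>(0, T)\<close>.\<close>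
    let ?p = "max 0 (- H)" and ?q = "min T (T - H)"
    define D where "D r = indicator {?p<..<?q} r * (M (r + H) - M r)" for r
    have iM: "integrable lborel (\<lambda>t. indicator ?I t * M t)"
    proof -
      have "integrable lborel (\<lambda>t. indicator ?I t * f t)"
        by (rule Bochner_Integration.integrable_bound[OF f]) (auto simp: indicator_def)
      moreover have "integrable lborel (\<lambda>t. indicator ?I t * G t)"
      proof (rule Bochner_Integration.integrable_bound)
        show "integrable lborel (\<lambda>t. indicator ?I t * (LINT s|lborel. \<bar>g s\<bar>))"
          using T by (intro integrable_mult_left integrable_real_indicator) auto
        show "AE t in lborel. norm (indicator ?I t * G t) \<le> norm (indicator ?I t * (LINT s|lborel. \<bar>g s\<bar>))"
          using primitive_bound[OF g] order_trans[OF _ abs_ge_self]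
          by (intro AE_I2) (auto simp: indicator_def G_def intro: order_trans)
      qed measurable
      ultimately show ?thesis unfolding M_def right_diff_distrib by (rule Bochner_Integration.integrable_diff)
    qed
    have D: "integrable lborel D"
    proof (rule Bochner_Integration.integrable_bound)
      show "integrable lborel (\<lambda>r. \<bar>indicator ?I (r + H) * M (r + H)\<bar> + \<bar>indicator ?I r * M r\<bar>)"
        using integrable_translate[OF iM] iM
        by (intro Bochner_Integration.integrable_add integrable_abs)
      show "AE r in lborel. norm (D r) \<le> norm (\<bar>indicator ?I (r + H) * M (r + H)\<bar> + \<bar>indicator ?I r * M r\<bar>)"
        by (intro AE_I2) (auto simp: D_def indicator_def split: if_splits)
      show "D \<in> borel_measurable lborel" unfolding D_def by measurable
    qed
    have "AE r in lborel. r \<in> {?p<..<?q} \<longrightarrow> D r = 0"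
    proof (rule AE_eq_0_if_interval_integrals_0[OF D], rule bump_integral_0_imp_interval[OF D])
      fix a b n assume ab: "?p < a" "a < b" "b < ?q"
      define \<psi> where "\<psi> x = bump a b n x + - bump (a + H) (b + H) n x" for x
      have \<psi>_alg: "\<psi> \<in> flat_algebra"
        unfolding \<psi>_def by (intro flat_algebra.add flat_algebra_uminus bump_flat_algebra)
      let ?a = "min a (a + H)" and ?b = "max b (b + H)"
      have \<psi>0: "\<psi> x = 0" if "x \<notin> {?a..?b}" for x
      proof -
        have "x \<notin> {a<..<b}" "x \<notin> {a + H<..<b + H}" using that by auto
        from this[THEN bump_eq_0, of n] show ?thesis by (simp add: \<psi>_def del: greaterThanLessThan_iff)
      qed
      have \<psi>i: "integrable lborel \<psi>"
        unfolding \<psi>_def by (intro Bochner_Integration.integrable_add Bochner_Integration.integrable_minus bump_integrable)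
      have tr: "(LINT x|lborel. bump (a + H) (b + H) n x * F x) = (LINT x|lborel. bump a b n x * F (x + H))" for F
        using integral_translate[of "\<lambda>x. bump (a + H) (b + H) n x * F x" H] by (simp add: bump_translate)
      have \<psi>_total: "(LINT x|lborel. \<psi> x) = 0"
        using tr[of "\<lambda>_. 1"] bump_integrable by (simp add: \<psi>_def)
      have \<psi>_int: "integral {x..y} \<psi> = (LINT s|lborel. indicator {x..y} s * \<psi> s)" for x y
      proof -
        have "set_integrable lborel {x..y} \<psi>"
          by (rule borel_integrable_atLeastAtMost'[OF flat_algebra_continuous[OF \<psi>_alg]])
        from set_borel_integral_eq_integral(2)[OF this] show ?thesis
          by (simp add: set_lebesgue_integral_def)
      qed
      have "integral {?a..?b} \<psi> = (LINT s|lborel. \<psi> s)"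
        unfolding \<psi>_int using \<psi>0 by (intro Bochner_Integration.integral_cong) (auto simp: indicator_def)
      then have zero: "integral {?a..?b} \<psi> = 0" using \<psi>_total by simp
      have pos: "0 < ?a" "?b < T" using ab by auto
      note test = primitive_test_function[OF \<psi>_alg pos \<psi>0 zero]
      \<comment> \<open>The mean value zero of \<open>\<psi>\<close> converts the integral up to
        \<open>t\<close> into minus the integral beyond \<open>t\<close>, the form required for the
        exchange of integrations.\<close>
      have prim: "integral {0..t} \<psi> = - (LINT s|lborel. indicator {t<..} s * \<psi> s)" for t
      proof -
        have "(LINT s|lborel. \<psi> s) = (LINT s|lborel. indicator {0..t} s * \<psi> s + indicator {t<..} s * \<psi> s)"
          by (rule Bochner_Integration.integral_cong) (use \<psi>0 pos in \<open>auto simp: indicator_def not_le\<close>)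
        also have "\<dots> = (LINT s|lborel. indicator {0..t} s * \<psi> s) + (LINT s|lborel. indicator {t<..} s * \<psi> s)"
          by (rule Bochner_Integration.integral_add)
            (rule Bochner_Integration.integrable_bound[OF \<psi>i], use \<psi>i in \<open>auto simp: indicator_def\<close>)+
        finally show ?thesis using \<psi>_total by (simp add: \<psi>_int)
      qed
      have \<psi>_bound: "\<bar>\<psi> x\<bar> \<le> 2" for x
        using bump_bounds[of a b n x] bump_bounds[of "a + H" "b + H" n x] by (auto simp: \<psi>_def abs_if)
      have [measurable]: "\<psi> \<in> borel_measurable borel" using \<psi>i by auto
      have \<psi>f: "integrable lborel (\<lambda>t. \<psi> t * f t)"
        by (rule Bochner_Integration.integrable_bound[OF integrable_mult_right[OF f, of 2]])
          (use \<psi>_bound in \<open>auto simp: abs_mult intro!: mult_right_mono\<close>)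
      have \<psi>G: "integrable lborel (\<lambda>t. \<psi> t * G t)"
      proof (rule Bochner_Integration.integrable_bound[OF integrable_mult_left[OF \<psi>i, of "LINT s|lborel. \<bar>g s\<bar>"]])
        show "(\<lambda>t. \<psi> t * G t) \<in> borel_measurable lborel" by measurable
        show "AE t in lborel. norm (\<psi> t * G t) \<le> norm (\<psi> t * (LINT s|lborel. \<bar>g s\<bar>))"
          using primitive_bound[OF g]
          by (intro AE_I2) (auto simp: abs_mult G_def intro!: mult_left_mono)
      qed
      have "(LINT t|lborel. \<psi> t * f t) = - (LINT t|lborel. integral {0..t} \<psi> * g t)"
        using weak[OF test(1)] test(2) by simp
      also have "\<dots> = (LINT t|lborel. (LINT s|lborel. indicator {t<..} s * \<psi> s) * g t)"
        unfolding prim by simp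
      also have "\<dots> = (LINT t|lborel. \<psi> t * G t)"
        unfolding G_def by (rule integral_primitive_swap[OF \<psi>i g])
      finally have \<psi>M: "(LINT t|lborel. \<psi> t * M t) = 0"
        using \<psi>f \<psi>G by (simp add: M_def right_diff_distrib)
      have i1: "integrable lborel (\<lambda>t. bump c d n t * M t)" if "0 \<le> c" "d \<le> T" for c d
      proof (rule Bochner_Integration.integrable_bound[OF iM])
        have [measurable]: "bump c d n \<in> borel_measurable borel" using bump_integrable by auto
        show "(\<lambda>t. bump c d n t * M t) \<in> borel_measurable lborel" by measurable
        show "AE t in lborel. norm (bump c d n t * M t) \<le> norm (indicator ?I t * M t)"
          using bump_bounds[of c d n] bump_eq_0[of _ c d n] that
          by (intro AE_I2) (auto simp: abs_mult indicator_def mult_left_le_one_le)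
      qed
      have ia: "integrable lborel (\<lambda>t. bump a b n t * M t)" using ab by (intro i1) auto
      have ib: "integrable lborel (\<lambda>t. bump (a + H) (b + H) n t * M t)" using ab by (intro i1) auto
      have ib': "integrable lborel (\<lambda>t. bump a b n t * M (t + H))"
        using integrable_translate[OF ib, of H] by (simp add: bump_translate)
      have "(LINT x|lborel. bump a b n x * D x) = (LINT x|lborel. bump a b n x * M (x + H) - bump a b n x * M x)"
        by (rule Bochner_Integration.integral_cong[OF refl])
          (use bump_eq_0[of _ a b n] ab in \<open>force simp: D_def indicator_def algebra_simps\<close>)
      also have "\<dots> = (LINT x|lborel. bump (a + H) (b + H) n x * M x) - (LINT x|lborel. bump a b n x * M x)"
        using ia ib' by (simp add: tr)
      also have "\<dots> = - (LINT t|lborel. \<psi> t * M t)"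
        using ia ib by (simp add: \<psi>_def left_diff_distrib)
      finally show "(LINT x|lborel. bump a b n x * D x) = 0" using \<psi>M by simp
    qed
    then show ?thesis by eventually_elim (auto simp: D_def indicator_def)
  qed
  then obtain C where "AE r in lborel. r \<in> ?I \<longrightarrow> M r = C"
    using AE_const_if_translation_invariant[of M 0 T] T by auto
  then show ?thesis by (intro exI[of _ C]) (auto simp: M_def G_def elim!: eventually_mono)
qed

section \<open>Continuity of translations in the mean square\<close>

lemma measure_translate:
  assumes [measurable]: "A \<in> sets borel"
  shows "emeasure lborel {x. x + h \<in> A} = emeasure lborel (A :: real set)"
proof -
  have "emeasure lborel A = emeasure (distr lborel borel ((+) h)) A" by (simp add: lborel_distr_plus)
  also have "\<dots> = emeasure lborel ((+) h -` A \<inter> space lborel)" by (rule emeasure_distr) auto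
  also have "(+) h -` A \<inter> space lborel = {x. x + h \<in> A}" by (auto simp: add.commute)
  finally show ?thesis by simp
qed

text \<open>By regularity there are a compact \<open>K\<close> and an open \<open>U\<close> with
  \<open>K \<subseteq> S \<subseteq> U\<close> and small differences. If \<open>h\<close> is smaller
  than the distance from \<open>K\<close> to the complement of \<open>U\<close>, a point that leaves
  \<open>S\<close> either starts in \<open>S - K\<close> or arrives in \<open>U - S\<close>.\<close>

lemma measure_leaving_tendsto_0:
  fixes S :: "real set"
  assumes S[measurable]: "S \<in> sets borel" and bnd: "bounded S"
  shows "((\<lambda>h. measure lborel {x. x \<in> S \<and> x + h \<notin> S}) \<longlongrightarrow> 0) (at 0)"
proof (rule tendstoI)
  fix e :: real assume e: "e > 0"
  obtain U where U: "open U" "S \<subseteq> U" "emeasure lborel (U - S) < ennreal (e / 2)"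
    using outer_regular_lborel[OF S, of "e / 2"] e by auto
  have Sl: "S \<in> sets lebesgue" using S by simp
  obtain K where K: "closed K" "K \<subseteq> S" "emeasure lebesgue (S - K) < ennreal (e / 2)"
    by (rule sets_lebesgue_inner_closed[OF Sl, of "e / 2"]) (use e in simp, rule that)
  have [measurable]: "U \<in> sets borel" "K \<in> sets borel" using U K by auto
  have K': "emeasure lborel (S - K) < ennreal (e / 2)" using K(3) by simp
  have "compact K" using K bnd bounded_subset compact_eq_bounded_closed by blast
  moreover have "closed (- U)" "K \<inter> - U = {}" using U K by auto
  ultimately obtain d where d: "d > 0" "\<And>x y. x \<in> K \<Longrightarrow> y \<in> - U \<Longrightarrow> d \<le> dist x y"
    using separate_compact_closed by metis
  have "measure lborel {x. x \<in> S \<and> x + h \<notin> S} < e" if h: "\<bar>h\<bar> < d" for h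
  proof -
    have "x + h \<in> U" if "x \<in> K" for x
      using d(2)[OF that, of "x + h"] h by (force simp: dist_real_def)
    then have sub: "{x. x \<in> S \<and> x + h \<notin> S} \<subseteq> (S - K) \<union> {x. x + h \<in> U - S}" by auto
    have "emeasure lborel {x. x \<in> S \<and> x + h \<notin> S} \<le> emeasure lborel ((S - K) \<union> {x. x + h \<in> U - S})"
      by (rule emeasure_mono[OF sub]) measurable
    also have "\<dots> \<le> emeasure lborel (S - K) + emeasure lborel {x. x + h \<in> U - S}"
      by (rule emeasure_subadditive) measurable
    also have "\<dots> = emeasure lborel (S - K) + emeasure lborel (U - S)"
      by (subst measure_translate) auto
    also have "\<dots> < ennreal (e / 2) + ennreal (e / 2)"
      using K' U(3) by (intro add_strict_mono)
    also have "\<dots> = ennreal e" using e by (simp flip: ennreal_plus)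
    finally have "emeasure lborel {x. x \<in> S \<and> x + h \<notin> S} < ennreal e" .
    moreover from this have "emeasure lborel {x. x \<in> S \<and> x + h \<notin> S} \<noteq> top" by auto
    ultimately show ?thesis by (simp add: emeasure_eq_ennreal_measure ennreal_less_iff)
  qed
  then show "eventually (\<lambda>h. dist (measure lborel {x. x \<in> S \<and> x + h \<notin> S}) 0 < e) (at 0)"
    unfolding eventually_at using d(1) by (intro exI[of _ d]) (auto simp: dist_real_def)
qed

text \<open>A point enters \<open>S\<close> under the shift by \<open>h\<close> exactly when its
  image leaves \<open>S\<close> under the shift by \<open>- h\<close>; the two sets are translates
  of each other.\<close>

lemma measure_entering_tendsto_0:
  fixes S :: "real set"
  assumes S[measurable]: "S \<in> sets borel" and bnd: "bounded S"
  shows "((\<lambda>h. measure lborel {x. x + h \<in> S \<and> x \<notin> S}) \<longlongrightarrow> 0) (at 0)"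
proof -
  have "filterlim uminus (at 0) (at (0::real))"
    unfolding filterlim_at by (auto simp: eventually_at_filter intro!: tendsto_eq_intros)
  from filterlim_compose[OF measure_leaving_tendsto_0[OF assms] this]
  have "((\<lambda>h. measure lborel {x. x \<in> S \<and> x + - h \<notin> S}) \<longlongrightarrow> 0) (at 0)" .
  moreover have "measure lborel {x. x \<in> S \<and> x + - h \<notin> S} = measure lborel {x. x + h \<in> S \<and> x \<notin> S}" for h
  proof -
    have "{x. x + h \<in> S \<and> x \<notin> S} = {x. x + h \<in> {y. y \<in> S \<and> y + - h \<notin> S}}" by auto
    moreover have "emeasure lborel {x. x + h \<in> {y. y \<in> S \<and> y + - h \<notin> S}} = emeasure lborel {y. y \<in> S \<and> y + - h \<notin> S}"
      by (rule measure_translate) measurable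
    ultimately show ?thesis by (simp only: measure_def)
  qed
  ultimately show ?thesis by (simp only:)
qed

lemma numeral_mult_ennreal: "0 \<le> x \<Longrightarrow> numeral k * ennreal x = ennreal (numeral k * x)"
  by (simp add: ennreal_mult)

definition translation_defect :: "(real \<Rightarrow> 'b::real_normed_vector) \<Rightarrow> real \<Rightarrow> ennreal" where
  "translation_defect f h = (\<integral>\<^sup>+x. ennreal ((norm (f (x + h) - f x))\<^sup>2) \<partial>lborel)"

text \<open>If \<open>s\<close> changes between \<open>x\<close> and \<open>x + h\<close>, then
  \<open>x\<close> leaves or enters the level set of some nonzero value. These level sets are
  finitely many and bounded, and the change never exceeds \<open>B\<close>. The value zero is left
  out because its level set is unbounded.\<close>

lemma translation_defect_simple_function:
  fixes s :: "real \<Rightarrow> 'b::real_normed_vector"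
  assumes s: "simple_function lborel s" and 0: "\<And>x. x \<notin> {0<..<T} \<Longrightarrow> s x = 0" and e: "e > 0"
  shows "eventually (\<lambda>h. translation_defect s h \<le> ennreal e) (at 0)"
proof -
  define F where "F = range s - {0}"
  have fin: "finite F" using simple_functionD(1)[OF s] by (simp add: F_def)
  define S where "S y = {x. s x = y}" for y
  have S[measurable]: "S y \<in> sets borel" for y
    using simple_functionD(2)[OF s, of "{y}"] by (simp add: S_def vimage_def)
  have bS: "S y \<subseteq> {0<..<T}" if "y \<in> F" for y
    using that 0 by (force simp: S_def F_def)
  define B where "B = 2 * (\<Sum>y\<in>F. norm y)"
  have B: "norm (s x) \<le> B / 2" for x
  proof (cases "s x = 0")
    case True then show ?thesis by (simp add: B_def sum_nonneg)
  next
    case False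
    then show ?thesis using fin member_le_sum[of "s x" F norm] by (simp add: B_def F_def)
  qed
  define L where "L y h = {x. x \<in> S y \<and> x + h \<notin> S y}" for y h
  define E where "E y h = {x. x + h \<in> S y \<and> x \<notin> S y}" for y h
  have [measurable]: "L y h \<in> sets borel" "E y h \<in> sets borel" for y h
    unfolding L_def E_def by measurable
  have fL: "emeasure lborel (L y h) < \<infinity>" if "y \<in> F" for y h
  proof -
    have "emeasure lborel (L y h) \<le> emeasure lborel {0..T}"
      using bS[OF that] by (intro emeasure_mono) (auto simp: L_def)
    also have "\<dots> < \<infinity>" by (simp add: emeasure_lborel_Icc_eq)
    finally show ?thesis .
  qed
  have fE: "emeasure lborel (E y h) < \<infinity>" if "y \<in> F" for y h
  proof -
    have "emeasure lborel (E y h) \<le> emeasure lborel {- h..T - h}"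
      using bS[OF that] by (intro emeasure_mono) (force simp: E_def)+
    also have "\<dots> < \<infinity>" by (simp add: emeasure_lborel_Icc_eq)
    finally show ?thesis .
  qed
  have pt: "(norm (s (x + h) - s x))\<^sup>2 \<le> (\<Sum>y\<in>F. B\<^sup>2 * (indicator (L y h) x + indicator (E y h) x))" for x h
  proof (cases "s (x + h) = s x")
    case True then show ?thesis by (auto intro!: sum_nonneg)
  next
    case False
    then obtain y where y: "y \<in> F" "x \<in> L y h \<or> x \<in> E y h"
      by (cases "s x = 0") (force simp: F_def L_def E_def S_def)+
    have "norm (s (x + h) - s x) \<le> B"
      using norm_triangle_ineq4[of "s (x + h)" "s x"] B[of x] B[of "x + h"] by linarith
    then have "(norm (s (x + h) - s x))\<^sup>2 \<le> B\<^sup>2" by (intro power_mono) auto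
    also have "\<dots> \<le> B\<^sup>2 * (indicator (L y h) x + indicator (E y h) x)"
      using y(2) by (auto simp: indicator_def)
    also have "\<dots> \<le> (\<Sum>y\<in>F. B\<^sup>2 * (indicator (L y h) x + indicator (E y h) x))"
      by (rule member_le_sum[OF y(1) _ fin]) auto
    finally show ?thesis .
  qed
  have bound: "translation_defect s h \<le> ennreal (\<Sum>y\<in>F. B\<^sup>2 * (measure lborel (L y h) + measure lborel (E y h)))" for h
  proof -
    have int: "integrable lborel (\<lambda>x. \<Sum>y\<in>F. B\<^sup>2 * (indicator (L y h) x + indicator (E y h) x))"
      using fL fE
      by (intro Bochner_Integration.integrable_sum integrable_mult_right Bochner_Integration.integrable_add
          integrable_real_indicator) auto
    have "translation_defect s h \<le> (\<integral>\<^sup>+x. ennreal (\<Sum>y\<in>F. B\<^sup>2 * (indicator (L y h) x + indicator (E y h) x)) \<partial>lborel)"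
      unfolding translation_defect_def by (intro nn_integral_mono ennreal_leI pt)
    also have "\<dots> = ennreal (LINT x|lborel. (\<Sum>y\<in>F. B\<^sup>2 * (indicator (L y h) x + indicator (E y h) x)))"
      by (rule nn_integral_eq_integral[OF int]) (auto intro!: sum_nonneg)
    also have "(LINT x|lborel. (\<Sum>y\<in>F. B\<^sup>2 * (indicator (L y h) x + indicator (E y h) x)))
        = (\<Sum>y\<in>F. B\<^sup>2 * (measure lborel (L y h) + measure lborel (E y h)))"
      using fL fE
      by (subst Bochner_Integration.integral_sum)
        (auto intro!: sum.cong integrable_mult_right Bochner_Integration.integrable_add simp: integrable_real_indicator)
    finally show ?thesis .
  qed
  have "bounded (S y)" if "y \<in> F" for y
  proof (rule bounded_subset)
    show "bounded {0..T}" by (rule compact_imp_bounded) simp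
    show "S y \<subseteq> {0..T}" using bS[OF that] by fastforce
  qed
  then have "((\<lambda>h. \<Sum>y\<in>F. B\<^sup>2 * (measure lborel (L y h) + measure lborel (E y h))) \<longlongrightarrow> (\<Sum>y\<in>F. B\<^sup>2 * (0 + 0))) (at 0)"
    unfolding L_def E_def
    by (intro tendsto_sum tendsto_mult tendsto_const tendsto_add measure_leaving_tendsto_0 measure_entering_tendsto_0 S)
  then have "((\<lambda>h. \<Sum>y\<in>F. B\<^sup>2 * (measure lborel (L y h) + measure lborel (E y h))) \<longlongrightarrow> 0) (at 0)"
    by simp
  then have "eventually (\<lambda>h. (\<Sum>y\<in>F. B\<^sup>2 * (measure lborel (L y h) + measure lborel (E y h))) < e) (at 0)"
    using e by (rule order_tendstoD(2))
  then show ?thesis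
    by eventually_elim (rule order_trans[OF bound ennreal_leI[OF less_imp_le]])
qed

lemma norm_diff_square_le:
  fixes a b c :: "'b::real_normed_vector"
  shows "(norm (a - b))\<^sup>2 \<le> 2 * (norm (a - c))\<^sup>2 + 2 * (norm (c - b))\<^sup>2"
proof -
  have "(norm (a - b))\<^sup>2 \<le> (norm (a - c) + norm (c - b))\<^sup>2"
    using norm_triangle_ineq[of "a - c" "c - b"] by (intro power_mono) auto
  also have "\<dots> \<le> 2 * (norm (a - c))\<^sup>2 + 2 * (norm (c - b))\<^sup>2"
    using zero_le_power2[of "norm (a - c) - norm (c - b)"]
    unfolding power2_sum power2_diff by linarith
  finally show ?thesis .
qed

lemma simple_limit_approx:
  fixes f :: "real \<Rightarrow> 'b::real_normed_vector"
  assumes f: "simple_limit f" and sq: "integrable lborel (\<lambda>x. (norm (f x))\<^sup>2)" and e: "e > 0"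
  obtains s where "simple_function lborel s" "\<And>x. norm (s x) \<le> 2 * norm (f x)"
    "(\<integral>\<^sup>+x. ennreal ((norm (f x - s x))\<^sup>2) \<partial>lborel) \<le> ennreal e"
    "(\<lambda>x. norm (f x - s x)) \<in> borel_measurable borel"
proof -
  obtain s where s: "\<And>n. simple_function lborel (s n)" "\<And>x. (\<lambda>n::nat. s n x) \<longlonglongrightarrow> f x"
    and b: "\<And>n x. norm (s n x) \<le> 2 * norm (f x)"
    using f unfolding simple_limit_def by auto
  have m: "(\<lambda>x. norm (f x - s n x)) \<in> borel_measurable borel" for n
  proof (rule borel_measurable_LIMSEQ_real)
    show "(\<lambda>k. norm (s k x - s n x)) \<longlonglongrightarrow> norm (f x - s n x)" for x
      by (intro tendsto_intros s)
    show "(\<lambda>x. norm (s k x - s n x)) \<in> borel_measurable borel" for k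
      using borel_measurable_simple_function[OF simple_function_compose2[OF s(1)[of k] s(1)[of n], of "\<lambda>a b. norm (a - b)"]]
      by simp
  qed
  have le: "(norm (f x - s n x))\<^sup>2 \<le> 9 * (norm (f x))\<^sup>2" for n x
  proof -
    have "norm (f x - s n x) \<le> 3 * norm (f x)"
      using norm_triangle_ineq4[of "f x" "s n x"] b[of n x] by linarith
    then have "(norm (f x - s n x))\<^sup>2 \<le> (3 * norm (f x))\<^sup>2" by (intro power_mono) auto
    then show ?thesis by (simp add: power_mult_distrib)
  qed
  have int: "integrable lborel (\<lambda>x. (norm (f x - s n x))\<^sup>2)" for n
    by (rule Bochner_Integration.integrable_bound[OF integrable_mult_right[OF sq, of 9]])
      (use m le in \<open>auto intro!: borel_measurable_power\<close>)
  have "(\<lambda>n. LINT x|lborel. (norm (f x - s n x))\<^sup>2) \<longlonglongrightarrow> (LINT x|(lborel::real measure). 0)"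
  proof (rule integral_dominated_convergence[where w="\<lambda>x. 9 * (norm (f x))\<^sup>2"])
    have "(\<lambda>n. (norm (f x - s n x))\<^sup>2) \<longlonglongrightarrow> (norm (f x - f x))\<^sup>2" for x
      by (intro tendsto_intros s)
    then show "AE x in lborel. (\<lambda>n. (norm (f x - s n x))\<^sup>2) \<longlonglongrightarrow> 0" by simp
  qed (use m le sq in \<open>auto intro!: borel_measurable_power\<close>)
  then have "eventually (\<lambda>n. (LINT x|lborel. (norm (f x - s n x))\<^sup>2) < e) sequentially"
    using e by (intro order_tendstoD(2)) auto
  then obtain n where n: "(LINT x|lborel. (norm (f x - s n x))\<^sup>2) < e"
    by (auto dest: eventually_happens)
  have "(\<integral>\<^sup>+x. ennreal ((norm (f x - s n x))\<^sup>2) \<partial>lborel) \<le> ennreal e"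
    using n by (subst nn_integral_eq_integral[OF int]) (auto intro: ennreal_leI)
  then show ?thesis using s(1) b m by (intro that[of "s n"])
qed

theorem translation_defect_tendsto_0:
  fixes f :: "real \<Rightarrow> 'b::real_normed_vector"
  assumes f: "simple_limit f" and sq: "integrable lborel (\<lambda>x. (norm (f x))\<^sup>2)"
    and 0: "\<And>x. x \<notin> {0<..<T} \<Longrightarrow> f x = 0" and e: "e > 0"
  shows "eventually (\<lambda>h. translation_defect f h \<le> ennreal e) (at 0)"
proof -
  \<comment> \<open>Going from \<open>f (x + h)\<close> to \<open>f x\<close> via
    \<open>s (x + h)\<close> and \<open>s x\<close> puts the weights \<open>2\<close> and
    \<open>4\<close> on the approximation error, in total \<open>6 * (e / 12) = e / 2\<close>. The
    defect of \<open>s\<close> carries the weight \<open>4\<close>, so a bound \<open>e / 8\<close>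
    for it supplies the other half.\<close>
  have e12: "e / 12 > 0" using e by simp
  obtain s where s: "simple_function lborel s" "\<And>x. norm (s x) \<le> 2 * norm (f x)"
    and app: "(\<integral>\<^sup>+x. ennreal ((norm (f x - s x))\<^sup>2) \<partial>lborel) \<le> ennreal (e / 12)"
    and m[measurable]: "(\<lambda>x. norm (f x - s x)) \<in> borel_measurable borel"
    by (rule simple_limit_approx[OF f sq e12]) (rule that)
  have s0: "s x = 0" if "x \<notin> {0<..<T}" for x using s(2)[of x] 0[OF that] by simp
  have [measurable]: "(\<lambda>x. norm (s (x + h) - s x)) \<in> borel_measurable borel" for h
  proof -
    have "simple_function lborel (\<lambda>x. s (x + h))"
      by (rule simple_function_comp[OF _ s(1)]) simp
    from borel_measurable_simple_function[OF simple_function_compose2[OF this s(1), of "\<lambda>a b. norm (a - b)"]]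
    show ?thesis by simp
  qed
  have [measurable]: "(\<lambda>x. norm (f (x + h) - s (x + h))) \<in> borel_measurable borel" for h
    using measurable_compose[OF _ m, of "\<lambda>x. x + h" borel] by simp
  have bound: "translation_defect f h \<le> ennreal (e / 2) + 4 * translation_defect s h" for h
  proof -
    have tr: "(\<integral>\<^sup>+x. ennreal ((norm (f (x + h) - s (x + h)))\<^sup>2) \<partial>lborel) = (\<integral>\<^sup>+x. ennreal ((norm (f x - s x))\<^sup>2) \<partial>lborel)"
      using nn_integral_real_affine[of "\<lambda>x. ennreal ((norm (f x - s x))\<^sup>2)" 1 h]
      by (simp add: add.commute)
    have pt: "(norm (f (x + h) - f x))\<^sup>2 \<le> 2 * (norm (f (x + h) - s (x + h)))\<^sup>2
        + (4 * (norm (s (x + h) - s x))\<^sup>2 + 4 * (norm (f x - s x))\<^sup>2)" for x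
      using norm_diff_square_le[of "f (x + h)" "f x" "s (x + h)"] norm_diff_square_le[of "s (x + h)" "f x" "s x"]
      by (simp add: norm_minus_commute)
    have "translation_defect f h \<le> (\<integral>\<^sup>+x. ennreal (2 * (norm (f (x + h) - s (x + h)))\<^sup>2
        + (4 * (norm (s (x + h) - s x))\<^sup>2 + 4 * (norm (f x - s x))\<^sup>2)) \<partial>lborel)"
      unfolding translation_defect_def by (intro nn_integral_mono ennreal_leI pt)
    also have "\<dots> = (\<integral>\<^sup>+x. 2 * ennreal ((norm (f (x + h) - s (x + h)))\<^sup>2)
        + (4 * ennreal ((norm (s (x + h) - s x))\<^sup>2) + 4 * ennreal ((norm (f x - s x))\<^sup>2)) \<partial>lborel)"
      by (intro nn_integral_cong) (simp add: ennreal_plus ennreal_mult)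
    also have "\<dots> = 2 * (\<integral>\<^sup>+x. ennreal ((norm (f x - s x))\<^sup>2) \<partial>lborel)
        + (4 * translation_defect s h + 4 * (\<integral>\<^sup>+x. ennreal ((norm (f x - s x))\<^sup>2) \<partial>lborel))"
      by (simp add: nn_integral_add nn_integral_cmult tr translation_defect_def)
    also have "\<dots> \<le> 2 * ennreal (e / 12) + (4 * translation_defect s h + 4 * ennreal (e / 12))"
      by (intro add_mono mult_left_mono app order_refl) auto
    also have "\<dots> = (2 * ennreal (e / 12) + 4 * ennreal (e / 12)) + 4 * translation_defect s h"
      by (simp add: ac_simps)
    also have "2 * ennreal (e / 12) + 4 * ennreal (e / 12) = ennreal (e / 2)"
    proof -
      have "2 * ennreal (e / 12) = ennreal (2 * (e / 12))" "4 * ennreal (e / 12) = ennreal (4 * (e / 12))"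
        using e by (intro numeral_mult_ennreal, simp)+
      then show ?thesis using e by (simp flip: ennreal_plus)
    qed
    finally show ?thesis .
  qed
  have "eventually (\<lambda>h. translation_defect s h \<le> ennreal (e / 8)) (at 0)"
    by (rule translation_defect_simple_function[OF s(1) s0]) (use e in auto)
  then show ?thesis
  proof eventually_elim
    case (elim h)
    have "translation_defect f h \<le> ennreal (e / 2) + 4 * ennreal (e / 8)"
      by (rule order_trans[OF bound]) (intro add_mono mult_left_mono elim order_refl, simp)
    also have "4 * ennreal (e / 8) = ennreal (4 * (e / 8))" using e by (intro numeral_mult_ennreal) simp
    also have "ennreal (e / 2) + \<dots> = ennreal e" using e by (simp flip: ennreal_plus)
    finally show ?case .
  qed
qed

section \<open>Integration by parts in a Gelfand triple\<close>

lemma continuous_on_blinfun_pair: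
  "continuous_on UNIV (\<lambda>p::('a::real_normed_vector \<Rightarrow>\<^sub>L 'b::real_normed_vector) \<times> 'a. blinfun_apply (fst p) (snd p))"
  by (intro bounded_bilinear.continuous_on[OF bounded_bilinear_blinfun_apply]
      continuous_on_fst continuous_on_snd continuous_on_id)

lemma norm_blinfun_real:
  fixes f :: "'a::real_normed_vector \<Rightarrow>\<^sub>L real"
  shows "\<bar>f v\<bar> \<le> norm f * norm v"
  using norm_blinfun[of f v] by simp

lemma simple_limit_apply_measurable:
  fixes g :: "real \<Rightarrow> 'a::real_normed_vector \<Rightarrow>\<^sub>L real"
  assumes g: "simple_limit g"
  shows "(\<lambda>t. g t v) \<in> borel_measurable borel"
proof -
  have "continuous_on UNIV (\<lambda>p::('a \<Rightarrow>\<^sub>L real) \<times> ('a \<Rightarrow>\<^sub>L real). blinfun_apply (fst p) v)"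
    by (intro bounded_linear.continuous_on[OF blinfun.bounded_linear_left] continuous_on_fst continuous_on_id)
  from simple_limit_compose2_measurable[OF g g this, of "\<lambda>x. x" borel "\<lambda>x. x"] show ?thesis by simp
qed

lemma simple_limit_inner_measurable:
  fixes \<iota> :: "'v::real_normed_vector \<Rightarrow>\<^sub>L 'h::real_inner"
  assumes w: "simple_limit w"
  shows "(\<lambda>t. \<iota> (w t) \<bullet> h) \<in> borel_measurable borel"
proof -
  have "continuous_on UNIV (\<lambda>p::'v \<times> 'v. \<iota> (fst p) \<bullet> h)"
    by (intro continuous_on_inner bounded_linear.continuous_on[OF blinfun.bounded_linear_right]
        continuous_on_fst continuous_on_id continuous_on_const)
  from simple_limit_compose2_measurable[OF w w this, of "\<lambda>x. x" borel "\<lambda>x. x"] show ?thesis by simp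
qed

text \<open>The setting for Borel representatives of a function in \<open>X\<close> and of its
  derivative, extended by zero to the whole line, so that shifted arguments always make sense. The
  identity \<open>weak\<close> is scalar, one fixed \<open>v\<close> at a time.\<close>

locale weak_evolution =
  fixes \<iota> :: "'v::{real_inner,banach} \<Rightarrow>\<^sub>L 'h::{real_inner,banach}" and T :: real
    and w :: "real \<Rightarrow> 'v" and g :: "real \<Rightarrow> 'v \<Rightarrow>\<^sub>L real"
  assumes T_pos: "0 < T"
    and w_lim: "simple_limit w" and g_lim: "simple_limit g"
    and w_0: "\<And>t. t \<notin> {0<..<T} \<Longrightarrow> w t = 0" and g_0: "\<And>t. t \<notin> {0<..<T} \<Longrightarrow> g t = 0"
    and w_sq: "integrable lborel (\<lambda>t. (norm (w t))\<^sup>2)" and g_sq: "integrable lborel (\<lambda>t. (norm (g t))\<^sup>2)"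
    and weak: "\<And>\<phi> v. test_function T \<phi> \<Longrightarrow>
      (LINT t|lborel. deriv \<phi> t * (\<iota> (w t) \<bullet> \<iota> v)) = - (LINT t|lborel. \<phi> t * g t v)"
begin

lemmas w_measurable [measurable (raw)] = simple_limit_norm_diff_measurable[OF w_lim] simple_limit_norm_measurable[OF w_lim]
lemmas g_measurable [measurable (raw)] = simple_limit_norm_measurable[OF g_lim]

lemmas g_apply_measurable [measurable] = simple_limit_apply_measurable[OF g_lim]

lemma g_w_measurable [measurable]: "(\<lambda>t. g t (w t)) \<in> borel_measurable borel"
  using simple_limit_compose2_measurable[OF g_lim w_lim continuous_on_blinfun_pair, of "\<lambda>x. x" borel "\<lambda>x. x"] by simp

lemmas F_inner_measurable [measurable] = simple_limit_inner_measurable[OF w_lim, of \<iota>]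

lemma F_norm_measurable [measurable]: "(\<lambda>t. norm (\<iota> (w t))) \<in> borel_measurable borel"
proof -
  have "continuous_on UNIV (\<lambda>p::'v \<times> 'v. norm (\<iota> (fst p)))"
    by (intro continuous_on_norm bounded_linear.continuous_on[OF blinfun.bounded_linear_right]
        continuous_on_fst continuous_on_id)
  from simple_limit_compose2_measurable[OF w_lim w_lim this, of "\<lambda>x. x" borel "\<lambda>x. x"] show ?thesis by simp
qed

lemma integrable_indicator_time: "integrable lborel (indicat_real {0<..<T})"
  using T_pos by (intro integrable_real_indicator) auto

lemma norm_integrable:
  fixes f :: "real \<Rightarrow> 'b::real_normed_vector"
  assumes m: "(\<lambda>t. norm (f t)) \<in> borel_measurable borel" and sq: "integrable lborel (\<lambda>t. (norm (f t))\<^sup>2)"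
    and 0: "\<And>t. t \<notin> {0<..<T} \<Longrightarrow> f t = 0"
  shows "integrable lborel (\<lambda>t. norm (f t))"
proof (rule Bochner_Integration.integrable_bound[OF Bochner_Integration.integrable_add[OF integrable_indicator_time sq]])
  have "x \<le> 1 + x\<^sup>2" for x :: real
    using zero_le_power2[of "x - 1/2"] by (simp add: power2_diff power2_eq_square field_simps)
  then show "AE t in lborel. norm (norm (f t)) \<le> norm (indicat_real {0<..<T} t + (norm (f t))\<^sup>2)"
    using 0 by (intro AE_I2) (auto simp: indicator_def)
qed (use m in simp)

lemma w_norm_integrable: "integrable lborel (\<lambda>t. norm (w t))"
  by (rule norm_integrable[OF _ w_sq w_0]) auto

lemma g_norm_integrable: "integrable lborel (\<lambda>t. norm (g t))"
  by (rule norm_integrable[OF _ g_sq g_0]) auto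

lemma g_apply_integrable: "integrable lborel (\<lambda>t. g t v)"
  by (rule Bochner_Integration.integrable_bound[OF integrable_mult_left[OF g_norm_integrable, of "norm v"]])
    (use norm_blinfun_real in \<open>auto simp: abs_mult\<close>)

lemma g_w_integrable: "integrable lborel (\<lambda>t. g t (w t))"
proof (rule Bochner_Integration.integrable_bound[OF Bochner_Integration.integrable_add[OF g_sq w_sq]])
  have "\<bar>g t (w t)\<bar> \<le> (norm (g t))\<^sup>2 + (norm (w t))\<^sup>2" for t
  proof -
    have "norm (g t) * norm (w t) \<le> (norm (g t))\<^sup>2 + (norm (w t))\<^sup>2"
      using sum_squares_bound[of "norm (g t)" "norm (w t)"]
        mult_nonneg_nonneg[OF norm_ge_zero[of "g t"] norm_ge_zero[of "w t"]] by linarith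
    then show ?thesis using norm_blinfun_real[of "g t" "w t"] by linarith
  qed
  then show "AE t in lborel. norm (g t (w t)) \<le> norm ((norm (g t))\<^sup>2 + (norm (w t))\<^sup>2)"
    by (intro AE_I2) simp
qed simp

lemma F_inner_integrable: "integrable lborel (\<lambda>t. \<iota> (w t) \<bullet> h)"
proof (rule Bochner_Integration.integrable_bound[OF integrable_mult_left[OF w_norm_integrable, of "norm \<iota> * norm h"]])
  have "\<bar>\<iota> (w t) \<bullet> h\<bar> \<le> norm (w t) * (norm \<iota> * norm h)" for t
    using Cauchy_Schwarz_ineq2[of "\<iota> (w t)" h] mult_right_mono[OF norm_blinfun[of \<iota> "w t"], of "norm h"]
    by (simp add: ac_simps)
  then show "AE t in lborel. norm (\<iota> (w t) \<bullet> h) \<le> norm (norm (w t) * (norm \<iota> * norm h))"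
    by (intro AE_I2) simp
qed simp

lemma bounded_mult_integrable:
  fixes a f :: "real \<Rightarrow> real"
  assumes "integrable lborel f" "a \<in> borel_measurable borel" "\<And>t. \<bar>a t\<bar> \<le> 1"
  shows "integrable lborel (\<lambda>t. a t * f t)"
  by (rule Bochner_Integration.integrable_bound[OF assms(1)])
    (use assms in \<open>auto simp: abs_mult mult_left_le_one_le\<close>)

text \<open>A signed indicator: \<open>1\<close> on \<open>[s, t)\<close> if
  \<open>s \<le> t\<close> and \<open>-1\<close> on \<open>[t, s)\<close> otherwise. The increment
  formula then holds for times in either order.\<close>

definition weight :: "real \<Rightarrow> real \<Rightarrow> real \<Rightarrow> real" where
  "weight s t \<tau> = indicator {..<t} \<tau> - indicator {..<s} \<tau>"

lemma weight_measurable [measurable]: "weight s t \<in> borel_measurable borel"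
  unfolding weight_def by measurable

lemma weight_bound: "\<bar>weight s t \<tau>\<bar> \<le> 1"
  by (auto simp: weight_def indicator_def)

lemma weight_diff:
  fixes f :: "real \<Rightarrow> real"
  assumes "integrable lborel f"
  shows "(LINT \<tau>|lborel. indicator {..<t} \<tau> * f \<tau>) - (LINT \<tau>|lborel. indicator {..<s} \<tau> * f \<tau>) = (LINT \<tau>|lborel. weight s t \<tau> * f \<tau>)"
  unfolding weight_def left_diff_distrib
  by (rule Bochner_Integration.integral_diff[symmetric])
    (rule bounded_mult_integrable[OF assms], auto simp: indicator_def)+

text \<open>Continuity in \<open>v\<close> is what extends an identity from a countable set of test
  vectors to its closure.\<close>

lemma bounded_linear_weight: "bounded_linear (\<lambda>v. LINT \<tau>|lborel. weight s t \<tau> * g \<tau> v)"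
proof (rule bounded_linear_intro[where K="LINT \<tau>|lborel. norm (g \<tau>)"])
  have i: "integrable lborel (\<lambda>\<tau>. weight s t \<tau> * g \<tau> v)" for v
    by (rule bounded_mult_integrable[OF g_apply_integrable _ weight_bound]) simp
  show "(LINT \<tau>|lborel. weight s t \<tau> * g \<tau> (x + y)) = (LINT \<tau>|lborel. weight s t \<tau> * g \<tau> x) + (LINT \<tau>|lborel. weight s t \<tau> * g \<tau> y)" for x y
    using i by (simp add: blinfun.add_right distrib_left)
  show "(LINT \<tau>|lborel. weight s t \<tau> * g \<tau> (r *\<^sub>R x)) = r *\<^sub>R (LINT \<tau>|lborel. weight s t \<tau> * g \<tau> x)" for r x
    by (simp add: blinfun.scaleR_right mult.left_commute)
  show "norm (LINT \<tau>|lborel. weight s t \<tau> * g \<tau> x) \<le> norm x * (LINT \<tau>|lborel. norm (g \<tau>))" for x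
  proof -
    have "norm (LINT \<tau>|lborel. weight s t \<tau> * g \<tau> x) \<le> (LINT \<tau>|lborel. norm x * norm (g \<tau>))"
    proof (rule Bochner_Integration.integral_norm_bound_integral[OF i integrable_mult_right[OF g_norm_integrable]])
      fix \<tau>
      have "\<bar>weight s t \<tau>\<bar> * \<bar>g \<tau> x\<bar> \<le> 1 * (norm (g \<tau>) * norm x)"
        by (intro mult_mono weight_bound norm_blinfun_real) auto
      then show "norm (weight s t \<tau> * g \<tau> x) \<le> norm x * norm (g \<tau>)" by (simp add: abs_mult mult.commute)
    qed
    then show ?thesis by simp
  qed
qed

text \<open>The formula is demanded for all triples of times simultaneously. Thereby the only
  condition left on the points of a time grid is membership in \<open>E\<close>.\<close>

definition good_times :: "real set \<Rightarrow> bool" where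
  "good_times E \<longleftrightarrow> E \<in> sets borel \<and> E \<subseteq> {0<..<T} \<and> (AE t in lborel. t \<in> {0<..<T} \<longrightarrow> t \<in> E) \<and>
    (\<forall>s\<in>E. \<forall>t\<in>E. \<forall>r\<in>E. (\<iota> (w t) - \<iota> (w s)) \<bullet> \<iota> (w r) = (LINT \<tau>|lborel. weight s t \<tau> * g \<tau> (w r)))"

text \<open>For each fixed \<open>d\<close> the pairing of \<open>w t\<close> with \<open>d\<close>
  is a constant plus a primitive, outside a null set depending on \<open>d\<close>. A countable
  \<open>D\<close> whose closure contains almost every \<open>w t\<close> needs only one null set.
  The constants \<open>C d\<close> cancel in increments, and both sides of the increment formula are
  continuous in the test vector, so \<open>D\<close> may be replaced by its closure.\<close>

lemma good_times_exist: "\<exists>E. good_times E"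
proof -
  have "strongly_measurable lborel w"
    using w_lim unfolding simple_limit_def strongly_measurable_def by (auto intro: AE_I2)
  then obtain D where D: "countable D" "AE t in lborel. w t \<in> closure D"
    by (rule strongly_measurable_separable_range)
  have "\<exists>C. AE t in lborel. t \<in> {0<..<T} \<longrightarrow>
      \<iota> (w t) \<bullet> \<iota> d = C + (LINT s|lborel. indicator {..<t} s * g s d)" for d
    by (rule weak_derivative_imp_primitive[OF T_pos F_inner_integrable g_apply_integrable weak])
  then have "\<exists>C. \<forall>d. AE t in lborel. t \<in> {0<..<T} \<longrightarrow>
      \<iota> (w t) \<bullet> \<iota> d = C d + (LINT s|lborel. indicator {..<t} s * g s d)"
    by (intro choice allI)
  then obtain C where C: "\<And>d. AE t in lborel. t \<in> {0<..<T} \<longrightarrow>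
      \<iota> (w t) \<bullet> \<iota> d = C d + (LINT s|lborel. indicator {..<t} s * g s d)" by blast
  define E where "E = {t \<in> {0<..<T}. w t \<in> closure D \<and>
      (\<forall>d\<in>D. \<iota> (w t) \<bullet> \<iota> d = C d + (LINT s|lborel. indicator {..<t} s * g s d))}"
  have "AE t in lborel. \<forall>d\<in>D. t \<in> {0<..<T} \<longrightarrow>
      \<iota> (w t) \<bullet> \<iota> d = C d + (LINT s|lborel. indicator {..<t} s * g s d)"
    by (subst AE_ball_countable[OF D(1)]) (use C in blast)
  with D(2) have "AE t in lborel. t \<in> {0<..<T} \<longrightarrow> t \<in> E"
    by eventually_elim (simp add: E_def)
  then obtain N where "{t \<in> space lborel. \<not> (t \<in> {0<..<T} \<longrightarrow> t \<in> E)} \<subseteq> N"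
    and N: "emeasure lborel N = 0" "N \<in> sets lborel"
    by (rule AE_E)
  \<comment> \<open>Removing a Borel null set from the interval gives a Borel subset of
    \<open>E\<close> of full measure, so measurability of \<open>E\<close> itself never becomes an
    issue.\<close>
  then have sub: "{0<..<T} - N \<subseteq> E" by auto
  have "AE t in lborel. t \<notin> N" using N by (intro AE_not_in) (simp add: null_sets_def)
  then have "AE t in lborel. t \<in> {0<..<T} \<longrightarrow> t \<in> {0<..<T} - N"
    by eventually_elim simp
  moreover have "{0<..<T} - N \<in> sets borel" using N(2) by simp
  moreover have "(\<iota> (w t) - \<iota> (w s)) \<bullet> \<iota> (w r) = (LINT \<tau>|lborel. weight s t \<tau> * g \<tau> (w r))"
    if st: "s \<in> E" "t \<in> E" and r: "r \<in> E" for s t r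
  proof -
    let ?S = "{v. (\<iota> (w t) - \<iota> (w s)) \<bullet> \<iota> v = (LINT \<tau>|lborel. weight s t \<tau> * g \<tau> v)}"
    have "closed ?S"
      by (intro closed_Collect_eq linear_continuous_on[OF bounded_linear_weight] continuous_on_inner
          continuous_on_const linear_continuous_on[OF blinfun.bounded_linear_right])
    moreover have "D \<subseteq> ?S"
    proof
      fix d assume d: "d \<in> D"
      have "(\<iota> (w t) - \<iota> (w s)) \<bullet> \<iota> d = (LINT \<tau>|lborel. indicator {..<t} \<tau> * g \<tau> d) - (LINT \<tau>|lborel. indicator {..<s} \<tau> * g \<tau> d)"
        using st d by (simp add: E_def inner_diff_left)
      then show "d \<in> ?S" by (simp add: weight_diff[OF g_apply_integrable])
    qed
    ultimately have "closure D \<subseteq> ?S" by (rule closure_minimal[rotated])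
    then show ?thesis using r by (auto simp: E_def)
  qed
  ultimately have "good_times ({0<..<T} - N)" unfolding good_times_def using sub by blast
  then show ?thesis ..
qed

section \<open>Constancy of the energy defect\<close>

text \<open>This dominates the change of the energy defect over one step: it measures the error made
  when \<open>w\<close> at the two endpoints is replaced by \<open>w \<tau>\<close> inside the
  integral. With values in \<open>ennreal\<close> it is meaningful at every
  \<open>r\<close>.\<close>

definition oscillation :: "real \<Rightarrow> real \<Rightarrow> ennreal" where
  "oscillation h r = (\<integral>\<^sup>+\<tau>. ennreal (indicator {r..<r + h} \<tau> * (norm (g \<tau>) * (norm (w (r + h) - w \<tau>) + norm (w r - w \<tau>)))) \<partial>lborel)"

lemma oscillation_measurable [measurable]: "oscillation h \<in> borel_measurable borel"
proof -
  have "(\<lambda>p::real \<times> real. ennreal ((if fst p \<le> snd p \<and> snd p < fst p + h then 1 else 0) *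
      (norm (g (snd p)) * (norm (w (fst p + h) - w (snd p)) + norm (w (fst p) - w (snd p))))))
      \<in> borel_measurable (lborel \<Otimes>\<^sub>M lborel)" by measurable
  then have "(\<lambda>r. \<integral>\<^sup>+\<tau>. ennreal ((if r \<le> \<tau> \<and> \<tau> < r + h then 1 else 0) *
      (norm (g \<tau>) * (norm (w (r + h) - w \<tau>) + norm (w r - w \<tau>)))) \<partial>lborel) \<in> borel_measurable lborel"
    by (intro lborel.borel_measurable_nn_integral) (simp add: case_prod_beta')
  moreover have "(\<lambda>r. \<integral>\<^sup>+\<tau>. ennreal ((if r \<le> \<tau> \<and> \<tau> < r + h then 1 else 0) *
      (norm (g \<tau>) * (norm (w (r + h) - w \<tau>) + norm (w r - w \<tau>)))) \<partial>lborel) = oscillation h"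
    unfolding oscillation_def by (intro ext nn_integral_cong) (auto simp: indicator_def)
  ultimately show ?thesis by simp
qed

lemma translation_defect_shift:
  "(\<integral>\<^sup>+r. ennreal ((norm (w (r + h) - w (r + \<sigma>)))\<^sup>2) \<partial>lborel) = translation_defect w (h - \<sigma>)"
  unfolding translation_defect_def
  by (subst nn_integral_real_affine[of _ 1 \<sigma>]) (simp_all add: add.commute add.left_commute)

text \<open>Substituting \<open>\<tau> = r + \<sigma>\<close> and exchanging the integrals fixes the
  offset \<open>\<sigma>\<close>; the inner integral over \<open>r\<close> then compares
  \<open>w\<close> with its translates only.\<close>

lemma oscillation_integral:
  "(\<integral>\<^sup>+r. oscillation h r \<partial>lborel) = (\<integral>\<^sup>+\<sigma>. indicator {0..<h} \<sigma> *
     (\<integral>\<^sup>+r. ennreal (norm (g (r + \<sigma>)) * (norm (w (r + h) - w (r + \<sigma>)) + norm (w r - w (r + \<sigma>)))) \<partial>lborel) \<partial>lborel)"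
proof -
  let ?k = "\<lambda>r \<sigma>. norm (g (r + \<sigma>)) * (norm (w (r + h) - w (r + \<sigma>)) + norm (w r - w (r + \<sigma>)))"
  have "oscillation h r = (\<integral>\<^sup>+\<sigma>. indicator {0..<h} \<sigma> * ennreal (?k r \<sigma>) \<partial>lborel)" for r
    unfolding oscillation_def
    by (subst nn_integral_real_affine[of _ 1 r]) (auto intro!: nn_integral_cong simp: indicator_def)
  then have "(\<integral>\<^sup>+r. oscillation h r \<partial>lborel) = (\<integral>\<^sup>+r. (\<integral>\<^sup>+\<sigma>. indicator {0..<h} \<sigma> * ennreal (?k r \<sigma>) \<partial>lborel) \<partial>lborel)"
    by simp
  also have "\<dots> = (\<integral>\<^sup>+\<sigma>. (\<integral>\<^sup>+r. indicator {0..<h} \<sigma> * ennreal (?k r \<sigma>) \<partial>lborel) \<partial>lborel)"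
  proof (rule lborel_pair.Fubini'[symmetric])
    show "(\<lambda>(r, \<sigma>). indicator {0..<h} \<sigma> * ennreal (?k r \<sigma>)) \<in> borel_measurable (lborel \<Otimes>\<^sub>M lborel)"
      by measurable
  qed
  also have "\<dots> = (\<integral>\<^sup>+\<sigma>. indicator {0..<h} \<sigma> * (\<integral>\<^sup>+r. ennreal (?k r \<sigma>) \<partial>lborel) \<partial>lborel)"
    by (intro nn_integral_cong nn_integral_cmult) measurable
  finally show ?thesis .
qed

text \<open>For each offset \<open>\<sigma>\<close> the shifts \<open>\<sigma>\<close> and
  \<open>h - \<sigma>\<close> are smaller than \<open>\<delta>\<close>, so Young's inequality and
  the continuity of translations bound the inner integral by \<open>\<epsilon>\<close>. The
  remaining integration over \<open>\<sigma>\<close> in \<open>[0, h)\<close> contributes the factor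
  \<open>h\<close>.\<close>

lemma oscillation_small:
  assumes "\<epsilon> > 0"
  obtains \<delta> where "\<delta> > 0" "\<And>h. 0 < h \<Longrightarrow> h < \<delta> \<Longrightarrow> (\<integral>\<^sup>+r. oscillation h r \<partial>lborel) \<le> ennreal (\<epsilon> * h)"
proof -
  define \<Gamma> where "\<Gamma> = (LINT t|lborel. (norm (g t))\<^sup>2)"
  have \<Gamma>0: "\<Gamma> \<ge> 0" unfolding \<Gamma>_def by simp
  have \<Gamma>: "(\<integral>\<^sup>+r. ennreal ((norm (g (r + \<sigma>)))\<^sup>2) \<partial>lborel) = ennreal \<Gamma>" for \<sigma>
  proof -
    have "(\<integral>\<^sup>+r. ennreal ((norm (g (r + \<sigma>)))\<^sup>2) \<partial>lborel) = (\<integral>\<^sup>+r. ennreal ((norm (g r))\<^sup>2) \<partial>lborel)"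
      using nn_integral_real_affine[of "\<lambda>r. ennreal ((norm (g r))\<^sup>2)" 1 \<sigma>] by (simp add: add.commute)
    then show ?thesis unfolding \<Gamma>_def by (subst (asm) nn_integral_eq_integral[OF g_sq]) auto
  qed
  \<comment> \<open>Young's inequality with parameter \<open>\<eta>\<close> gives
    \<open>\<eta> \<Gamma>\<close> from \<open>g\<close> and, once the defects are at most
    \<open>\<eta>^2\<close>, the amount \<open>(\<eta>^2 + \<eta>^2) / (2 \<eta>) = \<eta>\<close>
    from \<open>w\<close>. Their sum \<open>\<eta> (\<Gamma> + 1)\<close> is
    \<open>\<epsilon>\<close>.\<close>
  define \<eta> where "\<eta> = \<epsilon> / (\<Gamma> + 1)"
  have \<eta>: "\<eta> > 0" using assms \<Gamma>0 by (simp add: \<eta>_def)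
  have "eventually (\<lambda>h. translation_defect w h \<le> ennreal (\<eta>\<^sup>2)) (at 0)"
    by (rule translation_defect_tendsto_0[OF w_lim w_sq w_0]) (use \<eta> in auto)
  then obtain \<delta> where \<delta>: "\<delta> > 0" and "\<And>h. h \<noteq> 0 \<Longrightarrow> \<bar>h\<bar> < \<delta> \<Longrightarrow> translation_defect w h \<le> ennreal (\<eta>\<^sup>2)"
    unfolding eventually_at by (auto simp: dist_real_def)
  moreover have "translation_defect w 0 \<le> ennreal (\<eta>\<^sup>2)" by (simp add: translation_defect_def)
  ultimately have W: "translation_defect w h \<le> ennreal (\<eta>\<^sup>2)" if "\<bar>h\<bar> < \<delta>" for h
    using that by (cases "h = 0") auto
  have "(\<integral>\<^sup>+r. oscillation h r \<partial>lborel) \<le> ennreal (\<epsilon> * h)" if h: "0 < h" "h < \<delta>" for h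
  proof -
    have inner: "(\<integral>\<^sup>+r. ennreal (norm (g (r + \<sigma>)) * (norm (w (r + h) - w (r + \<sigma>)) + norm (w r - w (r + \<sigma>)))) \<partial>lborel) \<le> ennreal \<epsilon>"
      if \<sigma>: "\<sigma> \<in> {0..<h}" for \<sigma>
    proof -
      have young: "a * (x + y) \<le> \<eta> * a\<^sup>2 + (1 / (2 * \<eta>)) * (x\<^sup>2 + y\<^sup>2)" for a x y :: real
      proof -
        have "0 \<le> (2 * \<eta> * a - (x + y))\<^sup>2 + (x - y)\<^sup>2" by simp
        also have "\<dots> = 4 * \<eta> * (\<eta> * a\<^sup>2 + (1 / (2 * \<eta>)) * (x\<^sup>2 + y\<^sup>2) - a * (x + y))"
          using \<eta> by (simp add: field_simps power2_eq_square)
        finally show ?thesis using \<eta> by (simp add: zero_le_mult_iff)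
      qed
      have "(\<integral>\<^sup>+r. ennreal (norm (g (r + \<sigma>)) * (norm (w (r + h) - w (r + \<sigma>)) + norm (w r - w (r + \<sigma>)))) \<partial>lborel)
        \<le> (\<integral>\<^sup>+r. ennreal (\<eta> * (norm (g (r + \<sigma>)))\<^sup>2 +
            (1 / (2 * \<eta>)) * ((norm (w (r + h) - w (r + \<sigma>)))\<^sup>2 + (norm (w (r + \<sigma>) - w r))\<^sup>2)) \<partial>lborel)"
      proof (intro nn_integral_mono ennreal_leI)
        fix r
        show "norm (g (r + \<sigma>)) * (norm (w (r + h) - w (r + \<sigma>)) + norm (w r - w (r + \<sigma>))) \<le> \<eta> * (norm (g (r + \<sigma>)))\<^sup>2 +
            (1 / (2 * \<eta>)) * ((norm (w (r + h) - w (r + \<sigma>)))\<^sup>2 + (norm (w (r + \<sigma>) - w r))\<^sup>2)"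
          unfolding norm_minus_commute[of "w (r + \<sigma>)" "w r"] by (rule young)
      qed
      also have "\<dots> = (\<integral>\<^sup>+r. ennreal \<eta> * ennreal ((norm (g (r + \<sigma>)))\<^sup>2) +
            ennreal (1 / (2 * \<eta>)) * (ennreal ((norm (w (r + h) - w (r + \<sigma>)))\<^sup>2) + ennreal ((norm (w (r + \<sigma>) - w r))\<^sup>2)) \<partial>lborel)"
        using \<eta> by (intro nn_integral_cong) (simp flip: ennreal_plus ennreal_mult)
      also have "\<dots> = ennreal \<eta> * ennreal \<Gamma> + ennreal (1 / (2 * \<eta>)) * (translation_defect w (h - \<sigma>) + translation_defect w \<sigma>)"
        by (simp add: nn_integral_add nn_integral_cmult \<Gamma> translation_defect_shift) (simp add: translation_defect_def)
      also have "\<dots> \<le> ennreal \<eta> * ennreal \<Gamma> + ennreal (1 / (2 * \<eta>)) * (ennreal (\<eta>\<^sup>2) + ennreal (\<eta>\<^sup>2))"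
        using \<sigma> h by (intro add_mono mult_left_mono W order_refl) auto
      also have "\<dots> = ennreal (\<eta> * \<Gamma> + (1 / (2 * \<eta>)) * (\<eta>\<^sup>2 + \<eta>\<^sup>2))"
        using \<eta> \<Gamma>0 by (simp flip: ennreal_plus ennreal_mult)
      also have "\<eta> * \<Gamma> + (1 / (2 * \<eta>)) * (\<eta>\<^sup>2 + \<eta>\<^sup>2) = \<eta> * (\<Gamma> + 1)"
        using \<eta> by (simp add: power2_eq_square field_simps)
      also have "\<dots> = \<epsilon>" using \<Gamma>0 by (simp add: \<eta>_def)
      finally show ?thesis .
    qed
    have "(\<integral>\<^sup>+r. oscillation h r \<partial>lborel) \<le> (\<integral>\<^sup>+\<sigma>. ennreal \<epsilon> * indicator {0..<h} \<sigma> \<partial>lborel)"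
      unfolding oscillation_integral using inner by (intro nn_integral_mono) (auto simp: indicator_def)
    also have "\<dots> = ennreal \<epsilon> * ennreal h" using h by (simp add: nn_integral_cmult_indicator)
    also have "\<dots> = ennreal (\<epsilon> * h)" using assms h by (simp add: ennreal_mult)
    finally show ?thesis .
  qed
  with \<delta> show ?thesis by (rule that)
qed

definition energy_defect :: "real \<Rightarrow> real" where
  "energy_defect t = (norm (\<iota> (w t)))\<^sup>2 - 2 * (LINT \<tau>|lborel. indicator {..<t} \<tau> * g \<tau> (w \<tau>))"

lemma energy_defect_measurable [measurable]: "energy_defect \<in> borel_measurable borel"
  unfolding energy_defect_def
  by (intro borel_measurable_diff borel_measurable_power borel_measurable_times borel_measurable_const primitive_measurable)
    simp_all

text \<open>A difference of squared norms is the increment paired with both endpoint values, and the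
  formula for good times turns each pairing into an integral. Subtracting twice the integral of
  \<open>g \<tau> (w \<tau>)\<close> leaves only the differences of the endpoint values to
  \<open>w \<tau>\<close>.\<close>

lemma energy_defect_increment:
  assumes E: "good_times E" and r: "r \<in> E" "r + h \<in> E" and h: "0 < h"
  shows "ennreal \<bar>energy_defect (r + h) - energy_defect r\<bar> \<le> oscillation h r"
proof -
  let ?W = "weight r (r + h)"
  have W: "?W \<tau> = indicator {r..<r + h} \<tau>" for \<tau>
    using h by (auto simp: weight_def indicator_def)
  have i: "integrable lborel (\<lambda>\<tau>. ?W \<tau> * f \<tau>)" if "integrable lborel f" for f
    by (rule bounded_mult_integrable[OF that _ weight_bound]) simp
  have "(norm (\<iota> (w (r + h))))\<^sup>2 - (norm (\<iota> (w r)))\<^sup>2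
      = (\<iota> (w (r + h)) - \<iota> (w r)) \<bullet> \<iota> (w (r + h)) + (\<iota> (w (r + h)) - \<iota> (w r)) \<bullet> \<iota> (w r)"
    by (simp add: power2_norm_eq_inner algebra_simps inner_commute)
  also have "\<dots> = (LINT \<tau>|lborel. ?W \<tau> * g \<tau> (w (r + h))) + (LINT \<tau>|lborel. ?W \<tau> * g \<tau> (w r))"
    using E r by (simp add: good_times_def)
  finally have "energy_defect (r + h) - energy_defect r =
      (LINT \<tau>|lborel. ?W \<tau> * g \<tau> (w (r + h))) + (LINT \<tau>|lborel. ?W \<tau> * g \<tau> (w r)) - 2 * (LINT \<tau>|lborel. ?W \<tau> * g \<tau> (w \<tau>))"
    using weight_diff[OF g_w_integrable, of "r + h" r] by (simp add: energy_defect_def)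
  also have "\<dots> = (LINT \<tau>|lborel. (?W \<tau> * g \<tau> (w (r + h)) + ?W \<tau> * g \<tau> (w r)) - 2 * (?W \<tau> * g \<tau> (w \<tau>)))"
    using i[OF g_apply_integrable] i[OF g_w_integrable] by simp
  also have "\<dots> = (LINT \<tau>|lborel. ?W \<tau> * (g \<tau> (w (r + h) - w \<tau>) + g \<tau> (w r - w \<tau>)))"
    by (intro Bochner_Integration.integral_cong) (simp_all add: blinfun.diff_right algebra_simps)
  finally have eq: "energy_defect (r + h) - energy_defect r = \<dots>" .
  have "ennreal \<bar>energy_defect (r + h) - energy_defect r\<bar> \<le> (\<integral>\<^sup>+\<tau>. ennreal (norm (?W \<tau> * (g \<tau> (w (r + h) - w \<tau>) + g \<tau> (w r - w \<tau>)))) \<partial>lborel)"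
  proof -
    have "integrable lborel (\<lambda>\<tau>. ?W \<tau> * (g \<tau> (w (r + h) - w \<tau>) + g \<tau> (w r - w \<tau>)))"
      using g_apply_integrable g_w_integrable
      by (intro i Bochner_Integration.integrable_add) (auto simp: blinfun.diff_right)
    from integral_norm_bound_ennreal[OF this] show ?thesis by (simp add: eq)
  qed
  also have "\<dots> \<le> oscillation h r"
    unfolding oscillation_def
  proof (intro nn_integral_mono ennreal_leI)
    fix \<tau>
    have "\<bar>g \<tau> (w (r + h) - w \<tau>) + g \<tau> (w r - w \<tau>)\<bar> \<le> norm (g \<tau>) * (norm (w (r + h) - w \<tau>) + norm (w r - w \<tau>))"
      using norm_blinfun_real[of "g \<tau>" "w (r + h) - w \<tau>"] norm_blinfun_real[of "g \<tau>" "w r - w \<tau>"]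
      by (simp add: distrib_left)
    then show "norm (?W \<tau> * (g \<tau> (w (r + h) - w \<tau>) + g \<tau> (w r - w \<tau>)))
        \<le> indicator {r..<r + h} \<tau> * (norm (g \<tau>) * (norm (w (r + h) - w \<tau>) + norm (w r - w \<tau>)))"
      unfolding W by (auto simp: indicator_def)
  qed
  finally show ?thesis .
qed

text \<open>The shift \<open>H\<close> is cut into \<open>n\<close> steps of length
  \<open>h\<close>. Each step contributes at most \<open>(e / H) * h\<close> in the mean, so all of
  them together at most \<open>e\<close>, whatever \<open>n\<close> is. The grid points lie between
  \<open>r\<close> and \<open>r + H\<close>, hence in the interval, and for almost every
  \<open>r\<close> all of them are good times.\<close>

lemma energy_defect_invariant_pos:
  assumes H: "0 < H"
  shows "AE r in lborel. r \<in> {0<..<T} \<longrightarrow> r + H \<in> {0<..<T} \<longrightarrow> energy_defect (r + H) = energy_defect r"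
proof -
  obtain E where E: "good_times E" using good_times_exist by blast
  have [measurable]: "E \<in> sets borel" and ae: "AE t in lborel. t \<in> {0<..<T} \<longrightarrow> t \<in> E"
    using E by (auto simp: good_times_def)
  define Q where "Q r = (if r \<in> {0<..<T} \<and> r + H \<in> {0<..<T} then ennreal \<bar>energy_defect (r + H) - energy_defect r\<bar> else 0)" for r
  have [measurable]: "Q \<in> borel_measurable borel" unfolding Q_def by measurable
  have "(\<integral>\<^sup>+r. Q r \<partial>lborel) \<le> ennreal e" if e: "e > 0" for e
  proof -
    have "e / H > 0" using e H by simp
    then obtain \<delta> where \<delta>: "\<delta> > 0" "\<And>h. 0 < h \<Longrightarrow> h < \<delta> \<Longrightarrow> (\<integral>\<^sup>+r. oscillation h r \<partial>lborel) \<le> ennreal (e / H * h)"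
      by (rule oscillation_small) (rule that)
    obtain n where n: "H / \<delta> < real n" using reals_Archimedean2 by blast
    then have n0: "real n > 0" using H \<delta>(1) by (meson divide_pos_pos less_trans)
    define h where "h = H / real n"
    have h: "0 < h" "h < \<delta>" "real n * h = H"
      using n n0 H \<delta>(1) by (auto simp: h_def field_simps)
    have "AE r in lborel. \<forall>i\<in>{..n}. r + real i * h \<in> {0<..<T} \<longrightarrow> r + real i * h \<in> E"
    proof (subst AE_ball_countable)
      show "\<forall>i\<in>{..n}. AE r in lborel. r + real i * h \<in> {0<..<T} \<longrightarrow> r + real i * h \<in> E"
      proof
        fix i
        have "AE r in lborel. real i * h + 1 * r \<in> {0<..<T} \<longrightarrow> real i * h + 1 * r \<in> E"
          by (rule AE_borel_affine[OF _ _ ae]) (simp, measurable)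
        then show "AE r in lborel. r + real i * h \<in> {0<..<T} \<longrightarrow> r + real i * h \<in> E"
          by (simp add: add.commute)
      qed
    qed simp
    then have "AE r in lborel. Q r \<le> (\<Sum>i<n. oscillation h (r + real i * h))"
    proof eventually_elim
      case (elim r)
      show ?case
      proof (cases "r \<in> {0<..<T} \<and> r + H \<in> {0<..<T}")
        case True
        have inE: "r + real i * h \<in> E" if "i \<le> n" for i
        proof -
          have "0 \<le> real i * h" "real i * h \<le> real n * h" using that h(1) by (auto intro: mult_right_mono)
          then have "r + real i * h \<in> {0<..<T}" using True h(3) by auto
          then show ?thesis using elim that by auto
        qed
        have "energy_defect (r + H) - energy_defect r
            = (\<Sum>i<n. energy_defect (r + real (Suc i) * h) - energy_defect (r + real i * h))"
          using sum_lessThan_telescope[of "\<lambda>i. energy_defect (r + real i * h)" n] h(3) by simp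
        then have "ennreal \<bar>energy_defect (r + H) - energy_defect r\<bar>
            \<le> ennreal (\<Sum>i<n. \<bar>energy_defect (r + real (Suc i) * h) - energy_defect (r + real i * h)\<bar>)"
          by (auto intro!: ennreal_leI sum_abs)
        also have "\<dots> = (\<Sum>i<n. ennreal \<bar>energy_defect (r + real (Suc i) * h) - energy_defect (r + real i * h)\<bar>)"
          by (simp add: sum_ennreal)
        also have "\<dots> \<le> (\<Sum>i<n. oscillation h (r + real i * h))"
        proof (rule sum_mono)
          fix i assume "i \<in> {..<n}"
          then have "r + real i * h \<in> E" "(r + real i * h) + h \<in> E"
            using inE[of i] inE[of "Suc i"] by (auto simp: algebra_simps)
          from energy_defect_increment[OF E this h(1)]
          show "ennreal \<bar>energy_defect (r + real (Suc i) * h) - energy_defect (r + real i * h)\<bar> \<le> oscillation h (r + real i * h)"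
            by (simp add: algebra_simps)
        qed
        finally show ?thesis using True by (simp add: Q_def)
      qed (auto simp: Q_def)
    qed
    then have "(\<integral>\<^sup>+r. Q r \<partial>lborel) \<le> (\<integral>\<^sup>+r. (\<Sum>i<n. oscillation h (r + real i * h)) \<partial>lborel)"
      by (rule nn_integral_mono_AE)
    also have "\<dots> = (\<Sum>i<n. \<integral>\<^sup>+r. oscillation h (r + real i * h) \<partial>lborel)"
      by (rule nn_integral_sum) measurable
    also have "\<dots> = (\<Sum>i<n. \<integral>\<^sup>+r. oscillation h r \<partial>lborel)"
    proof (rule sum.cong[OF refl])
      fix i
      show "(\<integral>\<^sup>+r. oscillation h (r + real i * h) \<partial>lborel) = (\<integral>\<^sup>+r. oscillation h r \<partial>lborel)"
        using nn_integral_real_affine[of "oscillation h" 1 "real i * h"] by (simp add: add.commute)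
    qed
    also have "\<dots> \<le> (\<Sum>i<n. ennreal (e / H * h))"
      by (intro sum_mono \<delta>(2) h)
    also have "\<dots> = ennreal (real n * (e / H * h))"
      using e H h(1) by (subst sum_ennreal) auto
    also have "real n * (e / H * h) = e" using h(3) H by (simp add: field_simps)
    finally show ?thesis .
  qed
  then have "(\<integral>\<^sup>+r. Q r \<partial>lborel) \<le> 0"
    by - (rule ennreal_le_epsilon, simp)
  then have "AE r in lborel. Q r = 0" by (simp add: nn_integral_0_iff_AE)
  then show ?thesis by eventually_elim (auto simp: Q_def split: if_splits)
qed

lemma energy_defect_invariant:
  "AE r in lborel. r \<in> {0<..<T} \<longrightarrow> r + H \<in> {0<..<T} \<longrightarrow> energy_defect (r + H) = energy_defect r"
proof -
  consider "H > 0" | "H = 0" | "H < 0" by linarith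
  then show ?thesis
  proof cases
    case 1 then show ?thesis by (rule energy_defect_invariant_pos)
  next
    case 3
    \<comment> \<open>The case of the positive shift \<open>- H\<close>, used at the point
      \<open>r + H\<close>.\<close>
    have "AE r in lborel. H + 1 * r \<in> {0<..<T} \<longrightarrow> H + 1 * r + - H \<in> {0<..<T} \<longrightarrow>
        energy_defect (H + 1 * r + - H) = energy_defect (H + 1 * r)"
      by (rule AE_borel_affine[OF _ _ energy_defect_invariant_pos]) (use 3 in simp_all)
    then show ?thesis by eventually_elim (simp add: add.commute)
  qed simp
qed

lemma energy_identity:
  obtains E C where "good_times E" "\<And>t. t \<in> E \<Longrightarrow> energy_defect t = C"
proof -
  obtain E where E: "good_times E" using good_times_exist by blast
  obtain C where C: "AE t in lborel. t \<in> {0<..<T} \<longrightarrow> energy_defect t = C"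
    using AE_const_if_translation_invariant[OF energy_defect_measurable T_pos energy_defect_invariant] by blast
  have [measurable]: "E \<in> sets borel" and ae: "AE t in lborel. t \<in> {0<..<T} \<longrightarrow> t \<in> E"
    using E by (auto simp: good_times_def)
  have "{t. t \<in> E \<and> energy_defect t = C} \<in> sets borel" by measurable
  moreover have "AE t in lborel. t \<in> {0<..<T} \<longrightarrow> t \<in> {t. t \<in> E \<and> energy_defect t = C}"
    using ae C by eventually_elim simp
  ultimately have "good_times {t. t \<in> E \<and> energy_defect t = C}"
    using E by (simp add: good_times_def) blast
  then show ?thesis by (rule that) simp
qed

end

section \<open>From the energy identity to a continuous representative\<close>

lemma continuous_on_primitive:
  fixes f :: "real \<Rightarrow> real"
  assumes f: "integrable lborel f"
  shows "continuous_on S (\<lambda>t. LINT \<tau>|lborel. indicator {..<t} \<tau> * f \<tau>)"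
proof -
  have "isCont (\<lambda>t. LINT \<tau>|lborel. indicator {..<t} \<tau> * f \<tau>) x" for x
    unfolding continuous_at_sequentially o_def
  proof (intro allI impI)
    fix X :: "nat \<Rightarrow> real" assume X: "X \<longlonglongrightarrow> x"
    show "(\<lambda>n. LINT \<tau>|lborel. indicator {..<X n} \<tau> * f \<tau>) \<longlonglongrightarrow> (LINT \<tau>|lborel. indicator {..<x} \<tau> * f \<tau>)"
    proof (rule integral_dominated_convergence[where w="\<lambda>\<tau>. norm (f \<tau>)"])
      show "AE \<tau> in lborel. (\<lambda>n. indicator {..<X n} \<tau> * f \<tau>) \<longlonglongrightarrow> indicator {..<x} \<tau> * f \<tau>"
        using AE_lborel_singleton[of x]
      proof eventually_elim
        case (elim \<tau>)
        then consider "\<tau> < x" | "x < \<tau>" by linarith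
        then have "eventually (\<lambda>n. indicator {..<x} \<tau> * f \<tau> = indicator {..<X n} \<tau> * f \<tau>) sequentially"
        proof cases
          case 1
          from order_tendstoD(1)[OF X 1] show ?thesis by eventually_elim (use 1 in simp)
        next
          case 2
          from order_tendstoD(2)[OF X 2] show ?thesis by eventually_elim (use 2 in simp)
        qed
        then show ?case by (rule Lim_transform_eventually[OF tendsto_const])
      qed
    qed (use f in \<open>auto simp: abs_mult indicator_def\<close>)
  qed
  then show ?thesis by (simp add: continuous_at_imp_continuous_on)
qed

text \<open>A point of the interval outside the closure would have a whole ball around it that
  misses \<open>E\<close>, and a ball has positive measure.\<close>

lemma closure_full_measure:
  fixes E :: "real set"
  assumes T: "0 < T" and sub: "E \<subseteq> {0<..<T}" and ae: "AE t in lborel. t \<in> {0<..<T} \<longrightarrow> t \<in> E"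
  shows "closure E = {0..T}"
proof -
  have "{0<..<T} \<subseteq> closure E"
  proof (rule ccontr)
    assume "\<not> ?thesis"
    then obtain x where x: "x \<in> {0<..<T}" "x \<notin> closure E" by blast
    have "open ({0<..<T} - closure E)" by (intro open_Diff) auto
    then obtain e where e: "e > 0" "ball x e \<subseteq> {0<..<T} - closure E"
      using x open_contains_ball by (metis Diff_iff)
    have "ball x e \<inter> E = {}" using e(2) closure_subset[of E] by auto
    with ae e(2) have "AE t in lborel. t \<notin> ball x e"
      by (auto elim!: eventually_mono)
    then have "emeasure lborel (ball x e) = 0"
      by (subst (asm) AE_iff_measurable[of "ball x e"]) auto
    moreover have "ball x e = {x - e<..<x + e}" by (auto simp: dist_real_def)
    ultimately show False using e(1) by simp
  qed
  then have "closure {0<..<T} \<subseteq> closure E" by (metis closure_closure closure_mono)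
  moreover have "closure E \<subseteq> closure {0<..<T}" using sub by (rule closure_mono)
  ultimately show ?thesis using T by simp
qed

context weak_evolution
begin

lemma weight_eq: "s \<le> t \<Longrightarrow> weight s t \<tau> = indicator {s..<t} \<tau>"
  by (auto simp: weight_def indicator_def)

text \<open>If every good time in \<open>[s, t)\<close> violated the bound, integrating the
  violation would contradict the value of the integral; the extra \<open>t - s\<close> on the right
  makes this contradiction strict. The purpose is a time whose \<open>V\<close>-norm is controlled,
  which the endpoints \<open>s\<close> and \<open>t\<close> need not have.\<close>

lemma good_time_below_average:
  assumes E: "good_times E" and st: "s \<in> E" "t \<in> E" "s < t"
  obtains r where "r \<in> E" "s \<le> r" "r \<le> t"
    "(t - s) * (norm (w r))\<^sup>2 \<le> (LINT \<tau>|lborel. weight s t \<tau> * (norm (w \<tau>))\<^sup>2) + (t - s)"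
proof -
  let ?J = "LINT \<tau>|lborel. weight s t \<tau> * (norm (w \<tau>))\<^sup>2"
  have sub: "{s..<t} \<subseteq> {0<..<T}" using E st unfolding good_times_def by fastforce
  have ae: "AE t in lborel. t \<in> {0<..<T} \<longrightarrow> t \<in> E" using E by (auto simp: good_times_def)
  have W: "integrable lborel (weight s t)" "(LINT \<tau>|lborel. weight s t \<tau>) = t - s"
    unfolding weight_eq[OF less_imp_le[OF st(3)], abs_def] using st(3) by simp_all
  have i: "integrable lborel (\<lambda>\<tau>. weight s t \<tau> * (norm (w \<tau>))\<^sup>2)"
    by (rule bounded_mult_integrable[OF w_sq _ weight_bound]) simp
  have "\<exists>r\<in>E. s \<le> r \<and> r \<le> t \<and> (t - s) * (norm (w r))\<^sup>2 \<le> ?J + (t - s)"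
  proof (rule ccontr)
    assume no: "\<not> ?thesis"
    have "(LINT \<tau>|lborel. weight s t \<tau> * (?J + (t - s))) \<le> (LINT \<tau>|lborel. (t - s) * (weight s t \<tau> * (norm (w \<tau>))\<^sup>2))"
    proof (rule integral_mono_AE)
      show "AE \<tau> in lborel. weight s t \<tau> * (?J + (t - s)) \<le> (t - s) * (weight s t \<tau> * (norm (w \<tau>))\<^sup>2)"
        using ae
      proof eventually_elim
        case (elim \<tau>)
        show ?case
        proof (cases "\<tau> \<in> {s..<t}")
          case True
          then have "\<tau> \<in> E" using elim sub by blast
          then have "?J + (t - s) < (t - s) * (norm (w \<tau>))\<^sup>2" using no True by force
          then show ?thesis using True st(3) by (simp add: weight_eq)
        qed (use st(3) in \<open>simp add: weight_eq\<close>)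
      qed
    qed (use W i in auto)
    then have "(t - s) * (?J + (t - s)) \<le> (t - s) * ?J" using W i by simp
    then show False using st(3) by simp
  qed
  then show ?thesis using that by blast
qed

text \<open>A nondecreasing continuous function of time that controls the modulus of continuity of
  \<open>w\<close> in \<open>H\<close>. The indicator supplies the summand \<open>t - s\<close>
  needed in \<open>good_time_below_average\<close>.\<close>

definition action :: "real \<Rightarrow> real" where
  "action t = (LINT \<tau>|lborel. indicator {..<t} \<tau> * ((norm (g \<tau>))\<^sup>2 + (norm (w \<tau>))\<^sup>2 + indicator {0<..<T} \<tau>))"

lemma action_integrable: "integrable lborel (\<lambda>\<tau>. (norm (g \<tau>))\<^sup>2 + (norm (w \<tau>))\<^sup>2 + indicat_real {0<..<T} \<tau>)"
  by (intro Bochner_Integration.integrable_add g_sq w_sq integrable_indicator_time)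

text \<open>Both endpoints are compared with an intermediate time \<open>r\<close> of controlled
  \<open>V\<close>-norm. The square of the difference is the difference of squares minus twice the
  increment paired with \<open>w r\<close>; the energy identity evaluates the former, the increment
  formula the latter. Each comparison costs \<open>2 * (action t - action s)\<close>, and combining
  the two doubles each of them, whence \<open>8\<close>.\<close>

lemma increment_bound:
  assumes E: "good_times E" and C: "\<And>t. t \<in> E \<Longrightarrow> energy_defect t = C"
    and st: "s \<in> E" "t \<in> E" "s < t"
  shows "(norm (\<iota> (w t) - \<iota> (w s)))\<^sup>2 \<le> 8 * (action t - action s)"
proof -
  obtain r where r: "r \<in> E" "s \<le> r" "r \<le> t"
    and avg: "(t - s) * (norm (w r))\<^sup>2 \<le> (LINT \<tau>|lborel. weight s t \<tau> * (norm (w \<tau>))\<^sup>2) + (t - s)"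
    by (rule good_time_below_average[OF E st]) (rule that)
  have sub: "{s..<t} \<subseteq> {0<..<T}" using E st unfolding good_times_def by fastforce
  have W: "integrable lborel (weight s t)" "(LINT \<tau>|lborel. weight s t \<tau>) = t - s"
    unfolding weight_eq[OF less_imp_le[OF st(3)], abs_def] using st(3) by simp_all
  have i: "integrable lborel (\<lambda>\<tau>. weight a b \<tau> * f \<tau>)" if "integrable lborel f" for f a b
    by (rule bounded_mult_integrable[OF that _ weight_bound]) simp
  have "(norm (\<iota> (w x) - \<iota> (w r)))\<^sup>2 \<le> 2 * (action t - action s)" if x: "x \<in> E" "s \<le> x" "x \<le> t" for x
  proof -
    have "(norm (\<iota> (w x) - \<iota> (w r)))\<^sup>2 = ((norm (\<iota> (w x)))\<^sup>2 - (norm (\<iota> (w r)))\<^sup>2) - 2 * ((\<iota> (w x) - \<iota> (w r)) \<bullet> \<iota> (w r))"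
      by (simp add: power2_norm_eq_inner algebra_simps inner_commute)
    also have "(norm (\<iota> (w x)))\<^sup>2 - (norm (\<iota> (w r)))\<^sup>2 = 2 * (LINT \<tau>|lborel. weight r x \<tau> * g \<tau> (w \<tau>))"
      using C[OF x(1)] C[OF r(1)] weight_diff[OF g_w_integrable, of x r] by (simp add: energy_defect_def)
    also have "(\<iota> (w x) - \<iota> (w r)) \<bullet> \<iota> (w r) = (LINT \<tau>|lborel. weight r x \<tau> * g \<tau> (w r))"
      using E x(1) r(1) by (simp add: good_times_def)
    also have "2 * (LINT \<tau>|lborel. weight r x \<tau> * g \<tau> (w \<tau>)) - 2 * (LINT \<tau>|lborel. weight r x \<tau> * g \<tau> (w r))
        = (LINT \<tau>|lborel. 2 * (weight r x \<tau> * g \<tau> (w \<tau>)) - 2 * (weight r x \<tau> * g \<tau> (w r)))"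
      using i[OF g_w_integrable] i[OF g_apply_integrable] by simp
    also have "\<dots> \<le> (LINT \<tau>|lborel. 2 * (weight s t \<tau> * (norm (g \<tau>))\<^sup>2) + (weight s t \<tau> * (norm (w \<tau>))\<^sup>2 + weight s t \<tau> * (norm (w r))\<^sup>2))"
    proof (rule integral_mono)
      fix \<tau>
      have abs_w: "\<bar>weight r x \<tau>\<bar> \<le> weight s t \<tau>"
        using r x by (auto simp: weight_def indicator_def)
      have "2 * (weight r x \<tau> * g \<tau> (w \<tau>)) - 2 * (weight r x \<tau> * g \<tau> (w r)) \<le> \<bar>weight r x \<tau>\<bar> * (2 * \<bar>g \<tau> (w \<tau>)\<bar> + 2 * \<bar>g \<tau> (w r)\<bar>)"
        using abs_ge_self[of "weight r x \<tau> * g \<tau> (w \<tau>)"] abs_ge_minus_self[of "weight r x \<tau> * g \<tau> (w r)"]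
        by (simp add: abs_mult distrib_left)
      also have "\<dots> \<le> weight s t \<tau> * (2 * (norm (g \<tau>))\<^sup>2 + ((norm (w \<tau>))\<^sup>2 + (norm (w r))\<^sup>2))"
      proof (rule mult_mono[OF abs_w])
        have "2 * \<bar>g \<tau> v\<bar> \<le> (norm (g \<tau>))\<^sup>2 + (norm v)\<^sup>2" for v
          using norm_blinfun_real[of "g \<tau>" v] sum_squares_bound[of "norm (g \<tau>)" "norm v"] by linarith
        from this[of "w \<tau>"] this[of "w r"]
        show "2 * \<bar>g \<tau> (w \<tau>)\<bar> + 2 * \<bar>g \<tau> (w r)\<bar> \<le> 2 * (norm (g \<tau>))\<^sup>2 + ((norm (w \<tau>))\<^sup>2 + (norm (w r))\<^sup>2)"
          by linarith
      qed (use abs_w in auto)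
      finally show "2 * (weight r x \<tau> * g \<tau> (w \<tau>)) - 2 * (weight r x \<tau> * g \<tau> (w r))
          \<le> 2 * (weight s t \<tau> * (norm (g \<tau>))\<^sup>2) + (weight s t \<tau> * (norm (w \<tau>))\<^sup>2 + weight s t \<tau> * (norm (w r))\<^sup>2)"
        by (simp add: algebra_simps)
    next
      show "integrable lborel (\<lambda>\<tau>. 2 * (weight r x \<tau> * g \<tau> (w \<tau>)) - 2 * (weight r x \<tau> * g \<tau> (w r)))"
        using i[OF g_w_integrable] i[OF g_apply_integrable] by simp
      show "integrable lborel (\<lambda>\<tau>. 2 * (weight s t \<tau> * (norm (g \<tau>))\<^sup>2) + (weight s t \<tau> * (norm (w \<tau>))\<^sup>2 + weight s t \<tau> * (norm (w r))\<^sup>2))"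
        using i[OF g_sq] i[OF w_sq] W(1) by simp
    qed
    also have "\<dots> = 2 * (LINT \<tau>|lborel. weight s t \<tau> * (norm (g \<tau>))\<^sup>2) + ((LINT \<tau>|lborel. weight s t \<tau> * (norm (w \<tau>))\<^sup>2) + (t - s) * (norm (w r))\<^sup>2)"
      using i[OF g_sq] i[OF w_sq] W by simp
    also have "\<dots> \<le> 2 * (LINT \<tau>|lborel. weight s t \<tau> * (norm (g \<tau>))\<^sup>2) + (2 * (LINT \<tau>|lborel. weight s t \<tau> * (norm (w \<tau>))\<^sup>2) + (t - s))"
      using avg by simp
    also have "\<dots> \<le> 2 * (action t - action s)"
    proof -
      have "action t - action s = (LINT \<tau>|lborel. weight s t \<tau> * ((norm (g \<tau>))\<^sup>2 + (norm (w \<tau>))\<^sup>2 + indicat_real {0<..<T} \<tau>))"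
        unfolding action_def by (rule weight_diff[OF action_integrable])
      also have "\<dots> = (LINT \<tau>|lborel. (weight s t \<tau> * (norm (g \<tau>))\<^sup>2 + weight s t \<tau> * (norm (w \<tau>))\<^sup>2) + weight s t \<tau>)"
        using sub st(3) by (intro Bochner_Integration.integral_cong) (auto simp: weight_eq indicator_def)
      also have "\<dots> = (LINT \<tau>|lborel. weight s t \<tau> * (norm (g \<tau>))\<^sup>2) + (LINT \<tau>|lborel. weight s t \<tau> * (norm (w \<tau>))\<^sup>2) + (t - s)"
        using i[OF g_sq] i[OF w_sq] W by simp
      finally show ?thesis using st(3) by simp
    qed
    finally show ?thesis .
  qed
  from this[OF st(2)] this[OF st(1)] st(3)
  show ?thesis
    using norm_diff_square_le[of "\<iota> (w t)" "\<iota> (w s)" "\<iota> (w r)"] by (simp add: norm_minus_commute)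
qed

text \<open>On the good times the increments are governed by the continuous function
  \<open>action\<close>, so the embedded \<open>w\<close> is uniformly continuous there and,
  \<open>H\<close> being complete, extends to the closure \<open>[0, T]\<close>. The energy identity
  extends by continuity and is then available at both ends.\<close>

theorem continuous_representative:
  obtains z where "continuous_on {0..T} z" "AE t in lborel. t \<in> {0<..<T} \<longrightarrow> z t = \<iota> (w t)"
    "(norm (z T))\<^sup>2 - (norm (z 0))\<^sup>2 = 2 * (LINT t|lborel. g t (w t))"
proof -
  obtain E C where E: "good_times E" and C: "\<And>t. t \<in> E \<Longrightarrow> energy_defect t = C"
    by (rule energy_identity) (rule that)
  have cl: "closure E = {0..T}"
    using E T_pos by (intro closure_full_measure) (auto simp: good_times_def)
  have "uniformly_continuous_on E (\<lambda>t. \<iota> (w t))"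
    unfolding uniformly_continuous_on_def
  proof (intro allI impI)
    fix e :: real assume e: "e > 0"
    have "uniformly_continuous_on {0..T} action"
      unfolding action_def
      by (intro compact_uniformly_continuous continuous_on_primitive action_integrable) simp
    moreover have "e\<^sup>2 / 8 > 0" using e by simp
    ultimately obtain d where d: "d > 0" "\<And>x y. x \<in> {0..T} \<Longrightarrow> y \<in> {0..T} \<Longrightarrow> dist y x < d \<Longrightarrow> dist (action y) (action x) < e\<^sup>2 / 8"
      unfolding uniformly_continuous_on_def by meson
    have main: "norm (\<iota> (w t) - \<iota> (w s)) < e" if st: "s \<in> E" "t \<in> E" "s < t" "t - s < d" for s t
    proof -
      have "s \<in> {0..T}" "t \<in> {0..T}" using st closure_subset[of E] cl by auto
      from d(2)[OF this] st have "\<bar>action t - action s\<bar> < e\<^sup>2 / 8" by (simp add: dist_real_def)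
      then have "action t - action s < e\<^sup>2 / 8" by (rule le_less_trans[OF abs_ge_self])
      then have "8 * (action t - action s) < 8 * (e\<^sup>2 / 8)" by (rule mult_strict_left_mono) simp
      moreover have "(norm (\<iota> (w t) - \<iota> (w s)))\<^sup>2 \<le> 8 * (action t - action s)"
        by (rule increment_bound[OF E _ st(1-3)]) (rule C)
      ultimately have "(norm (\<iota> (w t) - \<iota> (w s)))\<^sup>2 < e\<^sup>2"
        by (metis le_less_trans nonzero_mult_div_cancel_left times_divide_eq_right zero_neq_numeral)
      then show ?thesis using e by (simp add: power2_less_imp_less)
    qed
    have "dist (\<iota> (w y)) (\<iota> (w x)) < e" if "x \<in> E" "y \<in> E" "dist y x < d" for x y
      using main[of x y] main[of y x] that e
      by (cases x y rule: linorder_cases) (auto simp: dist_norm norm_minus_commute dist_real_def)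
    then show "\<exists>d>0. \<forall>x\<in>E. \<forall>x'\<in>E. dist x' x < d \<longrightarrow> dist (\<iota> (w x')) (\<iota> (w x)) < e"
      using d(1) by blast
  qed
  then obtain z where z: "uniformly_continuous_on (closure E) z" "\<And>t. t \<in> E \<Longrightarrow> \<iota> (w t) = z t"
    by (rule uniformly_continuous_on_extension_on_closure) blast
  have zc: "continuous_on {0..T} z" using z(1) cl by (simp add: uniformly_continuous_imp_continuous)
  let ?P = "\<lambda>t. LINT \<tau>|lborel. indicator {..<t} \<tau> * g \<tau> (w \<tau>)"
  have "(norm (z t))\<^sup>2 - 2 * ?P t = C" if "t \<in> {0..T}" for t
  proof (rule continuous_constant_on_closure[of E "\<lambda>t. (norm (z t))\<^sup>2 - 2 * ?P t" C t])
    show "continuous_on (closure E) (\<lambda>t. (norm (z t))\<^sup>2 - 2 * ?P t)"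
      unfolding cl
      by (intro continuous_on_diff continuous_on_power continuous_on_norm continuous_on_mult continuous_on_const
          zc continuous_on_primitive g_w_integrable)
  qed (use C z(2) cl that in \<open>auto simp: energy_defect_def\<close>)
  from this[of T] this[of 0] T_pos have "(norm (z T))\<^sup>2 - (norm (z 0))\<^sup>2 = 2 * ?P T - 2 * ?P 0" by simp
  \<comment> \<open>As \<open>w\<close> vanishes outside \<open>(0, T)\<close>, the primitive has
    its full value at \<open>T\<close> and is zero at \<open>0\<close>.\<close>
  moreover have "?P T = (LINT t|lborel. g t (w t))"
    by (rule Bochner_Integration.integral_cong[OF refl]) (use w_0 in \<open>force simp: indicator_def\<close>)
  moreover have "?P 0 = (LINT t|(lborel :: real measure). 0)"
    by (rule Bochner_Integration.integral_cong[OF refl]) (use w_0 in \<open>force simp: indicator_def\<close>)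
  moreover have "AE t in lborel. t \<in> {0<..<T} \<longrightarrow> z t = \<iota> (w t)"
    using E unfolding good_times_def by (auto simp: z(2) elim!: eventually_mono)
  ultimately show ?thesis using zc by (intro that[of z]) simp_all
qed

end

section \<open>The spaces and operators\<close>

text \<open>Completeness of the Lebesgue measure is essential: a change on a null set preserves
  measurability.\<close>

lemma time_measure_AE_measurable:
  fixes f g :: "real \<Rightarrow> real"
  assumes f: "f \<in> borel_measurable (time_measure T)" and eq: "AE t in time_measure T. f t = g t"
  shows "g \<in> borel_measurable (time_measure T)"
proof -
  have "(\<lambda>t. indicator {0<..<T} t *\<^sub>R f t) \<in> borel_measurable lebesgue"
    using f by (subst (asm) borel_measurable_restrict_space_iff) (simp_all add: mult.commute)
  moreover have "AE t in lebesgue. indicator {0<..<T} t *\<^sub>R f t = indicator {0<..<T} t *\<^sub>R g t"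
    using eq unfolding time_measure_AE_iff AE_completion_iff
    by eventually_elim (simp add: indicator_def)
  ultimately have "(\<lambda>t. indicator {0<..<T} t *\<^sub>R g t) \<in> borel_measurable lebesgue"
    by (rule borel_measurable_AE)
  then show ?thesis by (subst borel_measurable_restrict_space_iff) (simp_all add: mult.commute)
qed

lemma quadratic_nonneg_discriminant:
  fixes a b c :: real
  assumes "\<And>s. 0 \<le> a * s\<^sup>2 - 2 * b * s + c"
  shows "b\<^sup>2 \<le> a * c"
proof (cases "a = 0")
  case True
  have "b = 0"
  proof (rule ccontr)
    assume "b \<noteq> 0"
    \<comment> \<open>With \<open>a = 0\<close> this argument makes the expression equal to
      \<open>-1\<close>.\<close>
    then show False using assms[of "(c + 1) / (2 * b)"] True by simp
  qed
  then show ?thesis using True by simp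
next
  case False
  have "a > 0"
  proof (rule ccontr)
    assume "\<not> a > 0"
    then have a: "a < 0" using False by simp
    \<comment> \<open>Chosen such that
      \<open>- a * s = - a + 2 * \<bar>b\<bar> + \<bar>c\<bar>\<close>; since
      \<open>s \<ge> 1\<close>, the quadratic term then outweighs the other two and the value
      becomes negative.\<close>
    define s where "s = 1 + (2 * \<bar>b\<bar> + \<bar>c\<bar>) / (- a)"
    have s: "s \<ge> 1" using a by (simp add: s_def divide_nonneg_neg)
    have "- a * s = - a + 2 * \<bar>b\<bar> + \<bar>c\<bar>" using a by (simp add: s_def field_simps)
    then have "(- a * s) * s = (- a + 2 * \<bar>b\<bar> + \<bar>c\<bar>) * s" by (simp only:)
    moreover have "- b * s \<le> \<bar>b\<bar> * s" using s by (intro mult_right_mono) auto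
    moreover have "\<bar>c\<bar> * 1 \<le> \<bar>c\<bar> * s" using s by (intro mult_left_mono) auto
    moreover have "0 < - a * s" using a s by (simp add: mult_neg_pos)
    moreover have "c \<le> \<bar>c\<bar>" by simp
    ultimately have "a * s\<^sup>2 - 2 * b * s + c < 0" by (simp add: algebra_simps power2_eq_square)
    then show False using assms[of s] by simp
  qed
  then have "0 \<le> a * (a * (b / a)\<^sup>2 - 2 * b * (b / a) + c)"
    using assms[of "b / a"] by (intro mult_nonneg_nonneg) auto
  also have "\<dots> = a * c - b\<^sup>2" using \<open>a > 0\<close> by (simp add: field_simps power2_eq_square)
  finally show ?thesis by simp
qed

section \<open>Square-integrable functions, duality pairings and weak derivatives\<close>

lemma L2_strongly_measurable: "f \<in> L2_space T \<Longrightarrow> strongly_measurable (time_measure T) f"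
  by (simp add: L2_space_def)

lemma continuous_on_norm_id: "continuous_on S (norm :: 'b::real_normed_vector \<Rightarrow> real)"
  by (intro continuous_on_norm continuous_on_id)

lemma L2_norm_measurable:
  "f \<in> L2_space T \<Longrightarrow> (\<lambda>t. norm (f t)) \<in> borel_measurable (time_measure T)"
  by (rule strongly_measurable_imp_borel_measurable[OF
        strongly_measurable_compose[OF L2_strongly_measurable continuous_on_norm_id]])

lemma L2_norm_prod_integrable:
  assumes f: "f \<in> L2_space T" and g: "g \<in> L2_space T"
  shows "integrable (time_measure T) (\<lambda>t. norm (f t) * norm (g t))"
proof (rule Bochner_Integration.integrable_bound)
  show "integrable (time_measure T) (\<lambda>t. (norm (f t))\<^sup>2 + (norm (g t))\<^sup>2)"
    using f g by (intro Bochner_Integration.integrable_add) (auto simp: L2_space_def)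
  show "(\<lambda>t. norm (f t) * norm (g t)) \<in> borel_measurable (time_measure T)"
    using L2_norm_measurable[OF f] L2_norm_measurable[OF g] by (rule borel_measurable_times)
  have "norm (f t) * norm (g t) \<le> (norm (f t))\<^sup>2 + (norm (g t))\<^sup>2" for t
    using sum_squares_bound[of "norm (f t)" "norm (g t)"]
      mult_nonneg_nonneg[OF norm_ge_zero[of "f t"] norm_ge_zero[of "g t"]] by linarith
  then show "AE t in time_measure T. norm (norm (f t) * norm (g t)) \<le> norm ((norm (f t))\<^sup>2 + (norm (g t))\<^sup>2)"
    by (intro AE_I2) simp
qed

lemma L2_norm_nonneg: "0 \<le> L2_norm T f"
  by (simp add: L2_norm_def)

lemma L2_norm_square: "(L2_norm T f)\<^sup>2 = (LINT t|time_measure T. (norm (f t))\<^sup>2)"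
  by (simp add: L2_norm_def)

lemma L2_Cauchy_Schwarz:
  assumes f: "f \<in> L2_space T" and g: "g \<in> L2_space T"
  shows "(LINT t|time_measure T. norm (f t) * norm (g t)) \<le> L2_norm T f * L2_norm T g"
proof -
  have i: "integrable (time_measure T) (\<lambda>t. (norm (f t))\<^sup>2)" "integrable (time_measure T) (\<lambda>t. (norm (g t))\<^sup>2)"
    using f g by (auto simp: L2_space_def)
  have "0 \<le> (LINT t|time_measure T. (norm (f t))\<^sup>2) * s\<^sup>2 - 2 * (LINT t|time_measure T. norm (f t) * norm (g t)) * s
      + (LINT t|time_measure T. (norm (g t))\<^sup>2)" for s
  proof -
    have "0 \<le> (LINT t|time_measure T. (s * norm (f t) - norm (g t))\<^sup>2)" by simp
    also have "\<dots> = (LINT t|time_measure T. s\<^sup>2 * (norm (f t))\<^sup>2 - 2 * s * (norm (f t) * norm (g t)) + (norm (g t))\<^sup>2)"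
      by (intro Bochner_Integration.integral_cong) (auto simp: power2_diff power_mult_distrib)
    also have "\<dots> = s\<^sup>2 * (LINT t|time_measure T. (norm (f t))\<^sup>2) - 2 * s * (LINT t|time_measure T. norm (f t) * norm (g t))
      + (LINT t|time_measure T. (norm (g t))\<^sup>2)"
      using i L2_norm_prod_integrable[OF f g] by simp
    finally show ?thesis by (simp add: ac_simps)
  qed
  from quadratic_nonneg_discriminant[OF this]
  have "(LINT t|time_measure T. norm (f t) * norm (g t))\<^sup>2 \<le> (L2_norm T f * L2_norm T g)\<^sup>2"
    by (simp add: L2_norm_square power_mult_distrib)
  then show ?thesis by (rule power2_le_imp_le) (simp add: L2_norm_nonneg)
qed

lemma L2_lincomb:
  assumes f: "f \<in> L2_space T" and g: "g \<in> L2_space T"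
  shows "(\<lambda>t. a *\<^sub>R f t + b *\<^sub>R g t) \<in> L2_space T"
proof -
  have m: "strongly_measurable (time_measure T) (\<lambda>t. a *\<^sub>R f t + b *\<^sub>R g t)"
    by (rule strongly_measurable_compose2[OF f[THEN L2_strongly_measurable] g[THEN L2_strongly_measurable],
          where H="\<lambda>x y. a *\<^sub>R x + b *\<^sub>R y"])
      (intro continuous_on_add continuous_on_scaleR continuous_on_const continuous_on_fst continuous_on_snd continuous_on_id)
  have "(\<lambda>t. norm (a *\<^sub>R f t + b *\<^sub>R g t)) \<in> borel_measurable (time_measure T)"
    by (rule strongly_measurable_imp_borel_measurable[OF strongly_measurable_compose[OF m continuous_on_norm_id]])
  then have m2: "(\<lambda>t. (norm (a *\<^sub>R f t + b *\<^sub>R g t))\<^sup>2) \<in> borel_measurable (time_measure T)"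
    by (rule borel_measurable_power)
  have i: "integrable (time_measure T) (\<lambda>t. 2 * a\<^sup>2 * (norm (f t))\<^sup>2 + 2 * b\<^sup>2 * (norm (g t))\<^sup>2)"
    using f g by (intro Bochner_Integration.integrable_add integrable_mult_right) (auto simp: L2_space_def)
  have "(norm (a *\<^sub>R f t + b *\<^sub>R g t))\<^sup>2 \<le> 2 * a\<^sup>2 * (norm (f t))\<^sup>2 + 2 * b\<^sup>2 * (norm (g t))\<^sup>2" for t
    using norm_diff_square_le[of "a *\<^sub>R f t" "- (b *\<^sub>R g t)" 0] by (simp add: power_mult_distrib)
  then have "integrable (time_measure T) (\<lambda>t. (norm (a *\<^sub>R f t + b *\<^sub>R g t))\<^sup>2)"
    by (intro Bochner_Integration.integrable_bound[OF i m2] AE_I2) (auto intro: order_trans)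
  with m show ?thesis by (simp add: L2_space_def)
qed

lemma pairing_measurable:
  assumes f: "f \<in> L2_space T" and v: "v \<in> L2_space T"
  shows "(\<lambda>t. blinfun_apply (f t) (v t) :: real) \<in> borel_measurable (time_measure T)"
  by (rule strongly_measurable_imp_borel_measurable[OF strongly_measurable_compose2[OF
        f[THEN L2_strongly_measurable] v[THEN L2_strongly_measurable] continuous_on_blinfun_pair]])

lemma
  fixes f :: "real \<Rightarrow> 'v::real_normed_vector \<Rightarrow>\<^sub>L real"
  assumes f: "f \<in> L2_space T" and v: "v \<in> L2_space T"
  shows pairing_integrable: "integrable (time_measure T) (\<lambda>t. f t (v t))"
    and pairing_bound: "\<bar>LINT t|time_measure T. f t (v t)\<bar> \<le> L2_norm T f * L2_norm T v"
proof -
  show i: "integrable (time_measure T) (\<lambda>t. f t (v t))"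
    by (rule Bochner_Integration.integrable_bound[OF L2_norm_prod_integrable[OF f v] pairing_measurable[OF f v]])
      (simp add: norm_blinfun_real)
  have "\<bar>LINT t|time_measure T. f t (v t)\<bar> \<le> (LINT t|time_measure T. norm (f t) * norm (v t))"
    using Bochner_Integration.integral_norm_bound_integral[OF i L2_norm_prod_integrable[OF f v]]
    by (simp add: norm_blinfun_real)
  then show "\<bar>LINT t|time_measure T. f t (v t)\<bar> \<le> L2_norm T f * L2_norm T v"
    using L2_Cauchy_Schwarz[OF f v] by simp
qed

lemma test_function_continuous:
  assumes "test_function T \<phi>"
  shows "continuous_on S \<phi>" "continuous_on S (deriv \<phi>)"
proof -
  have "((deriv ^^ 0) \<phi>) differentiable (at t)" "((deriv ^^ 1) \<phi>) differentiable (at t)" for t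
    using assms unfolding test_function_def by blast+
  then have "\<phi> differentiable (at t)" "deriv \<phi> differentiable (at t)" for t by simp_all
  then show "continuous_on S \<phi>" "continuous_on S (deriv \<phi>)"
    by (meson continuous_at_imp_continuous_on differentiable_imp_continuous_within)+
qed

lemma bounded_mult_pairing_integrable:
  fixes f :: "real \<Rightarrow> 'v::real_normed_vector \<Rightarrow>\<^sub>L real"
  assumes f: "f \<in> L2_space T" and \<phi>: "continuous_on UNIV \<phi>"
  shows "integrable (time_measure T) (\<lambda>t. \<phi> t * f t v)"
proof -
  have fin: "integrable (time_measure T) (\<lambda>t. 1 :: real)"
  proof -
    have "integrable lborel (indicat_real {0<..<T})"
      by (cases "T > 0") (auto intro!: integrable_real_indicator)
    then show ?thesis
      by (subst time_measure_integrable[where f'="indicat_real {0<..<T}"]) (auto simp: indicator_def)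
  qed
  obtain K where K: "\<And>t. t \<in> {0..T} \<Longrightarrow> \<bar>\<phi> t\<bar> \<le> K"
  proof -
    have "bounded (\<phi> ` {0..T})"
      by (intro compact_imp_bounded compact_continuous_image continuous_on_subset[OF \<phi>]) auto
    then obtain K where "\<forall>y\<in>\<phi> ` {0..T}. norm y \<le> K" unfolding bounded_iff by blast
    then show ?thesis by (intro that[of K]) simp
  qed
  have m: "(\<lambda>t. f t v) \<in> borel_measurable (time_measure T)"
    by (rule strongly_measurable_imp_borel_measurable,
        rule strongly_measurable_compose[OF f[THEN L2_strongly_measurable], where H="\<lambda>x. blinfun_apply x v"])
      (intro bounded_linear.continuous_on[OF blinfun.bounded_linear_left] continuous_on_id)
  have \<phi>m: "\<phi> \<in> borel_measurable (time_measure T)"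
    using borel_measurable_continuous_onI[OF \<phi>] by (intro measurable_restrict_space1) (simp add: measurable_completion)
  have i: "integrable (time_measure T) (\<lambda>t. K * ((norm (f t))\<^sup>2 + (norm v)\<^sup>2 * 1))"
    using f fin by (intro integrable_mult_right Bochner_Integration.integrable_add) (auto simp: L2_space_def)
  show ?thesis
  proof (rule Bochner_Integration.integrable_bound[OF i])
    show "(\<lambda>t. \<phi> t * f t v) \<in> borel_measurable (time_measure T)" using \<phi>m m by (rule borel_measurable_times)
    show "AE t in time_measure T. norm (\<phi> t * f t v) \<le> norm (K * ((norm (f t))\<^sup>2 + (norm v)\<^sup>2 * 1))"
    proof (rule AE_I2)
      fix t assume "t \<in> space (time_measure T)"
      then have "\<bar>\<phi> t\<bar> \<le> K" by (intro K) auto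
      moreover have "\<bar>f t v\<bar> \<le> (norm (f t))\<^sup>2 + (norm v)\<^sup>2"
        using norm_blinfun_real[of "f t" v] sum_squares_bound[of "norm (f t)" "norm v"]
          mult_nonneg_nonneg[OF norm_ge_zero[of "f t"] norm_ge_zero[of v]] by linarith
      ultimately have "\<bar>\<phi> t\<bar> * \<bar>f t v\<bar> \<le> K * ((norm (f t))\<^sup>2 + (norm v)\<^sup>2)"
        by (intro mult_mono) auto
      also have "\<dots> \<le> \<bar>K\<bar> * ((norm (f t))\<^sup>2 + (norm v)\<^sup>2)" by (intro mult_right_mono) auto
      finally show "norm (\<phi> t * f t v) \<le> norm (K * ((norm (f t))\<^sup>2 + (norm v)\<^sup>2 * 1))"
        by (simp add: abs_mult)
    qed
  qed
qed

lemma has_weak_derivative_lincomb: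
  fixes f1 f2 :: "real \<Rightarrow> 'v::real_normed_vector \<Rightarrow>\<^sub>L real"
  assumes L2: "f1 \<in> L2_space T" "f2 \<in> L2_space T" "g1 \<in> L2_space T" "g2 \<in> L2_space T"
    and d: "has_weak_derivative T f1 g1" "has_weak_derivative T f2 g2"
  shows "has_weak_derivative T (\<lambda>t. a *\<^sub>R f1 t + b *\<^sub>R f2 t) (\<lambda>t. a *\<^sub>R g1 t + b *\<^sub>R g2 t)"
  unfolding has_weak_derivative_def
proof (intro allI impI)
  fix \<phi> v assume \<phi>: "test_function T \<phi>"
  have lin: "(LINT t|time_measure T. \<psi> t * (a *\<^sub>R f t + b *\<^sub>R g t) v)
      = a * (LINT t|time_measure T. \<psi> t * f t v) + b * (LINT t|time_measure T. \<psi> t * g t v)"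
    if "f \<in> L2_space T" "g \<in> L2_space T" "continuous_on UNIV \<psi>" for \<psi> and f g :: "real \<Rightarrow> 'v \<Rightarrow>\<^sub>L real"
  proof -
    have "(LINT t|time_measure T. \<psi> t * (a *\<^sub>R f t + b *\<^sub>R g t) v)
        = (LINT t|time_measure T. a * (\<psi> t * f t v) + b * (\<psi> t * g t v))"
      by (intro Bochner_Integration.integral_cong) (auto simp: blinfun.add_left blinfun.scaleR_left algebra_simps)
    then show ?thesis
      using bounded_mult_pairing_integrable[OF that(1,3), of v] bounded_mult_pairing_integrable[OF that(2,3), of v] by simp
  qed
  have e: "(LINT t|time_measure T. deriv \<phi> t * f1 t v) = - (LINT t|time_measure T. \<phi> t * g1 t v)"
    "(LINT t|time_measure T. deriv \<phi> t * f2 t v) = - (LINT t|time_measure T. \<phi> t * g2 t v)"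
    using d \<phi> by (auto simp: has_weak_derivative_def)
  show "(LINT t|time_measure T. deriv \<phi> t * (a *\<^sub>R f1 t + b *\<^sub>R f2 t) v)
      = - (LINT t|time_measure T. \<phi> t * (a *\<^sub>R g1 t + b *\<^sub>R g2 t) v)"
    by (simp only: lin[OF L2(1,2) test_function_continuous(2)[OF \<phi>]] lin[OF L2(3,4) test_function_continuous(1)[OF \<phi>]] e
        mult_minus_right minus_add_distrib)
qed

text \<open>This frees \<open>op_dt\<close> from the arbitrary choice in
  \<open>weak_derivative\<close>. For each fixed vector the two derivatives agree almost everywhere;
  a countable set whose closure contains almost every \<open>v t\<close> and continuity of
  functionals give agreement along \<open>v\<close>, which is all that the pairing sees.\<close>

lemma weak_derivative_unique:
  fixes f g1 g2 :: "real \<Rightarrow> 'v::real_normed_vector \<Rightarrow>\<^sub>L real"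
  assumes g: "g1 \<in> L2_space T" "g2 \<in> L2_space T"
    and d: "has_weak_derivative T f g1" "has_weak_derivative T f g2"
    and v: "v \<in> L2_space T"
  shows "(LINT t|time_measure T. g1 t (v t)) = (LINT t|time_measure T. g2 t (v t))"
proof -
  let ?I = "{0<..<T}"
  have pt: "AE t in time_measure T. g1 t x = g2 t x" for x
  proof -
    have ex: "\<exists>h. h \<in> borel_measurable borel \<and> integrable lborel h \<and> (\<forall>t. t \<notin> ?I \<longrightarrow> h t = 0) \<and>
        (AE t in lborel. t \<in> ?I \<longrightarrow> g t x = h t)"
      if g: "g \<in> L2_space T" for g :: "real \<Rightarrow> 'v \<Rightarrow>\<^sub>L real"
    proof -
      obtain g' where g': "simple_limit g'" "\<And>t. t \<notin> ?I \<Longrightarrow> g' t = 0" "AE t in lborel. t \<in> ?I \<longrightarrow> g t = g' t"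
        by (rule strongly_measurable_simple_limit[OF L2_strongly_measurable[OF g]]) (rule that)
      have m: "(\<lambda>t. g' t x) \<in> borel_measurable borel"
        by (rule simple_limit_apply_measurable[OF g'(1)])
      have ae: "AE t in lborel. t \<in> ?I \<longrightarrow> g t x = g' t x"
        using g'(3) by eventually_elim simp
      have 0: "g' t x = 0" if "t \<notin> ?I" for t using g'(2)[OF that] by simp
      have "integrable (time_measure T) (\<lambda>t. g t x)"
        using bounded_mult_pairing_integrable[OF g continuous_on_const, of 1 x] by simp
      then have "integrable lborel (\<lambda>t. g' t x)"
        using time_measure_integrable[OF m ae 0] by simp
      with m ae 0 show ?thesis by blast
    qed
    obtain h1 where h1: "h1 \<in> borel_measurable borel" "integrable lborel h1" "\<And>t. t \<notin> ?I \<Longrightarrow> h1 t = 0"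
        "AE t in lborel. t \<in> ?I \<longrightarrow> g1 t x = h1 t"
      using ex[OF g(1)] by blast
    obtain h2 where h2: "h2 \<in> borel_measurable borel" "integrable lborel h2" "\<And>t. t \<notin> ?I \<Longrightarrow> h2 t = 0"
        "AE t in lborel. t \<in> ?I \<longrightarrow> g2 t x = h2 t"
      using ex[OF g(2)] by blast
    have "AE t in lborel. t \<in> ?I \<longrightarrow> h1 t = h2 t"
    proof (rule weak_derivative_unique_scalar[OF h1(2) h2(2)])
      fix \<phi> assume \<phi>: "test_function T \<phi>"
      have [measurable]: "\<phi> \<in> borel_measurable borel"
        by (rule borel_measurable_continuous_onI[OF test_function_continuous(1)[OF \<phi>]])
      note [measurable] = h1(1) h2(1)
      have ae1: "AE t in lborel. t \<in> ?I \<longrightarrow> \<phi> t * g1 t x = \<phi> t * h1 t"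
        using h1(4) by eventually_elim simp
      have ae2: "AE t in lborel. t \<in> ?I \<longrightarrow> \<phi> t * g2 t x = \<phi> t * h2 t"
        using h2(4) by eventually_elim simp
      have "(LINT t|time_measure T. \<phi> t * g1 t x) = (LINT t|lborel. \<phi> t * h1 t)"
        by (rule time_measure_integral[OF _ ae1]) (simp_all add: h1(3))
      moreover have "(LINT t|time_measure T. \<phi> t * g2 t x) = (LINT t|lborel. \<phi> t * h2 t)"
        by (rule time_measure_integral[OF _ ae2]) (simp_all add: h2(3))
      moreover have "(LINT t|time_measure T. \<phi> t * g1 t x) = (LINT t|time_measure T. \<phi> t * g2 t x)"
        using d[unfolded has_weak_derivative_def, rule_format, OF \<phi>, of x] by simp
      ultimately show "(LINT t|lborel. \<phi> t * h1 t) = (LINT t|lborel. \<phi> t * h2 t)" by simp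
    qed
    with h1(4) h2(4) show ?thesis unfolding time_measure_AE_iff by eventually_elim simp
  qed
  obtain D where D: "countable D" "AE t in time_measure T. v t \<in> closure D"
    by (rule strongly_measurable_separable_range[OF L2_strongly_measurable[OF v]])
  have "AE t in time_measure T. \<forall>x\<in>D. g1 t x = g2 t x"
    by (subst AE_ball_countable[OF D(1)]) (use pt in blast)
  with D(2) have "AE t in time_measure T. g1 t (v t) = g2 t (v t)"
  proof eventually_elim
    case (elim t)
    have "closed {x. g1 t x = g2 t x}"
      by (intro closed_Collect_eq linear_continuous_on[OF blinfun.bounded_linear_right])
    then have "closure D \<subseteq> {x. g1 t x = g2 t x}"
      using elim(2) by (intro closure_minimal) auto
    then show ?case using elim(1) by auto
  qed
  then show ?thesis
    by (intro integral_cong_AE pairing_measurable g v)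
qed

section \<open>The space X, its time derivative and its traces\<close>

lemma dual_emb_apply [simp]: "dual_emb \<iota> h v = h \<bullet> \<iota> v"
  by (simp add: dual_emb_def)

lemma dual_emb_lincomb: "dual_emb \<iota> (\<iota> (a *\<^sub>R x + b *\<^sub>R y)) = a *\<^sub>R dual_emb \<iota> (\<iota> x) + b *\<^sub>R dual_emb \<iota> (\<iota> y)"
  by (rule blinfun_eqI)
    (simp add: blinfun.add_right blinfun.scaleR_right blinfun.add_left blinfun.scaleR_left inner_add_left)

abbreviation time_derivative ::
  "('v::{real_inner,banach} \<Rightarrow>\<^sub>L 'h::{real_inner,banach}) \<Rightarrow> real \<Rightarrow> (real \<Rightarrow> 'v) \<Rightarrow> real \<Rightarrow> 'v \<Rightarrow>\<^sub>L real" where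
  "time_derivative \<iota> T w \<equiv> weak_derivative T (\<lambda>t. dual_emb \<iota> (\<iota> (w t)))"

lemma X_space_D:
  assumes "w \<in> X_space \<iota> T"
  shows "w \<in> L2_space T" "w \<in> Y_space T" "(\<lambda>t. dual_emb \<iota> (\<iota> (w t))) \<in> L2_space T"
    "time_derivative \<iota> T w \<in> L2_space T"
    "has_weak_derivative T (\<lambda>t. dual_emb \<iota> (\<iota> (w t))) (time_derivative \<iota> T w)"
proof -
  show "w \<in> L2_space T" "w \<in> Y_space T" "(\<lambda>t. dual_emb \<iota> (\<iota> (w t))) \<in> L2_space T"
    using assms by (auto simp: X_space_def Y_space_def H1_space_def)
  have "\<exists>g. g \<in> L2_space T \<and> has_weak_derivative T (\<lambda>t. dual_emb \<iota> (\<iota> (w t))) g"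
    using assms by (auto simp: X_space_def H1_space_def)
  from someI_ex[OF this] show "time_derivative \<iota> T w \<in> L2_space T"
    "has_weak_derivative T (\<lambda>t. dual_emb \<iota> (\<iota> (w t))) (time_derivative \<iota> T w)"
    by (simp_all add: weak_derivative_def)
qed

lemma X_space_lincomb:
  assumes u: "u \<in> X_space \<iota> T" and w: "w \<in> X_space \<iota> T"
  shows "(\<lambda>t. a *\<^sub>R u t + b *\<^sub>R w t) \<in> X_space \<iota> T"
    and "has_weak_derivative T (\<lambda>t. dual_emb \<iota> (\<iota> (a *\<^sub>R u t + b *\<^sub>R w t)))
        (\<lambda>t. a *\<^sub>R time_derivative \<iota> T u t + b *\<^sub>R time_derivative \<iota> T w t)"
proof -
  note u = X_space_D[OF u] and w = X_space_D[OF w]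
  show d: "has_weak_derivative T (\<lambda>t. dual_emb \<iota> (\<iota> (a *\<^sub>R u t + b *\<^sub>R w t)))
        (\<lambda>t. a *\<^sub>R time_derivative \<iota> T u t + b *\<^sub>R time_derivative \<iota> T w t)"
    unfolding dual_emb_lincomb by (rule has_weak_derivative_lincomb) (use u w in auto)
  have "(\<lambda>t. dual_emb \<iota> (\<iota> (a *\<^sub>R u t + b *\<^sub>R w t))) \<in> L2_space T"
    unfolding dual_emb_lincomb by (rule L2_lincomb[OF u(3) w(3)])
  moreover have "(\<lambda>t. a *\<^sub>R time_derivative \<iota> T u t + b *\<^sub>R time_derivative \<iota> T w t) \<in> L2_space T"
    by (rule L2_lincomb[OF u(4) w(4)])
  ultimately show "(\<lambda>t. a *\<^sub>R u t + b *\<^sub>R w t) \<in> X_space \<iota> T"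
    using L2_lincomb[OF u(1) w(1), of a b] d by (auto simp: X_space_def Y_space_def H1_space_def)
qed

lemma op_dt_lincomb_right:
  assumes w: "w \<in> X_space \<iota> T" and v: "v \<in> Y_space T" "v' \<in> Y_space T"
  shows "op_dt \<iota> T w (\<lambda>t. a *\<^sub>R v t + b *\<^sub>R v' t) = a * op_dt \<iota> T w v + b * op_dt \<iota> T w v'"
  using pairing_integrable[OF X_space_D(4)[OF w]] v
  unfolding op_dt_def Y_space_def by (simp add: blinfun.add_right blinfun.scaleR_right)

lemma op_dt_lincomb_left:
  assumes u: "u \<in> X_space \<iota> T" and w: "w \<in> X_space \<iota> T" and v: "v \<in> Y_space T"
  shows "op_dt \<iota> T (\<lambda>t. a *\<^sub>R u t + b *\<^sub>R w t) v = a * op_dt \<iota> T u v + b * op_dt \<iota> T w v"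
proof -
  note c = X_space_lincomb[OF u w, of a b]
  have v': "v \<in> L2_space T" using v by (simp add: Y_space_def)
  have "op_dt \<iota> T (\<lambda>t. a *\<^sub>R u t + b *\<^sub>R w t) v
      = (LINT t|time_measure T. (a *\<^sub>R time_derivative \<iota> T u t + b *\<^sub>R time_derivative \<iota> T w t) (v t))"
    unfolding op_dt_def
    by (rule weak_derivative_unique[OF X_space_D(4)[OF c(1)] L2_lincomb[OF X_space_D(4)[OF u] X_space_D(4)[OF w]]
        X_space_D(5)[OF c(1)] c(2) v'])
  also have "\<dots> = a * op_dt \<iota> T u v + b * op_dt \<iota> T w v"
    using pairing_integrable[OF X_space_D(4)[OF u] v'] pairing_integrable[OF X_space_D(4)[OF w] v']
    by (simp add: op_dt_def blinfun.add_left blinfun.scaleR_left)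
  finally show ?thesis .
qed

lemma op_dt_bound:
  assumes "w \<in> X_space \<iota> T" "v \<in> Y_space T"
  shows "\<bar>op_dt \<iota> T w v\<bar> \<le> L2_norm T (time_derivative \<iota> T w) * L2_norm T v"
  using pairing_bound[OF X_space_D(4)[OF assms(1)], of v] assms(2) by (simp add: op_dt_def Y_space_def)

lemma X_space_continuous_representative:
  fixes \<iota> :: "'v::{real_inner,banach} \<Rightarrow>\<^sub>L 'h::{real_inner,banach}"
  assumes T: "T > 0" and w: "w \<in> X_space \<iota> T"
  obtains z where "continuous_on {0..T} z" "AE s in time_measure T. z s = \<iota> (w s)"
    "(norm (z T))\<^sup>2 - (norm (z 0))\<^sup>2 = 2 * op_dt \<iota> T w w"
proof -
  let ?I = "{0<..<T}"
  define g where "g = time_derivative \<iota> T w"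
  note wX = X_space_D[OF w, folded g_def]
  obtain w' where w': "simple_limit w'" "\<And>t. t \<notin> ?I \<Longrightarrow> w' t = 0" "AE t in lborel. t \<in> ?I \<longrightarrow> w t = w' t"
    by (rule strongly_measurable_simple_limit[OF L2_strongly_measurable[OF wX(1)]]) (rule that)
  obtain g' where g': "simple_limit g'" "\<And>t. t \<notin> ?I \<Longrightarrow> g' t = 0" "AE t in lborel. t \<in> ?I \<longrightarrow> g t = g' t"
    by (rule strongly_measurable_simple_limit[OF L2_strongly_measurable[OF wX(4)]]) (rule that)
  have sq: "integrable lborel (\<lambda>t. (norm (f' t))\<^sup>2)"
    if "f \<in> L2_space T" "simple_limit f'" "\<And>t. t \<notin> ?I \<Longrightarrow> f' t = 0" "AE t in lborel. t \<in> ?I \<longrightarrow> f t = f' t"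
    for f f' :: "real \<Rightarrow> 'b::real_normed_vector"
  proof -
    have m: "(\<lambda>t. (norm (f' t))\<^sup>2) \<in> borel_measurable borel"
      by (intro borel_measurable_power simple_limit_norm_measurable[OF that(2)] measurable_ident_sets) simp
    have ae: "AE t in lborel. t \<in> ?I \<longrightarrow> (norm (f t))\<^sup>2 = (norm (f' t))\<^sup>2"
      using that(4) by eventually_elim simp
    have "integrable (time_measure T) (\<lambda>t. (norm (f t))\<^sup>2)" using that(1) by (simp add: L2_space_def)
    then show ?thesis using time_measure_integrable[OF m ae] that(3) by simp
  qed
  interpret weak_evolution \<iota> T w' g'
  proof
    show "0 < T" by (rule T)
    show "simple_limit w'" "simple_limit g'" by (rule w' g')+
    show "integrable lborel (\<lambda>t. (norm (w' t))\<^sup>2)" by (rule sq[OF wX(1) w'])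
    show "integrable lborel (\<lambda>t. (norm (g' t))\<^sup>2)" by (rule sq[OF wX(4) g'])
    fix t assume t: "t \<notin> ?I"
    show "w' t = 0" "g' t = 0" using w'(2)[OF t] g'(2)[OF t] by auto
  next
    fix \<phi> v assume \<phi>: "test_function T \<phi>"
    have [measurable]: "\<phi> \<in> borel_measurable borel" "deriv \<phi> \<in> borel_measurable borel"
      by (rule borel_measurable_continuous_onI[OF test_function_continuous(1)[OF \<phi>]],
          rule borel_measurable_continuous_onI[OF test_function_continuous(2)[OF \<phi>]])
    note [measurable] = simple_limit_inner_measurable[OF w'(1), of \<iota>] simple_limit_apply_measurable[OF g'(1)]
    have ae1: "AE t in lborel. t \<in> ?I \<longrightarrow> deriv \<phi> t * dual_emb \<iota> (\<iota> (w t)) v = deriv \<phi> t * (\<iota> (w' t) \<bullet> \<iota> v)"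
      using w'(3) by eventually_elim simp
    have ae2: "AE t in lborel. t \<in> ?I \<longrightarrow> \<phi> t * g t v = \<phi> t * g' t v"
      using g'(3) by eventually_elim simp
    have "(LINT t|time_measure T. deriv \<phi> t * dual_emb \<iota> (\<iota> (w t)) v) = (LINT t|lborel. deriv \<phi> t * (\<iota> (w' t) \<bullet> \<iota> v))"
      by (rule time_measure_integral[OF _ ae1]) (measurable, simp add: w'(2))
    moreover have "(LINT t|time_measure T. \<phi> t * g t v) = (LINT t|lborel. \<phi> t * g' t v)"
      by (rule time_measure_integral[OF _ ae2]) (measurable, simp add: g'(2))
    ultimately show "(LINT t|lborel. deriv \<phi> t * (\<iota> (w' t) \<bullet> \<iota> v)) = - (LINT t|lborel. \<phi> t * g' t v)"
      using wX(5)[unfolded has_weak_derivative_def, rule_format, OF \<phi>, of v] by simp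
  qed
  obtain z where z: "continuous_on {0..T} z" "AE t in lborel. t \<in> ?I \<longrightarrow> z t = \<iota> (w' t)"
    "(norm (z T))\<^sup>2 - (norm (z 0))\<^sup>2 = 2 * (LINT t|lborel. g' t (w' t))"
    by (rule continuous_representative) (rule that)
  have "AE s in time_measure T. z s = \<iota> (w s)"
    unfolding time_measure_AE_iff using z(2) w'(3) by eventually_elim simp
  moreover have "op_dt \<iota> T w w = (LINT t|lborel. g' t (w' t))"
    unfolding op_dt_def g_def[symmetric]
  proof (rule time_measure_integral[OF g_w_measurable])
    show "AE t in lborel. t \<in> ?I \<longrightarrow> g t (w t) = g' t (w' t)"
      using g'(3) w'(3) by eventually_elim simp
  qed (simp add: w_0)
  ultimately show ?thesis using z by (intro that[of z]) simp_all
qed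

text \<open>Two continuous representatives agree on a set of full measure, which is dense, hence on
  all of \<open>[0, T]\<close>; so the definite description in \<open>trace_at\<close> is well
  defined.\<close>

lemma trace_at_eq:
  fixes \<iota> :: "'v::{real_inner,banach} \<Rightarrow>\<^sub>L 'h::{real_inner,banach}"
  assumes T: "T > 0" and z: "continuous_on {0..T} z" "AE s in time_measure T. z s = \<iota> (w s)" and t: "t \<in> {0..T}"
  shows "trace_at \<iota> T t w = z t"
  unfolding trace_at_def
proof (rule the_equality)
  show "\<exists>z'. continuous_on {0..T} z' \<and> (AE s in time_measure T. z' s = \<iota> (w s)) \<and> z t = z' t"
    using z by blast
next
  fix h assume "\<exists>z'. continuous_on {0..T} z' \<and> (AE s in time_measure T. z' s = \<iota> (w s)) \<and> h = z' t"
  then obtain z' where z': "continuous_on {0..T} z'" "AE s in time_measure T. z' s = \<iota> (w s)" "h = z' t" by blast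
  let ?E = "{s \<in> {0<..<T}. z' s - z s = 0}"
  have "AE s in lborel. s \<in> {0<..<T} \<longrightarrow> s \<in> ?E"
    using z(2) z'(2) unfolding time_measure_AE_iff by eventually_elim simp
  then have cl: "closure ?E = {0..T}" by (intro closure_full_measure[OF T]) auto
  have "z' t - z t = 0"
  proof (rule continuous_constant_on_closure[of ?E "\<lambda>s. z' s - z s" 0 t])
    show "continuous_on (closure ?E) (\<lambda>s. z' s - z s)"
      unfolding cl by (rule continuous_on_diff[OF z'(1) z(1)])
    show "t \<in> closure ?E" unfolding cl by (rule t)
  qed simp
  then show "h = z t" using z'(3) by simp
qed

lemma trace_at_lincomb:
  assumes T: "T > 0" and u: "u \<in> X_space \<iota> T" and w: "w \<in> X_space \<iota> T" and t: "t \<in> {0..T}"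
  shows "trace_at \<iota> T t (\<lambda>s. a *\<^sub>R u s + b *\<^sub>R w s) = a *\<^sub>R trace_at \<iota> T t u + b *\<^sub>R trace_at \<iota> T t w"
proof -
  obtain z where z: "continuous_on {0..T} z" "AE s in time_measure T. z s = \<iota> (u s)"
    by (rule X_space_continuous_representative[OF T u]) (rule that)
  obtain y where y: "continuous_on {0..T} y" "AE s in time_measure T. y s = \<iota> (w s)"
    by (rule X_space_continuous_representative[OF T w]) (rule that)
  have "trace_at \<iota> T t (\<lambda>s. a *\<^sub>R u s + b *\<^sub>R w s) = a *\<^sub>R z t + b *\<^sub>R y t"
  proof (rule trace_at_eq[OF T _ _ t])
    show "continuous_on {0..T} (\<lambda>t. a *\<^sub>R z t + b *\<^sub>R y t)"
      using z y by (intro continuous_on_add continuous_on_scaleR continuous_on_const)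
    show "AE s in time_measure T. a *\<^sub>R z s + b *\<^sub>R y s = \<iota> (a *\<^sub>R u s + b *\<^sub>R w s)"
      using z(2) y(2) by eventually_elim (simp add: blinfun.add_right blinfun.scaleR_right)
  qed
  then show ?thesis using trace_at_eq[OF T z t] trace_at_eq[OF T y t] by simp
qed

lemma trace_energy:
  assumes T: "T > 0" and w: "w \<in> X_space \<iota> T"
  shows "2 * op_dt \<iota> T w w = (norm (trace_at \<iota> T T w))\<^sup>2 - (norm (trace_at \<iota> T 0 w))\<^sup>2"
proof -
  obtain z where z: "continuous_on {0..T} z" "AE s in time_measure T. z s = \<iota> (w s)"
    "(norm (z T))\<^sup>2 - (norm (z 0))\<^sup>2 = 2 * op_dt \<iota> T w w"
    by (rule X_space_continuous_representative[OF T w]) (rule that)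
  then show ?thesis
    using trace_at_eq[OF T z(1,2), of T] trace_at_eq[OF T z(1,2), of 0] T by simp
qed

section \<open>Bilinear forms and dual norms of a parabolic operator\<close>

text \<open>Measurability of \<open>A\<close> is known only for fixed arguments. A pair of simple
  functions takes finitely many values, so the claim holds for simple arguments, and continuity of
  each \<open>A t\<close> carries it to the pointwise limit.\<close>

lemma op_A_measurable:
  fixes A :: "real \<Rightarrow> 'v::{real_inner,banach} \<Rightarrow>\<^sub>L 'v \<Rightarrow>\<^sub>L real"
  assumes A: "\<And>x y. (\<lambda>t. A t x y) \<in> borel_measurable (time_measure T)"
    and w: "w \<in> L2_space T" and v: "v \<in> L2_space T"
  shows "(\<lambda>t. A t (w t) (v t)) \<in> borel_measurable (time_measure T)"
proof -
  have ex: "\<exists>f' s. (\<forall>n. simple_function lborel (s n)) \<and> (\<forall>t. (\<lambda>n::nat. s n t) \<longlonglongrightarrow> f' t) \<and>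
      (AE t in time_measure T. f t = f' t)" if f: "f \<in> L2_space T" for f :: "real \<Rightarrow> 'v"
  proof -
    obtain f' where f': "simple_limit f'" "\<And>t. t \<notin> {0<..<T} \<Longrightarrow> f' t = 0" "AE t in lborel. t \<in> {0<..<T} \<longrightarrow> f t = f' t"
      by (rule strongly_measurable_simple_limit[OF L2_strongly_measurable[OF f]]) (rule that)
    from f'(1) obtain s where "\<forall>n. simple_function lborel (s n)" "\<forall>t. (\<lambda>n::nat. s n t) \<longlonglongrightarrow> f' t"
      unfolding simple_limit_def by blast
    with f'(3) show ?thesis unfolding time_measure_AE_iff by blast
  qed
  obtain w' r where r: "\<And>n. simple_function lborel (r n)" "\<And>t. (\<lambda>n::nat. r n t) \<longlonglongrightarrow> w' t"
    and ww: "AE t in time_measure T. w t = w' t" using ex[OF w] by blast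
  obtain v' s where s: "\<And>n. simple_function lborel (s n)" "\<And>t. (\<lambda>n::nat. s n t) \<longlonglongrightarrow> v' t"
    and vv: "AE t in time_measure T. v t = v' t" using ex[OF v] by blast
  have "(\<lambda>t. A t (w' t) (v' t)) \<in> borel_measurable (time_measure T)"
  proof (rule borel_measurable_LIMSEQ_real)
    show "(\<lambda>n. A t (r n t) (s n t)) \<longlonglongrightarrow> A t (w' t) (v' t)" for t
      by (intro blinfun.tendsto tendsto_const r(2) s(2))
    show "(\<lambda>t. A t (r n t) (s n t)) \<in> borel_measurable (time_measure T)" for n
    proof -
      have sf: "simple_function lborel (\<lambda>t. (r n t, s n t))"
        using simple_function_compose2[OF r(1) s(1), of Pair] .
      have "(\<lambda>t. (r n t, s n t)) \<in> measurable lborel (count_space ((\<lambda>t. (r n t, s n t)) ` UNIV))"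
        using measurable_simple_function[OF sf] by (simp add: measurable_count_space_eq2_countable
            countable_finite[OF simple_functionD(1)[OF sf, simplified]] measurable_def)
      then have "(\<lambda>t. (r n t, s n t)) \<in> measurable (time_measure T) (count_space ((\<lambda>t. (r n t, s n t)) ` UNIV))"
        by (intro measurable_restrict_space1 measurable_completion)
      from measurable_compose_countable'[OF _ this, of "\<lambda>p t. A t (fst p) (snd p)" borel]
      show ?thesis using A countable_finite[OF simple_functionD(1)[OF sf, simplified]] by simp
    qed
  qed
  moreover have "AE t in time_measure T. A t (w' t) (v' t) = A t (w t) (v t)"
    using ww vv by eventually_elim simp
  ultimately show ?thesis by (rule time_measure_AE_measurable)
qed

text \<open>The assumption \<open>nontrivial\<close> keeps the index sets of the suprema in the dual
  norm and in the asymmetry nonempty.\<close>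

locale parabolic =
  fixes \<iota> :: "'v::{real_inner,banach} \<Rightarrow>\<^sub>L 'h::{real_inner,banach}" and T :: real
    and A :: "real \<Rightarrow> 'v \<Rightarrow>\<^sub>L 'v \<Rightarrow>\<^sub>L real"
  assumes T_pos: "T > 0" and admissible: "admissible_operator T A"
    and nontrivial: "\<exists>v\<in>Y_space T. nonzero T (v :: real \<Rightarrow> 'v)"
begin

abbreviation Y :: "(real \<Rightarrow> 'v) set" where "Y \<equiv> Y_space T"
abbreviation X :: "(real \<Rightarrow> 'v) set" where "X \<equiv> X_space \<iota> T"
abbreviation a :: "(real \<Rightarrow> 'v) \<Rightarrow> (real \<Rightarrow> 'v) \<Rightarrow> real" where "a \<equiv> op_A T A"
abbreviation a_s :: "(real \<Rightarrow> 'v) \<Rightarrow> (real \<Rightarrow> 'v) \<Rightarrow> real" where "a_s \<equiv> op_As T A"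
abbreviation a_a :: "(real \<Rightarrow> 'v) \<Rightarrow> (real \<Rightarrow> 'v) \<Rightarrow> real" where "a_a \<equiv> op_Aa T A"
abbreviation dt :: "(real \<Rightarrow> 'v) \<Rightarrow> (real \<Rightarrow> 'v) \<Rightarrow> real" where "dt \<equiv> op_dt \<iota> T"
abbreviation \<gamma> :: "real \<Rightarrow> (real \<Rightarrow> 'v) \<Rightarrow> 'h" where "\<gamma> \<equiv> trace_at \<iota> T"
abbreviation nY :: "(real \<Rightarrow> 'v) \<Rightarrow> real" where "nY \<equiv> Y_norm T A"
abbreviation \<alpha> :: real where "\<alpha> \<equiv> asymmetry T A"

lemma Y_lincomb: "v \<in> Y \<Longrightarrow> w \<in> Y \<Longrightarrow> (\<lambda>t. r *\<^sub>R v t + s *\<^sub>R w t) \<in> Y"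
  unfolding Y_space_def by (rule L2_lincomb)

lemma X_subset_Y: "w \<in> X \<Longrightarrow> w \<in> Y" by (rule X_space_D(2))

lemma op_A_bounded: obtains C where "C \<ge> 0"
  "\<And>w v. w \<in> Y \<Longrightarrow> v \<in> Y \<Longrightarrow> integrable (time_measure T) (\<lambda>t. A t (w t) (v t))"
  "\<And>w v. w \<in> Y \<Longrightarrow> v \<in> Y \<Longrightarrow> \<bar>a w v\<bar> \<le> C * (L2_norm T w * L2_norm T v)"
proof -
  obtain C' where C': "AE t in time_measure T. norm (A t) \<le> C'"
    using admissible by (auto simp: admissible_operator_def)
  define C where "C = max C' 0"
  have CC: "AE t in time_measure T. \<bar>A t (w t) (v t)\<bar> \<le> C * (norm (w t) * norm (v t))" for w v
    using C'
  proof eventually_elim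
    case (elim t)
    have "\<bar>A t (w t) (v t)\<bar> \<le> norm (A t (w t)) * norm (v t)" by (rule norm_blinfun_real)
    also have "\<dots> \<le> (norm (A t) * norm (w t)) * norm (v t)" by (intro mult_right_mono norm_blinfun) auto
    also have "\<dots> \<le> (C * norm (w t)) * norm (v t)" using elim by (intro mult_right_mono) (auto simp: C_def)
    finally show ?case by (simp add: mult.assoc)
  qed
  have i: "integrable (time_measure T) (\<lambda>t. A t (w t) (v t))" and b: "\<bar>a w v\<bar> \<le> C * (L2_norm T w * L2_norm T v)"
    if wv: "w \<in> Y" "v \<in> Y" for w v
  proof -
    have L2: "w \<in> L2_space T" "v \<in> L2_space T" using wv by (auto simp: Y_space_def)
    have ip: "integrable (time_measure T) (\<lambda>t. C * (norm (w t) * norm (v t)))"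
      by (rule integrable_mult_right[OF L2_norm_prod_integrable[OF L2]])
    have m: "(\<lambda>t. A t (w t) (v t)) \<in> borel_measurable (time_measure T)"
      by (rule op_A_measurable[OF _ L2]) (use admissible in \<open>simp add: admissible_operator_def\<close>)
    show i: "integrable (time_measure T) (\<lambda>t. A t (w t) (v t))"
    proof (rule Bochner_Integration.integrable_bound[OF ip m])
      show "AE t in time_measure T. norm (A t (w t) (v t)) \<le> norm (C * (norm (w t) * norm (v t)))"
        using CC[of w v] by eventually_elim (simp add: C_def)
    qed
    have "\<bar>a w v\<bar> \<le> (LINT t|time_measure T. \<bar>A t (w t) (v t)\<bar>)"
      unfolding op_A_def by (rule integral_abs_bound)
    also have "\<dots> \<le> (LINT t|time_measure T. C * (norm (w t) * norm (v t)))"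
      by (rule integral_mono_AE[OF integrable_abs[OF i] ip CC])
    also have "\<dots> \<le> C * (L2_norm T w * L2_norm T v)"
      using L2_Cauchy_Schwarz[OF L2] by (simp add: C_def mult_left_mono)
    finally show "\<bar>a w v\<bar> \<le> C * (L2_norm T w * L2_norm T v)" .
  qed
  have "C \<ge> 0" by (simp add: C_def)
  from this i b show ?thesis by (rule that)
qed

lemma op_A_integrable: "w \<in> Y \<Longrightarrow> v \<in> Y \<Longrightarrow> integrable (time_measure T) (\<lambda>t. A t (w t) (v t))"
  by (rule op_A_bounded) blast

lemma op_A_lincomb_left:
  "u \<in> Y \<Longrightarrow> w \<in> Y \<Longrightarrow> v \<in> Y \<Longrightarrow> a (\<lambda>t. r *\<^sub>R u t + s *\<^sub>R w t) v = r * a u v + s * a w v"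
  using op_A_integrable[of u v] op_A_integrable[of w v]
  by (simp add: op_A_def blinfun.add_right blinfun.scaleR_right blinfun.add_left blinfun.scaleR_left)

lemma op_A_lincomb_right:
  "u \<in> Y \<Longrightarrow> w \<in> Y \<Longrightarrow> v \<in> Y \<Longrightarrow> a v (\<lambda>t. r *\<^sub>R u t + s *\<^sub>R w t) = r * a v u + s * a v w"
  using op_A_integrable[of v u] op_A_integrable[of v w]
  by (simp add: op_A_def blinfun.add_right blinfun.scaleR_right)

lemma op_As_commute: "a_s v w = a_s w v"
  by (simp add: op_As_def adjoint_op_def)

lemma op_As_lincomb_left:
  "u \<in> Y \<Longrightarrow> w \<in> Y \<Longrightarrow> v \<in> Y \<Longrightarrow> a_s (\<lambda>t. r *\<^sub>R u t + s *\<^sub>R w t) v = r * a_s u v + s * a_s w v"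
  by (simp add: op_As_def adjoint_op_def op_A_lincomb_left op_A_lincomb_right algebra_simps add_divide_distrib)

lemma op_As_lincomb_right:
  "u \<in> Y \<Longrightarrow> w \<in> Y \<Longrightarrow> v \<in> Y \<Longrightarrow> a_s v (\<lambda>t. r *\<^sub>R u t + s *\<^sub>R w t) = r * a_s v u + s * a_s v w"
  using op_As_lincomb_left[of u w v r s] by (simp add: op_As_commute)

lemma op_As_self: "a_s v v = a v v"
  by (simp add: op_As_def adjoint_op_def)

lemma op_As_lincomb_self:
  "u \<in> Y \<Longrightarrow> w \<in> Y \<Longrightarrow> a_s (\<lambda>t. r *\<^sub>R u t + s *\<^sub>R w t) (\<lambda>t. r *\<^sub>R u t + s *\<^sub>R w t)
    = r\<^sup>2 * a_s u u + 2 * r * s * a_s u w + s\<^sup>2 * a_s w w"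
  using op_As_commute[of w u]
  by (simp add: op_As_lincomb_left op_As_lincomb_right Y_lincomb power2_eq_square algebra_simps)

lemma op_Aa_skew: "a_a v w = - a_a w v"
  unfolding op_Aa_def adjoint_op_def by (simp only: mult_minus_right[symmetric] minus_diff_eq)

lemma op_Aa_self: "a_a v v = 0"
  by (simp add: op_Aa_def adjoint_op_def)

lemma op_Aa_lincomb_right:
  "u \<in> Y \<Longrightarrow> w \<in> Y \<Longrightarrow> v \<in> Y \<Longrightarrow> a_a v (\<lambda>t. r *\<^sub>R u t + s *\<^sub>R w t) = r * a_a v u + s * a_a v w"
  by (simp add: op_Aa_def adjoint_op_def op_A_lincomb_left op_A_lincomb_right algebra_simps diff_divide_distrib)

lemma op_A_split: "a w v = a_s w v + a_a w v"
  by (simp add: op_As_def op_Aa_def adjoint_op_def field_simps)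

lemma op_A_coercive:
  obtains c where "c > 0" "\<And>v. v \<in> Y \<Longrightarrow> c * (L2_norm T v)\<^sup>2 \<le> a_s v v"
proof -
  obtain c where c: "c > 0" "AE t in time_measure T. \<forall>v. A t v v \<ge> c * (norm v)\<^sup>2"
    using admissible by (auto simp: admissible_operator_def)
  have "c * (L2_norm T v)\<^sup>2 \<le> a_s v v" if v: "v \<in> Y" for v
  proof -
    have "c * (L2_norm T v)\<^sup>2 = (LINT t|time_measure T. c * (norm (v t))\<^sup>2)"
      by (simp add: L2_norm_square)
    also have "\<dots> \<le> (LINT t|time_measure T. A t (v t) (v t))"
    proof (rule integral_mono_AE)
      show "integrable (time_measure T) (\<lambda>t. c * (norm (v t))\<^sup>2)"
        using v by (intro integrable_mult_right) (simp add: Y_space_def L2_space_def)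
      show "AE t in time_measure T. c * (norm (v t))\<^sup>2 \<le> A t (v t) (v t)"
        using c(2) by eventually_elim blast
    qed (rule op_A_integrable[OF v v])
    finally show ?thesis by (simp add: op_As_self op_A_def)
  qed
  with c(1) show ?thesis by (rule that)
qed

lemma op_As_nonneg: "v \<in> Y \<Longrightarrow> 0 \<le> a_s v v"
  by (rule op_A_coercive) (meson order_trans mult_nonneg_nonneg less_imp_le zero_le_power2)

lemma Y_norm_square: "v \<in> Y \<Longrightarrow> (nY v)\<^sup>2 = a_s v v"
  by (simp add: Y_norm_def op_As_nonneg)

lemma Y_norm_nonneg: "v \<in> Y \<Longrightarrow> 0 \<le> nY v"
  by (simp add: Y_norm_def op_As_nonneg)

lemma L2_norm_le_Y_norm: obtains K where "K \<ge> 0" "\<And>v. v \<in> Y \<Longrightarrow> L2_norm T v \<le> K * nY v"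
proof -
  obtain c where c: "c > 0" "\<And>v. v \<in> Y \<Longrightarrow> c * (L2_norm T v)\<^sup>2 \<le> a_s v v" by (rule op_A_coercive) blast
  have "L2_norm T v \<le> sqrt (1 / c) * nY v" if v: "v \<in> Y" for v
  proof (rule power2_le_imp_le)
    show "(L2_norm T v)\<^sup>2 \<le> (sqrt (1 / c) * nY v)\<^sup>2"
      using c(2)[OF v] c(1) by (simp add: power_mult_distrib Y_norm_square[OF v] field_simps)
    show "0 \<le> sqrt (1 / c) * nY v" using c(1) Y_norm_nonneg[OF v] by simp
  qed
  moreover have "sqrt (1 / c) \<ge> 0" using c(1) by simp
  ultimately show ?thesis by (rule that[rotated])
qed

lemma nonzero_Y_norm_pos:
  assumes v: "v \<in> Y" and nz: "nonzero T v"
  shows "0 < nY v"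
proof (rule ccontr)
  assume "\<not> 0 < nY v"
  then have 0: "nY v = 0" using Y_norm_nonneg[OF v] by simp
  obtain K where "L2_norm T v \<le> K * nY v" using L2_norm_le_Y_norm v by metis
  then have "(LINT t|time_measure T. (norm (v t))\<^sup>2) = 0"
    using 0 L2_norm_nonneg[of T v] by (simp add: L2_norm_square[symmetric])
  moreover have "integrable (time_measure T) (\<lambda>t. (norm (v t))\<^sup>2)"
    using v by (simp add: Y_space_def L2_space_def)
  ultimately have "AE t in time_measure T. (norm (v t))\<^sup>2 = 0"
    by (subst (asm) integral_nonneg_eq_0_iff_AE) auto
  then show False using nz unfolding nonzero_def by auto
qed

lemma Y_norm_null:
  assumes v: "v \<in> Y" and nz: "\<not> nonzero T v"
  shows "nY v = 0"
proof -
  have ae: "AE t in time_measure T. v t = 0" using nz by (simp add: nonzero_def)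
  have "a v v = 0"
    unfolding op_A_def by (rule integral_eq_zero_AE) (use ae in \<open>eventually_elim, simp\<close>)
  then show ?thesis by (simp add: Y_norm_def op_As_self)
qed

lemma Y_dual_norm_bdd:
  assumes K: "\<And>v. v \<in> Y \<Longrightarrow> f v \<le> K * nY v"
  shows "bdd_above ((\<lambda>v. f v / nY v) ` {v \<in> Y. nonzero T v})"
  by (rule bdd_aboveI[of _ K]) (use K nonzero_Y_norm_pos in \<open>auto simp: divide_le_eq\<close>)

text \<open>The bound \<open>K\<close> makes the real-valued supremum meaningful. For
  representatives of zero, which the supremum omits, it also gives
  \<open>f v \<le> 0\<close>.\<close>

lemma Y_dual_norm_upper:
  assumes K: "\<And>v. v \<in> Y \<Longrightarrow> f v \<le> K * nY v" and v: "v \<in> Y"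
  shows "f v \<le> Y_dual_norm T A f * nY v"
proof (cases "nonzero T v")
  case True
  have "f v / nY v \<le> Y_dual_norm T A f"
    unfolding Y_dual_norm_def by (rule cSUP_upper[OF _ Y_dual_norm_bdd[OF K]]) (use v True in auto)
  then show ?thesis using nonzero_Y_norm_pos[OF v True] by (simp add: divide_le_eq)
next
  case False
  then show ?thesis using K[OF v] Y_norm_null[OF v False] by simp
qed

lemma Y_dual_norm_least:
  assumes K: "\<And>v. v \<in> Y \<Longrightarrow> f v \<le> K * nY v"
  shows "Y_dual_norm T A f \<le> K"
  unfolding Y_dual_norm_def
  by (rule cSUP_least) (use nontrivial K nonzero_Y_norm_pos in \<open>auto simp: divide_le_eq\<close>)

lemma op_Aa_bounded: obtains K where "K \<ge> 0" "\<And>w v. w \<in> Y \<Longrightarrow> v \<in> Y \<Longrightarrow> a_a w v \<le> K * nY w * nY v"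
proof -
  obtain C where C: "C \<ge> 0" "\<And>w v. w \<in> Y \<Longrightarrow> v \<in> Y \<Longrightarrow> \<bar>a w v\<bar> \<le> C * (L2_norm T w * L2_norm T v)"
    by (rule op_A_bounded) blast
  obtain L where L: "L \<ge> 0" "\<And>v. v \<in> Y \<Longrightarrow> L2_norm T v \<le> L * nY v" by (rule L2_norm_le_Y_norm) blast
  have "a_a w v \<le> (C * L * L) * nY w * nY v" if wv: "w \<in> Y" "v \<in> Y" for w v
  proof -
    have "a_a w v \<le> C * (L2_norm T w * L2_norm T v)"
      using C(2)[OF wv] C(2)[OF wv(2,1)] by (simp add: op_Aa_def adjoint_op_def abs_le_iff mult.commute[of "L2_norm T v"])
    also have "\<dots> \<le> C * ((L * nY w) * (L * nY v))"
      using C(1) L(1) Y_norm_nonneg[OF wv(1)] by (intro mult_left_mono mult_mono L wv L2_norm_nonneg) auto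
    finally show ?thesis by (simp add: ac_simps)
  qed
  then show ?thesis using C(1) L(1) by (intro that[of "C * L * L"]) auto
qed

lemma op_Aa_le:
  assumes w: "w \<in> Y" and v: "v \<in> Y"
  shows "a_a w v \<le> \<alpha> * nY w * nY v"
proof -
  obtain K where K: "K \<ge> 0" "\<And>w v. w \<in> Y \<Longrightarrow> v \<in> Y \<Longrightarrow> a_a w v \<le> K * nY w * nY v" by (rule op_Aa_bounded) blast
  show ?thesis
  proof (cases "nonzero T w")
    case True
    have "bdd_above ((\<lambda>w. Y_dual_norm T A (a_a w) / nY w) ` {w \<in> Y. nonzero T w})"
      by (rule bdd_aboveI[of _ K])
        (use K Y_dual_norm_least[of "a_a _" "K * nY _"] nonzero_Y_norm_pos in \<open>auto simp: divide_le_eq\<close>)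
    then have "Y_dual_norm T A (a_a w) / nY w \<le> \<alpha>"
      unfolding asymmetry_def by (rule cSUP_upper[rotated]) (use w True in auto)
    then have "Y_dual_norm T A (a_a w) \<le> \<alpha> * nY w"
      using nonzero_Y_norm_pos[OF w True] by (simp add: divide_le_eq)
    then have "Y_dual_norm T A (a_a w) * nY v \<le> \<alpha> * nY w * nY v"
      using Y_norm_nonneg[OF v] by (rule mult_right_mono)
    moreover have "a_a w v \<le> Y_dual_norm T A (a_a w) * nY v"
      by (rule Y_dual_norm_upper[OF K(2)[OF w] v])
    ultimately show ?thesis by simp
  next
    case False
    then show ?thesis using K(2)[OF w v] Y_norm_null[OF w False] by simp
  qed
qed

lemma asymmetry_nonneg: "0 \<le> \<alpha>"
proof -
  obtain v where v: "v \<in> Y" "nonzero T v" using nontrivial by blast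
  then have "0 \<le> \<alpha> * nY v * nY v" using op_Aa_le[OF v(1,1)] by (simp add: op_Aa_self)
  then show ?thesis using nonzero_Y_norm_pos[OF v] by (simp add: zero_le_mult_iff)
qed

lemma op_dt_le:
  assumes w: "w \<in> X" and v: "v \<in> Y"
  shows "dt w v \<le> Y_dual_norm T A (dt w) * nY v"
proof -
  obtain L where L: "L \<ge> 0" "\<And>v. v \<in> Y \<Longrightarrow> L2_norm T v \<le> L * nY v" by (rule L2_norm_le_Y_norm) blast
  have "dt w v \<le> (L2_norm T (time_derivative \<iota> T w) * L) * nY v" if "v \<in> Y" for v
    using op_dt_bound[OF w that] mult_left_mono[OF L(2)[OF that] L2_norm_nonneg[of T "time_derivative \<iota> T w"]]
    by (simp add: mult.assoc)
  then show ?thesis using v by (rule Y_dual_norm_upper)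
qed

lemma op_As_Cauchy_Schwarz:
  assumes u: "u \<in> Y" and v: "v \<in> Y"
  shows "a_s u v \<le> nY u * nY v"
proof -
  have "0 \<le> a_s v v * s\<^sup>2 - 2 * a_s u v * s + a_s u u" for s
    using op_As_nonneg[OF Y_lincomb[OF u v, of 1 "- s"]] unfolding op_As_lincomb_self[OF u v]
    by (simp add: algebra_simps)
  from quadratic_nonneg_discriminant[OF this] have "(a_s u v)\<^sup>2 \<le> (nY u * nY v)\<^sup>2"
    by (simp add: power_mult_distrib Y_norm_square u v mult.commute)
  then show ?thesis
    by (rule power2_le_imp_le) (simp add: Y_norm_nonneg u v)
qed

end

section \<open>Scalar inequalities behind the constant c(\<alpha>)\<close>

text \<open>The matrix of the left-hand form has determinant \<open>1\<close> and trace
  \<open>2 + \<alpha>^2\<close>, with \<open>c_const \<alpha>\<close> as its larger eigenvalue. The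
  difference of the two sides is thus a degenerate form: by
  \<open>(s + \<alpha>) (s - \<alpha>) = 4\<close> it is a nonnegative multiple of the square of
  \<open>(s + \<alpha>) m - 2 y\<close>.\<close>

lemma c_const_quadratic:
  assumes "0 \<le> \<alpha>"
  shows "(m + \<alpha> * y)\<^sup>2 + y\<^sup>2 \<le> c_const \<alpha> * (m\<^sup>2 + y\<^sup>2)"
proof -
  define s where "s = sqrt (\<alpha>\<^sup>2 + 4)"
  have s2: "s * s = \<alpha> * \<alpha> + 4" by (simp add: s_def power2_eq_square)
  have prod: "(s + \<alpha>) * (s - \<alpha>) = 4" using s2 by (simp add: algebra_simps)
  have s: "s + \<alpha> > 0" using assms by (simp add: s_def add_pos_nonneg real_sqrt_gt_zero add_nonneg_pos)
  have "0 \<le> ((s + \<alpha>) * m - 2 * y)\<^sup>2" by simp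
  also have "\<dots> = (s + \<alpha>) * ((s + \<alpha>) * m\<^sup>2 - 4 * m * y) + 4 * y\<^sup>2"
    by (simp add: power2_eq_square algebra_simps)
  also have "4 * y\<^sup>2 = (s + \<alpha>) * ((s - \<alpha>) * y\<^sup>2)"
    by (simp only: mult.assoc[symmetric] prod)
  also have "(s + \<alpha>) * ((s + \<alpha>) * m\<^sup>2 - 4 * m * y) + (s + \<alpha>) * ((s - \<alpha>) * y\<^sup>2)
      = (s + \<alpha>) * ((s + \<alpha>) * m\<^sup>2 - 4 * m * y + (s - \<alpha>) * y\<^sup>2)"
    by (simp add: distrib_left)
  finally have "0 \<le> (s + \<alpha>) * m\<^sup>2 - 4 * m * y + (s - \<alpha>) * y\<^sup>2"
    using s by (simp add: zero_le_mult_iff)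
  then have "0 \<le> \<alpha> / 2 * ((s + \<alpha>) * m\<^sup>2 - 4 * m * y + (s - \<alpha>) * y\<^sup>2)"
    using assms by (intro mult_nonneg_nonneg) auto
  also have "\<dots> = c_const \<alpha> * (m\<^sup>2 + y\<^sup>2) - ((m + \<alpha> * y)\<^sup>2 + y\<^sup>2)"
    unfolding c_const_def s_def[symmetric] by (simp add: power2_eq_square field_simps)
  finally show ?thesis by simp
qed

lemma c_const_ge_1: "0 \<le> \<alpha> \<Longrightarrow> 1 \<le> c_const \<alpha>"
  unfolding c_const_def by (simp add: add_nonneg_nonneg)

lemma sum_products_le_sqrt:
  fixes x y z w :: real
  shows "x * y + z * w \<le> sqrt (x\<^sup>2 + z\<^sup>2) * sqrt (y\<^sup>2 + w\<^sup>2)"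
proof (rule power2_le_imp_le)
  have "(sqrt (x\<^sup>2 + z\<^sup>2) * sqrt (y\<^sup>2 + w\<^sup>2))\<^sup>2 = (x\<^sup>2 + z\<^sup>2) * (y\<^sup>2 + w\<^sup>2)"
    by (simp add: power_mult_distrib)
  also have "\<dots> = (x * y + z * w)\<^sup>2 + (x * w - z * y)\<^sup>2"
    by (simp add: power2_eq_square algebra_simps)
  finally show "(x * y + z * w)\<^sup>2 \<le> (sqrt (x\<^sup>2 + z\<^sup>2) * sqrt (y\<^sup>2 + w\<^sup>2))\<^sup>2"
    by simp
qed simp

section \<open>Residual norm and quasi-optimality\<close>

context parabolic
begin

text \<open>The function \<open>r = lam - e\<close> is the Riesz lift of
  \<open>d_t e + A_a e\<close>, so the dual norm of \<open>d_t e\<close> is at most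
  \<open>nY r + \<alpha> * nY e\<close>. Expanding the square of \<open>r\<close> and inserting the
  energy formula shows that \<open>r\<close>, \<open>e\<close> and the final trace together have
  exactly the squared size of \<open>lam\<close> and the initial trace.\<close>

lemma X_norm_le_residual:
  assumes e: "e \<in> X" and lam: "lam \<in> Y" and lift: "\<And>v. v \<in> Y \<Longrightarrow> a_s lam v = op_B \<iota> T A e v"
  shows "(X_norm \<iota> T A e)\<^sup>2 \<le> c_const \<alpha> * ((nY lam)\<^sup>2 + (norm (\<gamma> 0 e))\<^sup>2)"
proof -
  have eY: "e \<in> Y" by (rule X_subset_Y[OF e])
  define r where "r = (\<lambda>t. 1 *\<^sub>R lam t + (-1) *\<^sub>R e t)"
  have rY: "r \<in> Y" unfolding r_def by (rule Y_lincomb[OF lam eY])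
  define N where "N = Y_dual_norm T A (dt e)"
  have dt: "dt e v = a_s r v + a_a v e" if v: "v \<in> Y" for v
    using lift[OF v] op_As_lincomb_left[OF lam eY v, of 1 "-1"] op_A_split[of e v] op_Aa_skew[of e v]
    by (simp add: op_B_def r_def)
  have "dt e v \<le> (nY r + \<alpha> * nY e) * nY v" if v: "v \<in> Y" for v
    using op_As_Cauchy_Schwarz[OF rY v] op_Aa_le[OF v eY] by (simp add: dt[OF v] algebra_simps)
  then have N: "N \<le> nY r + \<alpha> * nY e" unfolding N_def by (rule Y_dual_norm_least)
  \<comment> \<open>Needed before squaring. The bound is applied to \<open>v\<close> and to
    \<open>- v\<close>, the latter written as a linear combination, and the two are added.\<close>
  have N0: "0 \<le> N"
  proof -
    obtain v where v: "v \<in> Y" "nonzero T v" using nontrivial by blast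
    have "0 \<le> N * nY v + N * nY v"
    proof -
      have m: "(\<lambda>t. (-1) *\<^sub>R v t + 0 *\<^sub>R v t) \<in> Y" by (rule Y_lincomb[OF v(1) v(1)])
      have "nY (\<lambda>t. (-1) *\<^sub>R v t + 0 *\<^sub>R v t) = nY v"
        unfolding Y_norm_def op_As_lincomb_self[OF v(1) v(1)] by simp
      then have "- dt e v \<le> N * nY v"
        using op_dt_le[OF e m] op_dt_lincomb_right[OF e v(1) v(1), of "-1" 0] by (simp add: N_def)
      then show ?thesis using op_dt_le[OF e v(1)] unfolding N_def by linarith
    qed
    then show ?thesis using nonzero_Y_norm_pos[OF v] by (simp add: zero_le_mult_iff)
  qed
  have "(X_norm \<iota> T A e)\<^sup>2 = N\<^sup>2 + (nY e)\<^sup>2 + (norm (\<gamma> T e))\<^sup>2"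
    by (simp add: X_norm_def N_def)
  also have "\<dots> \<le> (nY r + \<alpha> * nY e)\<^sup>2 + (nY e)\<^sup>2 + (norm (\<gamma> T e))\<^sup>2"
    using power_mono[OF N N0, of 2] by simp
  also have "\<dots> \<le> c_const \<alpha> * ((nY r)\<^sup>2 + (nY e)\<^sup>2) + c_const \<alpha> * (norm (\<gamma> T e))\<^sup>2"
    using c_const_quadratic[OF asymmetry_nonneg, of "nY r" "nY e"]
      mult_right_mono[OF c_const_ge_1[OF asymmetry_nonneg], of "(norm (\<gamma> T e))\<^sup>2"] by simp
  also have "\<dots> = c_const \<alpha> * ((nY r)\<^sup>2 + (nY e)\<^sup>2 + (norm (\<gamma> T e))\<^sup>2)"
    by (simp add: distrib_left)
  also have "(nY r)\<^sup>2 + (nY e)\<^sup>2 + (norm (\<gamma> T e))\<^sup>2 = (nY lam)\<^sup>2 + (norm (\<gamma> 0 e))\<^sup>2"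
  proof -
    have "(nY r)\<^sup>2 = a_s lam lam - 2 * a_s lam e + a_s e e"
      unfolding Y_norm_square[OF rY] unfolding r_def op_As_lincomb_self[OF lam eY] by simp
    moreover have "a_s lam e = dt e e + a_s e e"
      using lift[OF eY] op_A_split[of e e] by (simp add: op_B_def op_Aa_self)
    ultimately show ?thesis
      using trace_energy[OF T_pos e] by (simp add: Y_norm_square eY lam)
  qed
  finally show ?thesis .
qed

text \<open>For a functional \<open>G\<close> of norm at most \<open>N\<close>, the inequality \<open>2 G(x) - \<parallel>x\<parallel>\<^sup>2 \<le> N\<^sup>2\<close> at
  \<open>x = s p - v\<close> replaces the Riesz representative of \<open>G\<close>.\<close>
lemma residual_le_X_norm:
  assumes v: "v \<in> X" and p: "p \<in> Y"
  shows "op_B \<iota> T A v p + h \<bullet> \<gamma> 0 v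
    \<le> sqrt ((nY p)\<^sup>2 + (norm h)\<^sup>2) * (sqrt (c_const \<alpha>) * X_norm \<iota> T A v)"
proof -
  have vY: "v \<in> Y" by (rule X_subset_Y[OF v])
  define N where "N = Y_dual_norm T A (dt v)"
  define N' where "N' = N + \<alpha> * nY v"
  define f where "f = op_B \<iota> T A v p"
  \<comment> \<open>If \<open>q\<close> denotes the Riesz lift of \<open>d_t v + A_a v\<close>, then
    \<open>B v\<close> has the lift \<open>q + v\<close>, whose squared norm is that of
    \<open>q\<close> plus \<open>2 * dt v v + (nY v)\<^sup>2\<close>. Thus \<open>M\<close> bounds
    the squared dual norm of \<open>B v\<close>.\<close>
  define M where "M = N'\<^sup>2 + 2 * dt v v + (nY v)\<^sup>2"
  have G: "dt v x + a_a v x \<le> N' * nY x" if x: "x \<in> Y" for x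
    using op_dt_le[OF v x] op_Aa_le[OF vY x] by (simp add: N'_def N_def algebra_simps)
  have quad: "0 \<le> (nY p)\<^sup>2 * s\<^sup>2 - 2 * f * s + M" for s
  proof -
    define x where "x = (\<lambda>t. s *\<^sub>R p t + (-1) *\<^sub>R v t)"
    have xY: "x \<in> Y" unfolding x_def by (rule Y_lincomb[OF p vY])
    have "2 * (dt v x + a_a v x) \<le> 2 * (N' * nY x)" using G[OF xY] by simp
    also have "\<dots> \<le> N'\<^sup>2 + (nY x)\<^sup>2" using sum_squares_bound[of N' "nY x"] by simp
    also have "(nY x)\<^sup>2 = s\<^sup>2 * (nY p)\<^sup>2 - 2 * s * a_s v p + (nY v)\<^sup>2"
      unfolding Y_norm_square[OF xY] unfolding x_def op_As_lincomb_self[OF p vY]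
      by (simp add: Y_norm_square p vY op_As_commute[of p v])
    also have "dt v x + a_a v x = s * (dt v p + a_a v p) - dt v v"
      unfolding x_def op_dt_lincomb_right[OF v p vY] op_Aa_lincomb_right[OF p vY vY]
      by (simp add: op_Aa_self algebra_simps)
    finally show ?thesis
      by (simp add: f_def M_def op_B_def op_A_split algebra_simps)
  qed
  have fM: "f\<^sup>2 \<le> (nY p)\<^sup>2 * M" by (rule quadratic_nonneg_discriminant[OF quad])
  have M0: "0 \<le> M" using quad[of 0] by simp
  have total: "M + (norm (\<gamma> 0 v))\<^sup>2 \<le> c_const \<alpha> * (X_norm \<iota> T A v)\<^sup>2"
  proof -
    \<comment> \<open>The energy formula trades \<open>2 * dt v v\<close> and the initial trace for
      the final trace, which is the one occurring in the \<open>X\<close>-norm.\<close>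
    have "M + (norm (\<gamma> 0 v))\<^sup>2 = ((N + \<alpha> * nY v)\<^sup>2 + (nY v)\<^sup>2) + (norm (\<gamma> T v))\<^sup>2"
      using trace_energy[OF T_pos v] by (simp add: M_def N'_def)
    also have "\<dots> \<le> c_const \<alpha> * (N\<^sup>2 + (nY v)\<^sup>2) + c_const \<alpha> * (norm (\<gamma> T v))\<^sup>2"
      using c_const_quadratic[OF asymmetry_nonneg, of N "nY v"]
        mult_right_mono[OF c_const_ge_1[OF asymmetry_nonneg], of "(norm (\<gamma> T v))\<^sup>2"] by simp
    also have "\<dots> = c_const \<alpha> * (X_norm \<iota> T A v)\<^sup>2"
      by (simp add: X_norm_def N_def distrib_left add.commute add.left_commute)
    finally show ?thesis .
  qed
  have "f \<le> nY p * sqrt M"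
  proof (rule power2_le_imp_le)
    show "f\<^sup>2 \<le> (nY p * sqrt M)\<^sup>2" using fM M0 by (simp add: power_mult_distrib)
    show "0 \<le> nY p * sqrt M" using Y_norm_nonneg[OF p] M0 by simp
  qed
  moreover have "h \<bullet> \<gamma> 0 v \<le> norm h * norm (\<gamma> 0 v)" by (rule norm_cauchy_schwarz)
  ultimately have "f + h \<bullet> \<gamma> 0 v \<le> nY p * sqrt M + norm h * norm (\<gamma> 0 v)" by simp
  also have "\<dots> \<le> sqrt ((nY p)\<^sup>2 + (norm h)\<^sup>2) * sqrt ((sqrt M)\<^sup>2 + (norm (\<gamma> 0 v))\<^sup>2)"
    by (rule sum_products_le_sqrt)
  also have "\<dots> \<le> sqrt ((nY p)\<^sup>2 + (norm h)\<^sup>2) * (sqrt (c_const \<alpha>) * X_norm \<iota> T A v)"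
  proof (rule mult_left_mono)
    have "sqrt ((sqrt M)\<^sup>2 + (norm (\<gamma> 0 v))\<^sup>2) \<le> sqrt (c_const \<alpha> * (X_norm \<iota> T A v)\<^sup>2)"
      using total M0 by simp
    also have "\<dots> = sqrt (c_const \<alpha>) * X_norm \<iota> T A v"
      by (simp add: real_sqrt_mult X_norm_def)
    finally show "sqrt ((sqrt M)\<^sup>2 + (norm (\<gamma> 0 v))\<^sup>2) \<le> sqrt (c_const \<alpha>) * X_norm \<iota> T A v" .
  qed simp
  finally show ?thesis by (simp add: f_def)
qed

lemma X_norm_nonneg: "0 \<le> X_norm \<iota> T A w"
  by (simp add: X_norm_def)

lemma X_diff: "u \<in> X \<Longrightarrow> w \<in> X \<Longrightarrow> (\<lambda>t. u t - w t) \<in> X"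
  using X_space_lincomb(1)[of u \<iota> T w 1 "-1"] by simp

lemma Y_diff: "u \<in> Y \<Longrightarrow> w \<in> Y \<Longrightarrow> (\<lambda>t. u t - w t) \<in> Y"
  using Y_lincomb[of u w 1 "-1"] by simp

lemma op_B_diff: "u \<in> X \<Longrightarrow> w \<in> X \<Longrightarrow> v \<in> Y \<Longrightarrow>
    op_B \<iota> T A (\<lambda>t. u t - w t) v = op_B \<iota> T A u v - op_B \<iota> T A w v"
  using op_dt_lincomb_left[of u \<iota> T w v 1 "-1"] op_A_lincomb_left[of u w v 1 "-1"]
  by (simp add: op_B_def X_subset_Y)

lemma trace_0_diff: "u \<in> X \<Longrightarrow> w \<in> X \<Longrightarrow> \<gamma> 0 (\<lambda>t. u t - w t) = \<gamma> 0 u - \<gamma> 0 w"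
  using trace_at_lincomb[OF T_pos, of u \<iota> w 0 1 "-1"] T_pos by simp

end

section \<open>The dependence on \<rho> and the quasi-optimality bound\<close>

text \<open>Removing \<open>1 + \<rho>^2\<close> from both sides leaves
  \<open>\<rho>^2 / (\<rho> + 1/2)^2 \<le> 5 \<rho> / (4 \<rho> + 4)\<close>. After clearing
  denominators the difference is \<open>- \<rho> (\<rho>^2 + \<rho> + 5/4)\<close>.\<close>

lemma estimate_constant:
  assumes "0 \<le> (\<rho>::real)"
  shows "1 + \<rho>\<^sup>2 * (1 + 1 / (\<rho> + 1/2)\<^sup>2) \<le> \<rho>\<^sup>2 + (9 * \<rho> + 4) / (4 * \<rho> + 4)"
proof -
  have h: "\<rho> + 1/2 > 0" "4 * \<rho> + 4 > 0" using assms by auto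
  have "\<rho>\<^sup>2 / (\<rho> + 1/2)\<^sup>2 \<le> 5 * \<rho> / (4 * \<rho> + 4)"
  proof (subst frac_le_eq)
    have "\<rho>\<^sup>2 * (4 * \<rho> + 4) - 5 * \<rho> * (\<rho> + 1/2)\<^sup>2 = - (\<rho> * (\<rho>\<^sup>2 + \<rho> + 5/4))"
      by (simp add: power2_eq_square field_simps)
    also have "\<dots> \<le> 0" using assms by simp
    finally show "(\<rho>\<^sup>2 * (4 * \<rho> + 4) - 5 * \<rho> * (\<rho> + 1/2)\<^sup>2) / ((\<rho> + 1/2)\<^sup>2 * (4 * \<rho> + 4)) \<le> 0"
      using h by (intro divide_nonpos_pos) auto
  qed (use h in auto)
  also have "\<dots> = (9 * \<rho> + 4) / (4 * \<rho> + 4) - 1" using h by (simp add: field_simps)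
  finally show ?thesis by (simp add: distrib_left)
qed

theorem theorem5p1:
  fixes \<iota> :: "'v::{real_inner,banach} \<Rightarrow>\<^sub>L 'h::{real_inner,banach}"
    and T :: real
    and A :: "real \<Rightarrow> 'v \<Rightarrow>\<^sub>L 'v \<Rightarrow>\<^sub>L real"
    and \<Delta> :: "'i set" and infty :: 'i
    and Xd Yd :: "'i \<Rightarrow> (real \<Rightarrow> 'v) set"
    and l :: "(real \<Rightarrow> 'v) \<Rightarrow> real" and u0 :: 'h
    and \<delta> :: 'i
    and lam_d u_d lam u :: "real \<Rightarrow> 'v"
    and \<rho> :: real
  assumes "gelfand_triple \<iota>"
    and "T > 0"
    and "admissible_operator T A"
    and "discretization_family \<iota> T A \<Delta> infty Xd Yd"
    and "l \<in> Y_dual T"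
    and "\<delta> \<in> \<Delta>"
    and "saddle_point_solution \<iota> T A (Xd \<delta>) (Yd \<delta>) l u0 lam_d u_d"
    and "lam \<in> Y_space T"
    and "\<forall>v\<in>Y_space T. op_As T A lam v = l v - op_B \<iota> T A u_d v"
    and "\<rho> \<ge> 0"
    and "Y_norm T A (\<lambda>t. lam t - lam_d t)
           \<le> \<rho> * sqrt ((Y_norm T A lam_d)\<^sup>2
                       + (1 + 1 / (\<rho> + 1/2)\<^sup>2) * (norm (u0 - trace_at \<iota> T 0 u_d))\<^sup>2)"
    and "u \<in> X_space \<iota> T"
    and "\<forall>v\<in>Y_space T. op_B \<iota> T A u v = l v"
    and "trace_at \<iota> T 0 u = u0"
  shows "X_norm \<iota> T A (\<lambda>t. u t - u_d t)
           \<le> c_const (asymmetry T A) * sqrt (\<rho>\<^sup>2 + (9 * \<rho> + 4) / (4 * \<rho> + 4))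
              * (INF w\<in>Xd \<delta>. X_norm \<iota> T A (\<lambda>t. u t - w t))"
proof -
  have XS: "closed_nontrivial_subspace T (X_norm \<iota> T A) (X_space \<iota> T) (Xd \<delta>)"
    and YS: "closed_nontrivial_subspace T (Y_norm T A) (Y_space T) (Yd \<delta>)"
    using assms(4,6) by (auto simp: discretization_family_def)
  interpret parabolic \<iota> T A
    using assms(2,3) YS by unfold_locales (auto simp: closed_nontrivial_subspace_def)
  have lam_d: "lam_d \<in> Yd \<delta>" and u_d: "u_d \<in> Xd \<delta>"
    and sad1: "\<And>v. v \<in> Yd \<delta> \<Longrightarrow> a_s lam_d v + op_B \<iota> T A u_d v = l v"
    and sad2: "\<And>w. w \<in> Xd \<delta> \<Longrightarrow> op_B \<iota> T A w lam_d + (u0 - \<gamma> 0 u_d) \<bullet> \<gamma> 0 w = 0"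
    using assms(7) by (auto simp: saddle_point_solution_def)
  have subX: "Xd \<delta> \<subseteq> X" and subY: "Yd \<delta> \<subseteq> Y"
    using XS YS by (auto simp: closed_nontrivial_subspace_def)
  have lamY: "lam \<in> Y" and uX: "u \<in> X" and u_dX: "u_d \<in> X" and lam_dY: "lam_d \<in> Y"
    using assms(8,12) subX subY u_d lam_d by auto
  define e where "e = (\<lambda>t. u t - u_d t)"
  define \<mu> where "\<mu> = u0 - \<gamma> 0 u_d"
  define c where "c = c_const (asymmetry T A)"
  define \<kappa> where "\<kappa> = 1 + 1 / (\<rho> + 1/2)\<^sup>2"
  define S where "S = (nY lam_d)\<^sup>2 + (norm \<mu>)\<^sup>2"
  have c1: "1 \<le> c" unfolding c_def by (rule c_const_ge_1[OF asymmetry_nonneg])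
  have \<kappa>1: "1 \<le> \<kappa>" by (simp add: \<kappa>_def)
  have S0: "0 \<le> S" by (simp add: S_def)
  have eX: "e \<in> X" unfolding e_def by (rule X_diff[OF uX u_dX])
  have lift: "a_s lam v = op_B \<iota> T A e v" if "v \<in> Y" for v
    using assms(9,13) that op_B_diff[OF uX u_dX that] by (simp add: e_def)
  have \<gamma>e: "\<gamma> 0 e = \<mu>" using trace_0_diff[OF uX u_dX] assms(14) by (simp add: e_def \<mu>_def)
  have upper: "(X_norm \<iota> T A e)\<^sup>2 \<le> c * ((nY lam)\<^sup>2 + (norm \<mu>)\<^sup>2)"
    using X_norm_le_residual[OF eX lamY lift] by (simp add: c_def \<gamma>e)
  \<comment> \<open>The first saddle point equation makes \<open>lam_d\<close> the orthogonal
    projection of \<open>lam\<close>; this single test suffices for the Pythagorean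
    identity.\<close>
  have galerkin: "a_s lam lam_d = a_s lam_d lam_d"
    using sad1[OF lam_d] assms(9) lam_dY by simp
  have "(nY (\<lambda>t. lam t - lam_d t))\<^sup>2 = (nY lam)\<^sup>2 - (nY lam_d)\<^sup>2"
    using op_As_lincomb_self[OF lamY lam_dY, of 1 "-1"] galerkin
    by (simp add: Y_norm_square Y_diff lamY lam_dY)
  moreover have "(nY (\<lambda>t. lam t - lam_d t))\<^sup>2 \<le> (\<rho> * sqrt ((nY lam_d)\<^sup>2 + \<kappa> * (norm \<mu>)\<^sup>2))\<^sup>2"
    using assms(11) Y_norm_nonneg[OF Y_diff[OF lamY lam_dY]] unfolding \<kappa>_def \<mu>_def by (rule power_mono)
  ultimately have "(nY lam)\<^sup>2 \<le> (nY lam_d)\<^sup>2 + \<rho>\<^sup>2 * ((nY lam_d)\<^sup>2 + \<kappa> * (norm \<mu>)\<^sup>2)"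
    using \<kappa>1 by (simp add: power_mult_distrib)
  \<comment> \<open>Raising the weight of \<open>lam_d\<close> from \<open>1\<close> to
    \<open>\<kappa>\<close> allows \<open>S\<close> to be factored out.\<close>
  also have "\<dots> \<le> (nY lam_d)\<^sup>2 + \<rho>\<^sup>2 * (\<kappa> * (nY lam_d)\<^sup>2 + \<kappa> * (norm \<mu>)\<^sup>2)"
    using mult_right_mono[OF \<kappa>1, of "(nY lam_d)\<^sup>2"] by (intro add_left_mono mult_left_mono add_right_mono) auto
  finally have "(nY lam)\<^sup>2 + (norm \<mu>)\<^sup>2 \<le> (1 + \<rho>\<^sup>2 * \<kappa>) * S"
    by (simp add: S_def algebra_simps)
  also have "\<dots> \<le> (\<rho>\<^sup>2 + (9 * \<rho> + 4) / (4 * \<rho> + 4)) * S"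
    unfolding \<kappa>_def by (rule mult_right_mono[OF estimate_constant[OF assms(10)] S0])
  finally have residual: "(nY lam)\<^sup>2 + (norm \<mu>)\<^sup>2 \<le> (\<rho>\<^sup>2 + (9 * \<rho> + 4) / (4 * \<rho> + 4)) * S" .
  define R where "R = \<rho>\<^sup>2 + (9 * \<rho> + 4) / (4 * \<rho> + 4)"
  have "0 < (9 * \<rho> + 4) / (4 * \<rho> + 4)" using assms(10) by (intro divide_pos_pos) auto
  then have R0: "0 < R" by (simp add: R_def add_nonneg_pos)
  have "(X_norm \<iota> T A e)\<^sup>2 \<le> c * (R * S)"
    unfolding R_def by (rule order_trans[OF upper mult_left_mono[OF residual]]) (use c1 in simp)
  then have "X_norm \<iota> T A e \<le> sqrt (c * (R * S))"
    using X_norm_nonneg by (intro real_le_rsqrt)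
  then have Xe: "X_norm \<iota> T A e \<le> sqrt c * sqrt R * sqrt S"
    by (simp add: real_sqrt_mult mult.assoc)
  \<comment> \<open>The second saddle point equation annihilates both \<open>u_d\<close> and
    \<open>w\<close>, so \<open>e\<close> may be exchanged for \<open>u - w\<close> in the
    expression equal to \<open>S\<close>. Bounding it by the residual estimate produces a factor
    \<open>sqrt S\<close>, which is then cancelled.\<close>
  have best: "sqrt S \<le> sqrt c * X_norm \<iota> T A (\<lambda>t. u t - w t)" if w: "w \<in> Xd \<delta>" for w
  proof -
    have wX: "w \<in> X" using w subX by blast
    have "S = op_B \<iota> T A e lam_d + \<mu> \<bullet> \<gamma> 0 e"
      using lift[OF lam_dY] galerkin by (simp add: S_def Y_norm_square lam_dY \<gamma>e power2_norm_eq_inner)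
    also have "\<dots> = op_B \<iota> T A (\<lambda>t. u t - w t) lam_d + \<mu> \<bullet> \<gamma> 0 (\<lambda>t. u t - w t)"
      using sad2[OF w] sad2[OF u_d]
      by (simp add: e_def op_B_diff uX u_dX wX lam_dY trace_0_diff inner_diff_right \<mu>_def)
    also have "\<dots> \<le> sqrt S * (sqrt c * X_norm \<iota> T A (\<lambda>t. u t - w t))"
      unfolding S_def c_def by (rule residual_le_X_norm[OF X_diff[OF uX wX] lam_dY])
    finally have prod: "sqrt S * sqrt S \<le> sqrt S * (sqrt c * X_norm \<iota> T A (\<lambda>t. u t - w t))"
      using S0 by simp
    show ?thesis
    proof (cases "S = 0")
      case False
      then have "0 < sqrt S" using S0 by simp
      with prod show ?thesis by (rule mult_left_le_imp_le)
    qed (use c1 X_norm_nonneg[of "\<lambda>t. u t - w t"] in simp)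
  qed
  have K: "0 < c * sqrt R" using c1 R0 by simp
  \<comment> \<open>The positive constant is moved to the left so that the quotient is a lower bound
    for every member of the infimum. One factor \<open>sqrt c\<close> comes from \<open>Xe\<close>,
    the other from \<open>best\<close>.\<close>
  have "X_norm \<iota> T A e / (c * sqrt R) \<le> (INF w\<in>Xd \<delta>. X_norm \<iota> T A (\<lambda>t. u t - w t))"
  proof (rule cINF_greatest)
    show "Xd \<delta> \<noteq> {}" using u_d by blast
    fix w assume "w \<in> Xd \<delta>"
    from best[OF this] have "sqrt c * sqrt R * sqrt S \<le> sqrt c * sqrt R * (sqrt c * X_norm \<iota> T A (\<lambda>t. u t - w t))"
      using c1 R0 by (intro mult_left_mono) auto
    also have "\<dots> = (sqrt c * sqrt c) * sqrt R * X_norm \<iota> T A (\<lambda>t. u t - w t)"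
      by (simp only: ac_simps)
    also have "sqrt c * sqrt c = c" using c1 by simp
    finally show "X_norm \<iota> T A e / (c * sqrt R) \<le> X_norm \<iota> T A (\<lambda>t. u t - w t)"
      using Xe K by (simp add: divide_le_eq mult.commute)
  qed
  then show ?thesis
    using K by (simp add: divide_le_eq e_def c_def R_def mult.commute)
qed

end
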